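(* Let $(M,h,\nabla)$ be a quasi-statistical manifold such that $\nabla$ is flat. Let $h^{S^*}$ be the Sasaki $(0,2)$-tensor field on $T^*M$ with respect to $\nabla$, and let $\tilde\nabla$ be the affine connection on $T^*M$ which is the pull-back of $\hat\nabla$. Then $(T^*M,h^{S^*},\tilde\nabla)$ is a flat quasi-statistical manifold, i.e. it is a quasi-statistical manifold and $\tilde\nabla$ is flat.
   Context: A quasi-statistical manifold $(N,k,D)$ is a smooth manifold $N$ with a non-degenerate $(0,2)$-tensor field $k$ (not necessarily symmetric) and an affine connection $D$ (possibly with torsion $T^D(A,B)=D_AB-D_BA-[A,B]$) such that $(D_Ak)(B,C)-(D_Bk)(A,C)+k(T^D(A,B),C)=0$ for all vector fields $A,B,C$ on $N$. A connection is flat if its curvature vanishes (torsion is allowed). $h$ also denotes the isomorphism $TM\to T^*M$, $h(X)=h(X,\cdot)$, with inverse $h^{-1}$. With coordinates $(\tilde x^i,y_i)$ on $T^*M$ induced by $(x^i)$ on $M$ and $\nabla_{\partial/\partial x^i}\partial/\partial x^j=\Gamma^k_{ij}\partial/\partial x^k$, the horizontal lift of $X=X^i\partial/\partial x^i$ is $X^H=X^i\big(\partial/\partial\tilde x^i+y_k\Gamma^k_{il}\,\partial/\partial y_l\big)$ and the vertical lift of $\alpha=\alpha_idx^i$ is $\alpha^V=\alpha_i\,\partial/\partial y_i$. The Sasaki tensor is defined by $h^{S^*}(X^H,Y^H)=h(X,Y)$, $h^{S^*}(\alpha^V,\beta^V)=h(h^{-1}(\alpha),h^{-1}(\beta))$,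 $h^{S^*}(\alpha^V,Y^H)=h^{S^*}(Y^H,\alpha^V)=0$. On $TM\oplus T^*M$ one has the connection $\hat\nabla_{X+\alpha}(Y+\beta)=\nabla_XY+h(\nabla_X(h^{-1}(\beta)))$. Identifying $T(T^*M)$ with $\pi^*(TM\oplus T^*M)$ ($\pi:T^*M\to M$) by the horizontal/vertical splitting, the pull-back connection $\tilde\nabla$ is the affine connection on $T^*M$ determined by $\tilde\nabla_{X^H}Y^H=(\nabla_XY)^H$, $\tilde\nabla_{X^H}\beta^V=\big(h(\nabla_X(h^{-1}(\beta)))\big)^V$, $\tilde\nabla_{\alpha^V}Y^H=0$, $\tilde\nabla_{\alpha^V}\beta^V=0$ for vector fields $X,Y$ and 1-forms $\alpha,\beta$ on $M$. *)

theory Defs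
  imports "HOL-Analysis.Analysis"
begin

section \<open>Smooth maps between Euclidean spaces\<close>

text \<open>Both notions are meant for open \<open>S\<close>, so that the values outside \<open>S\<close> play no role.\<close>

primrec Ck_on :: "nat \<Rightarrow> ('a::euclidean_space \<Rightarrow> 'b::euclidean_space) \<Rightarrow> 'a set \<Rightarrow> bool" where
  "Ck_on 0 f S \<longleftrightarrow> continuous_on S f"
| "Ck_on (Suc k) f S \<longleftrightarrow>
     f differentiable_on S \<and> (\<forall>v. Ck_on k (\<lambda>x. frechet_derivative f (at x) v) S)"

definition smooth_on :: "('a::euclidean_space \<Rightarrow> 'b::euclidean_space) \<Rightarrow> 'a set \<Rightarrow> bool" where
  "smooth_on f S \<longleftrightarrow> (\<forall>k. Ck_on k f S)"


section \<open>Smooth manifolds\<close>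

text \<open>
  A smooth manifold is given by a smooth atlas \<open>A\<close>, not necessarily maximal: the underlying set is
  the union of the chart domains and the topology is the one making all charts homeomorphisms onto
  open sets.  It has to be Hausdorff and second countable.  The values of a coordinate map outside
  the domain of its chart are irrelevant.
\<close>

type_synonym ('m, 'e) chart = "'m set \<times> ('m \<Rightarrow> 'e)"

definition chart_inv :: "('m, 'e) chart \<Rightarrow> 'e \<Rightarrow> 'm" where
  "chart_inv c = inv_into (fst c) (snd c)"

definition transition :: "('m, 'e) chart \<Rightarrow> ('m, 'e) chart \<Rightarrow> 'e \<Rightarrow> 'e" where
  "transition c d = snd d \<circ> chart_inv c"

definition smooth_atlas :: "('m, 'e::euclidean_space) chart set \<Rightarrow> bool" where
  "smooth_atlas A \<longleftrightarrow>
     (\<forall>c\<in>A. inj_on (snd c) (fst c)) \<and>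
     (\<forall>c\<in>A. \<forall>d\<in>A. open (snd c ` (fst c \<inter> fst d)) \<and>
                   smooth_on (transition c d) (snd c ` (fst c \<inter> fst d)))"

definition points :: "('m, 'e) chart set \<Rightarrow> 'm set" where
  "points A = (\<Union>c\<in>A. fst c)"

definition atlas_open :: "('m, 'e::euclidean_space) chart set \<Rightarrow> 'm set \<Rightarrow> bool" where
  "atlas_open A W \<longleftrightarrow> W \<subseteq> points A \<and> (\<forall>c\<in>A. open (snd c ` (W \<inter> fst c)))"

definition atlas_topology :: "('m, 'e::euclidean_space) chart set \<Rightarrow> 'm topology" where
  "atlas_topology A = topology (atlas_open A)"

lemma openin_atlas_topology:
  assumes "smooth_atlas A"
  shows "openin (atlas_topology A) W \<longleftrightarrow> atlas_open A W"
proof -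
  have "atlas_open A (S \<inter> T)" if "atlas_open A S" "atlas_open A T" for S T
  proof -
    have "snd c ` (S \<inter> T \<inter> fst c) = snd c ` (S \<inter> fst c) \<inter> snd c ` (T \<inter> fst c)" if "c \<in> A" for c
    proof -
      have "inj_on (snd c) (fst c)"
        using assms that by (auto simp: smooth_atlas_def)
      from inj_on_image_Int[OF this, of "S \<inter> fst c" "T \<inter> fst c"] show ?thesis
        by (simp add: Int_ac)
    qed
    then show ?thesis
      using that unfolding atlas_open_def by (auto intro: open_Int)
  qed
  moreover have "atlas_open A (\<Union>K)" if "\<forall>S\<in>K. atlas_open A S" for K
  proof -
    have "snd c ` (\<Union>K \<inter> fst c) = (\<Union>S\<in>K. snd c ` (S \<inter> fst c))" for c
      by blast
    moreover have "open (\<Union>S\<in>K. snd c ` (S \<inter> fst c))" if "c \<in> A" for c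
      using \<open>\<forall>S\<in>K. atlas_open A S\<close> that by (intro open_UN) (auto simp: atlas_open_def)
    moreover have "\<Union>K \<subseteq> points A"
      using that by (auto simp: atlas_open_def)
    ultimately show ?thesis
      unfolding atlas_open_def by metis
  qed
  ultimately have "istopology (atlas_open A)"
    unfolding istopology_def by blast
  then show ?thesis
    by (simp add: atlas_topology_def)
qed

definition smooth_manifold :: "('m, 'e::euclidean_space) chart set \<Rightarrow> bool" where
  "smooth_manifold A \<longleftrightarrow>
     smooth_atlas A \<and> Hausdorff_space (atlas_topology A) \<and> second_countable (atlas_topology A)"

definition smooth_function :: "('m, 'e::euclidean_space) chart set \<Rightarrow> ('m \<Rightarrow> real) \<Rightarrow> bool" where
  "smooth_function A f \<longleftrightarrow> (\<forall>c\<in>A. smooth_on (f \<circ> chart_inv c) (snd c ` fst c))"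


section \<open>Tangent and cotangent vectors\<close>

text \<open>
  A tangent vector at \<open>p\<close> is an equivalence class of pairs of a chart at \<open>p\<close> and a vector of the
  model space, two pairs being equivalent if the derivative of the transition map sends one vector
  to the other.  Such a class contains exactly one vector for every chart at \<open>p\<close>, so it is encoded
  as a function on charts, extended by \<open>0\<close> to everything that is not a chart at \<open>p\<close>.  In
  particular the tangent space at a \<open>p\<close> outside the manifold is \<open>{0}\<close>, so vector fields and 1-forms
  vanish there and can be compared as functions.
\<close>

type_synonym ('m, 'e) tvec = "('m, 'e) chart \<Rightarrow> 'e"
type_synonym ('m, 'e) covec = "('m, 'e) tvec \<Rightarrow> real"
type_synonym ('m, 'e) vfield = "'m \<Rightarrow> ('m, 'e) tvec"
type_synonym ('m, 'e) form = "'m \<Rightarrow> ('m, 'e) covec"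
type_synonym ('m, 'e) tensor = "'m \<Rightarrow> ('m, 'e) tvec \<Rightarrow> ('m, 'e) tvec \<Rightarrow> real"
type_synonym ('m, 'e) connection = "('m, 'e) vfield \<Rightarrow> ('m, 'e) vfield \<Rightarrow> ('m, 'e) vfield"

definition tangent :: "('m, 'e::euclidean_space) chart set \<Rightarrow> 'm \<Rightarrow> ('m, 'e) tvec set" where
  "tangent A p = {v.
     (\<forall>c. c \<notin> A \<or> p \<notin> fst c \<longrightarrow> v c = 0) \<and>
     (\<forall>c\<in>A. \<forall>d\<in>A. p \<in> fst c \<and> p \<in> fst d \<longrightarrow>
        v d = frechet_derivative (transition c d) (at (snd c p)) (v c))}"

text \<open>The tangent vector at \<open>p\<close> whose component in the chart \<open>c\<close> is \<open>a\<close>; for \<open>a\<close> in the standard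
  basis these are the coordinate vectors of \<open>c\<close>.\<close>

definition coord_vec ::
  "('m, 'e::euclidean_space) chart set \<Rightarrow> ('m, 'e) chart \<Rightarrow> 'm \<Rightarrow> 'e \<Rightarrow> ('m, 'e) tvec" where
  "coord_vec A c p a = (\<lambda>d. if d \<in> A \<and> p \<in> fst d
     then frechet_derivative (transition c d) (at (snd c p)) a else 0)"

definition cotangent :: "('m, 'e::euclidean_space) chart set \<Rightarrow> 'm \<Rightarrow> ('m, 'e) covec set" where
  "cotangent A p = {\<alpha>.
     (\<forall>u\<in>tangent A p. \<forall>v\<in>tangent A p. \<alpha> (\<lambda>c. u c + v c) = \<alpha> u + \<alpha> v) \<and>
     (\<forall>r. \<forall>v\<in>tangent A p. \<alpha> (\<lambda>c. r *\<^sub>R v c) = r * \<alpha> v) \<and>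
     (\<forall>v. v \<notin> tangent A p \<longrightarrow> \<alpha> v = 0)}"

definition vector_field :: "('m, 'e::euclidean_space) chart set \<Rightarrow> ('m, 'e) vfield \<Rightarrow> bool" where
  "vector_field A X \<longleftrightarrow>
     (\<forall>p. X p \<in> tangent A p) \<and>
     (\<forall>c\<in>A. smooth_on (\<lambda>x. X (chart_inv c x) c) (snd c ` fst c))"

definition one_form :: "('m, 'e::euclidean_space) chart set \<Rightarrow> ('m, 'e) form \<Rightarrow> bool" where
  "one_form A \<alpha> \<longleftrightarrow>
     (\<forall>p. \<alpha> p \<in> cotangent A p) \<and>
     (\<forall>c\<in>A. \<forall>a\<in>Basis.
        smooth_on (\<lambda>x. \<alpha> (chart_inv c x) (coord_vec A c (chart_inv c x) a)) (snd c ` fst c))"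

definition tensor_field :: "('m, 'e::euclidean_space) chart set \<Rightarrow> ('m, 'e) tensor \<Rightarrow> bool" where
  "tensor_field A k \<longleftrightarrow>
     (\<forall>p\<in>points A. \<forall>u\<in>tangent A p. \<forall>v\<in>tangent A p. \<forall>w\<in>tangent A p. \<forall>r.
        k p (\<lambda>c. u c + v c) w = k p u w + k p v w \<and>
        k p w (\<lambda>c. u c + v c) = k p w u + k p w v \<and>
        k p (\<lambda>c. r *\<^sub>R u c) w = r * k p u w \<and>
        k p w (\<lambda>c. r *\<^sub>R u c) = r * k p w u) \<and>
     (\<forall>c\<in>A. \<forall>a\<in>Basis. \<forall>b\<in>Basis.
        smooth_on (\<lambda>x. k (chart_inv c x) (coord_vec A c (chart_inv c x) a)
                                        (coord_vec A c (chart_inv c x) b)) (snd c ` fst c))"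

definition nondegenerate :: "('m, 'e::euclidean_space) chart set \<Rightarrow> ('m, 'e) tensor \<Rightarrow> bool" where
  "nondegenerate A k \<longleftrightarrow> (\<forall>p\<in>points A. \<forall>u\<in>tangent A p.
     ((\<forall>v\<in>tangent A p. k p u v = 0) \<longrightarrow> u = (\<lambda>_. 0)) \<and>
     ((\<forall>v\<in>tangent A p. k p v u = 0) \<longrightarrow> u = (\<lambda>_. 0)))"

text \<open>The value does not depend on the choice of a chart around a point of the manifold in any of
  the definitions below that make this choice.\<close>

definition chart_at :: "('m, 'e) chart set \<Rightarrow> 'm \<Rightarrow> ('m, 'e) chart" where
  "chart_at A p = (SOME c. c \<in> A \<and> p \<in> fst c)"

definition derivation ::
  "('m, 'e::euclidean_space) chart set \<Rightarrow> ('m, 'e) vfield \<Rightarrow> ('m \<Rightarrow> real) \<Rightarrow> 'm \<Rightarrow> real" where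
  "derivation A X f p = (let c = chart_at A p in
     frechet_derivative (f \<circ> chart_inv c) (at (snd c p)) (X p c))"

definition lie_bracket ::
  "('m, 'e::euclidean_space) chart set \<Rightarrow> ('m, 'e) vfield \<Rightarrow> ('m, 'e) vfield \<Rightarrow> ('m, 'e) vfield" where
  "lie_bracket A X Y p c = (if c \<in> A \<and> p \<in> fst c
     then frechet_derivative (\<lambda>x. Y (chart_inv c x) c) (at (snd c p)) (X p c)
        - frechet_derivative (\<lambda>x. X (chart_inv c x) c) (at (snd c p)) (Y p c)
     else 0)"


section \<open>Affine connections and quasi-statistical manifolds\<close>

definition affine_connection ::
  "('m, 'e::euclidean_space) chart set \<Rightarrow> ('m, 'e) connection \<Rightarrow> bool" where
  "affine_connection A D \<longleftrightarrow>
     (\<forall>X Y. vector_field A X \<and> vector_field A Y \<longrightarrow> vector_field A (D X Y)) \<and>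
     (\<forall>X Y Z. vector_field A X \<and> vector_field A Y \<and> vector_field A Z \<longrightarrow>
        D (\<lambda>p c. X p c + Y p c) Z = (\<lambda>p c. D X Z p c + D Y Z p c) \<and>
        D Z (\<lambda>p c. X p c + Y p c) = (\<lambda>p c. D Z X p c + D Z Y p c)) \<and>
     (\<forall>f X Y. smooth_function A f \<and> vector_field A X \<and> vector_field A Y \<longrightarrow>
        D (\<lambda>p c. f p *\<^sub>R X p c) Y = (\<lambda>p c. f p *\<^sub>R D X Y p c) \<and>
        D X (\<lambda>p c. f p *\<^sub>R Y p c) =
          (\<lambda>p c. derivation A X f p *\<^sub>R Y p c + f p *\<^sub>R D X Y p c))"

definition torsion ::
  "('m, 'e::euclidean_space) chart set \<Rightarrow> ('m, 'e) connection \<Rightarrow>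
     ('m, 'e) vfield \<Rightarrow> ('m, 'e) vfield \<Rightarrow> ('m, 'e) vfield" where
  "torsion A D X Y = (\<lambda>p c. D X Y p c - D Y X p c - lie_bracket A X Y p c)"

definition curvature ::
  "('m, 'e::euclidean_space) chart set \<Rightarrow> ('m, 'e) connection \<Rightarrow>
     ('m, 'e) vfield \<Rightarrow> ('m, 'e) vfield \<Rightarrow> ('m, 'e) vfield \<Rightarrow> ('m, 'e) vfield" where
  "curvature A D X Y Z =
     (\<lambda>p c. D X (D Y Z) p c - D Y (D X Z) p c - D (lie_bracket A X Y) Z p c)"

definition flat :: "('m, 'e::euclidean_space) chart set \<Rightarrow> ('m, 'e) connection \<Rightarrow> bool" where
  "flat A D \<longleftrightarrow> (\<forall>X Y Z. vector_field A X \<and> vector_field A Y \<and> vector_field A Z \<longrightarrow>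
     curvature A D X Y Z = (\<lambda>_ _. 0))"

definition cov_deriv ::
  "('m, 'e::euclidean_space) chart set \<Rightarrow> ('m, 'e) connection \<Rightarrow> ('m, 'e) tensor \<Rightarrow>
     ('m, 'e) vfield \<Rightarrow> ('m, 'e) vfield \<Rightarrow> ('m, 'e) vfield \<Rightarrow> 'm \<Rightarrow> real" where
  "cov_deriv A D k X Y Z p =
     derivation A X (\<lambda>q. k q (Y q) (Z q)) p - k p (D X Y p) (Z p) - k p (Y p) (D X Z p)"

definition quasi_statistical ::
  "('m, 'e::euclidean_space) chart set \<Rightarrow> ('m, 'e) tensor \<Rightarrow> ('m, 'e) connection \<Rightarrow> bool" where
  "quasi_statistical A k D \<longleftrightarrow>
     smooth_manifold A \<and> tensor_field A k \<and> nondegenerate A k \<and> affine_connection A D \<and>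
     (\<forall>X Y Z. vector_field A X \<and> vector_field A Y \<and> vector_field A Z \<longrightarrow>
        (\<forall>p\<in>points A. cov_deriv A D k X Y Z p - cov_deriv A D k Y X Z p
                      + k p (torsion A D X Y p) (Z p) = 0))"


section \<open>The isomorphism between tangent and cotangent spaces\<close>

definition lower ::
  "('m, 'e::euclidean_space) chart set \<Rightarrow> ('m, 'e) tensor \<Rightarrow> 'm \<Rightarrow> ('m, 'e) tvec \<Rightarrow> ('m, 'e) covec" where
  "lower A h p u = (\<lambda>v. if p \<in> points A \<and> v \<in> tangent A p then h p u v else 0)"

definition raise ::
  "('m, 'e::euclidean_space) chart set \<Rightarrow> ('m, 'e) tensor \<Rightarrow> 'm \<Rightarrow> ('m, 'e) covec \<Rightarrow> ('m, 'e) tvec" where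
  "raise A h p = inv_into (tangent A p) (lower A h p)"

text \<open>The cotangent part \<open>(X, \<beta>) \<mapsto> h(\<nabla>\<^sub>X (h\<^sup>-\<^sup>1 \<beta>))\<close> of the connection on the sum of the tangent and
  cotangent bundles; its tangent part is \<open>D\<close> itself.\<close>

definition form_connection ::
  "('m, 'e::euclidean_space) chart set \<Rightarrow> ('m, 'e) tensor \<Rightarrow> ('m, 'e) connection \<Rightarrow>
     ('m, 'e) vfield \<Rightarrow> ('m, 'e) form \<Rightarrow> ('m, 'e) form" where
  "form_connection A h D X \<beta> = (\<lambda>p. lower A h p (D X (\<lambda>q. raise A h q (\<beta> q)) p))"


section \<open>The cotangent bundle\<close>

text \<open>The points of the cotangent bundle are the pairs \<open>(p, \<alpha>)\<close> with \<open>\<alpha>\<close> in the cotangent space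
  at \<open>p\<close>.  The components of \<open>\<alpha>\<close> in a chart are collected into one vector of the model space.\<close>

definition covec_coords ::
  "('m, 'e::euclidean_space) chart set \<Rightarrow> ('m, 'e) chart \<Rightarrow> 'm \<Rightarrow> ('m, 'e) covec \<Rightarrow> 'e" where
  "covec_coords A c p \<alpha> = (\<Sum>l\<in>Basis. \<alpha> (coord_vec A c p l) *\<^sub>R l)"

definition cotangent_chart ::
  "('m, 'e::euclidean_space) chart set \<Rightarrow> ('m, 'e) chart \<Rightarrow>
     ('m \<times> ('m, 'e) covec, 'e \<times> 'e) chart" where
  "cotangent_chart A c =
     ({(p, \<alpha>). p \<in> fst c \<and> \<alpha> \<in> cotangent A p},
      \<lambda>(p, \<alpha>). (snd c p, covec_coords A c p \<alpha>))"

definition cotangent_bundle ::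
  "('m, 'e::euclidean_space) chart set \<Rightarrow> ('m \<times> ('m, 'e) covec, 'e \<times> 'e) chart set" where
  "cotangent_bundle A = cotangent_chart A ` A"

text \<open>
  The vector with coordinates \<open>\<Gamma>\<^sup>k\<^sub>i\<^sub>j\<close> (over \<open>k\<close>) at \<open>p\<close> in the chart \<open>c\<close>, for basis vectors \<open>i\<close> and
  \<open>j\<close>.  Coordinate vector fields are defined on the chart domain only, so \<open>D\<close> is applied to vector
  fields on the manifold which agree with them near \<open>p\<close>; the result depends neither on this
  extension nor on the neighbourhood.
\<close>

definition christoffel ::
  "('m, 'e::euclidean_space) chart set \<Rightarrow> ('m, 'e) connection \<Rightarrow> ('m, 'e) chart \<Rightarrow> 'm \<Rightarrow>
     'e \<Rightarrow> 'e \<Rightarrow> 'e" where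
  "christoffel A D c p i j = (THE w. \<exists>X Y W.
     vector_field A X \<and> vector_field A Y \<and>
     openin (atlas_topology A) W \<and> p \<in> W \<and> W \<subseteq> fst c \<and>
     (\<forall>q\<in>W. X q = coord_vec A c q i \<and> Y q = coord_vec A c q j) \<and>
     w = D X Y p c)"

text \<open>Lifts of a tangent vector \<open>u\<close>, respectively a covector \<open>\<beta>\<close>, at \<open>fst q\<close> to a point \<open>q\<close> of the
  cotangent bundle, in the coordinates of the induced chart.\<close>

definition hlift ::
  "('m, 'e::euclidean_space) chart set \<Rightarrow> ('m, 'e) connection \<Rightarrow> 'm \<times> ('m, 'e) covec \<Rightarrow>
     ('m, 'e) tvec \<Rightarrow> ('m \<times> ('m, 'e) covec, 'e \<times> 'e) tvec" where
  "hlift A D q u =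
     (let p = fst q; c = chart_at A p; y = covec_coords A c p (snd q) in
      coord_vec (cotangent_bundle A) (cotangent_chart A c) q
        (u c, \<Sum>l\<in>Basis. (\<Sum>i\<in>Basis. \<Sum>k\<in>Basis.
                 (u c \<bullet> i) * (y \<bullet> k) * (christoffel A D c p i l \<bullet> k)) *\<^sub>R l))"

definition vlift ::
  "('m, 'e::euclidean_space) chart set \<Rightarrow> 'm \<times> ('m, 'e) covec \<Rightarrow>
     ('m, 'e) covec \<Rightarrow> ('m \<times> ('m, 'e) covec, 'e \<times> 'e) tvec" where
  "vlift A q \<beta> =
     (let p = fst q; c = chart_at A p in
      coord_vec (cotangent_bundle A) (cotangent_chart A c) q (0, covec_coords A c p \<beta>))"

definition hlift_field ::
  "('m, 'e::euclidean_space) chart set \<Rightarrow> ('m, 'e) connection \<Rightarrow> ('m, 'e) vfield \<Rightarrow>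
     ('m \<times> ('m, 'e) covec, 'e \<times> 'e) vfield" where
  "hlift_field A D X = (\<lambda>q. hlift A D q (X (fst q)))"

definition vlift_field ::
  "('m, 'e::euclidean_space) chart set \<Rightarrow> ('m, 'e) form \<Rightarrow>
     ('m \<times> ('m, 'e) covec, 'e \<times> 'e) vfield" where
  "vlift_field A \<beta> = (\<lambda>q. vlift A q (\<beta> (fst q)))"

text \<open>Every tangent vector of the cotangent bundle splits uniquely into a horizontal and a vertical
  lift, so the three defining equations of the Sasaki tensor amount by bilinearity to
  \<open>h\<^sup>S(u\<^sup>H + \<alpha>\<^sup>V, v\<^sup>H + \<beta>\<^sup>V) = h(u, v) + h(h\<^sup>-\<^sup>1 \<alpha>, h\<^sup>-\<^sup>1 \<beta>)\<close>.\<close>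

definition sasaki ::
  "('m, 'e::euclidean_space) chart set \<Rightarrow> ('m, 'e) tensor \<Rightarrow> ('m, 'e) connection \<Rightarrow>
     ('m \<times> ('m, 'e) covec, 'e \<times> 'e) tensor" where
  "sasaki A h D q \<xi> \<eta> = (THE r. \<exists>u v \<alpha> \<beta>.
     u \<in> tangent A (fst q) \<and> v \<in> tangent A (fst q) \<and>
     \<alpha> \<in> cotangent A (fst q) \<and> \<beta> \<in> cotangent A (fst q) \<and>
     \<xi> = (\<lambda>C. hlift A D q u C + vlift A q \<alpha> C) \<and>
     \<eta> = (\<lambda>C. hlift A D q v C + vlift A q \<beta> C) \<and>
     r = h (fst q) u v + h (fst q) (raise A h (fst q) \<alpha>) (raise A h (fst q) \<beta>))"

definition pullback_connection ::
  "('m, 'e::euclidean_space) chart set \<Rightarrow> ('m, 'e) tensor \<Rightarrow> ('m, 'e) connection \<Rightarrow>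
     ('m \<times> ('m, 'e) covec, 'e \<times> 'e) connection \<Rightarrow> bool" where
  "pullback_connection A h D D' \<longleftrightarrow>
     affine_connection (cotangent_bundle A) D' \<and>
     (\<forall>X Y \<alpha> \<beta>. vector_field A X \<and> vector_field A Y \<and> one_form A \<alpha> \<and> one_form A \<beta> \<longrightarrow>
        D' (hlift_field A D X) (hlift_field A D Y) = hlift_field A D (D X Y) \<and>
        D' (hlift_field A D X) (vlift_field A \<beta>) = vlift_field A (form_connection A h D X \<beta>) \<and>
        D' (vlift_field A \<alpha>) (hlift_field A D Y) = (\<lambda>_ _. 0) \<and>
        D' (vlift_field A \<alpha>) (vlift_field A \<beta>) = (\<lambda>_ _. 0))"

end

theory Submission
  imports Defs "HOL-Computational_Algebra.Polynomial"
begin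

text \<open>
  Write \<open>X\<^sup>H + (h B)\<^sup>V\<close> for the lift of a pair of vector fields \<open>X\<close>, \<open>B\<close> to the cotangent bundle.  The
  pull-back connection acts on such lifts componentwise, \<open>(X, B)\<close> and \<open>(X', B')\<close> giving
  \<open>(\<nabla>\<^sub>X X', \<nabla>\<^sub>X B')\<close>, and the Sasaki tensor is \<open>h (X, X') + h (B, B')\<close>.  A tangent vector of the
  cotangent bundle is determined by its action on the functions \<open>f \<circ> \<pi>\<close> and on the evaluations
  \<open>ev\<^sub>Z (p, \<alpha>) = \<alpha> (Z p)\<close>; the lift of \<open>(X, B)\<close> sends them to \<open>X f \<circ> \<pi>\<close> and to
  \<open>ev\<^bsub>\<nabla>\<^sub>X Z\<^esub> + h (B, Z) \<circ> \<pi>\<close>.  This shows that the horizontal lift does not depend on the chart and,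
  for flat \<open>\<nabla>\<close>, computes the brackets of lifts.  Curvature and the quasi-statistical expression are
  linear over smooth functions, so their values at a point depend only on the values of the vector
  fields there and it suffices to insert lifts.
\<close>

section \<open>Smooth maps between Euclidean spaces\<close>

text \<open>Flatness is spent on one fact: on \<open>ev_Z\<close> the bracket of two horizontal
  lifts yields \<open>ev\<close> of D X (D X' Z) - D X' (D X Z), which vanishing curvature turns
  into \<open>ev\<close> of D [X,X'] Z. So the bracket of the lifts of (X,B) and (X',B') is the lift
  of ([X,X'],W), with W known through h (W,Z) alone. Vertical directions are given by vector fields
  B rather than 1-forms, since conjugating D with h then disappears. W stands in the left slot
  because h is not symmetric. In the Codazzi expression of lifts the formula for h (W,B3) cancels
  all terms containing some B and leaves the Codazzi expression of h in the base fields. From the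
  curvature W drops out, as the pull-back connection gives 0 on lifts in vertical directions. The
  obstacle is that connections act on global fields only: passing from a vector or a field in a
  chart to a global field costs a cutoff function, whose extension by 0 is smooth because compact
  sets of a Hausdorff space are closed. Smoothness of the Sasaki tensor also needs the inverse of
  the matrix of h to depend smoothly on the point.\<close>

abbreviation fderiv :: "('a::real_normed_vector \<Rightarrow> 'b::real_normed_vector) \<Rightarrow> 'a \<Rightarrow> 'a \<Rightarrow> 'b"
  where "fderiv f x \<equiv> frechet_derivative f (at x)"

lemma fderiv_eqI: "(f has_derivative f') (at x) \<Longrightarrow> fderiv f x = f'"
  using frechet_derivative_at by metis

lemma linear_expand_Basis:
  \<comment> \<open>Trades a linear map for its finitely many values on \<open>Basis\<close>.
    Wherever both a map and its argument vary with a point, this separates the two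
    dependences.\<close>
  fixes f :: "'a::euclidean_space \<Rightarrow> 'b::real_vector"
  assumes "linear f"
  shows "(\<Sum>b\<in>Basis. (w \<bullet> b) *\<^sub>R f b) = f w"
  using assms by (subst (2) euclidean_representation[of w, symmetric]) (simp only: linear_sum linear_cmul)

subsection \<open>Functions of class \<open>C\<^sup>k\<close>\<close>

lemma differentiable_on_open_has_derivative:
  assumes "open S" "f differentiable_on S" "x \<in> S"
  shows "(f has_derivative fderiv f x) (at x)"
  using assms by (simp add: differentiable_on_eq_differentiable_at flip: frechet_derivative_works)

text \<open>\<open>frechet_derivative\<close> at a point sees only the germ there, so values on an
  open set determine all derivatives on it. The induction generalises over both functions because
  the hypothesis is applied to their derivatives.\<close>

lemma Ck_on_cong:
  assumes "open S" "\<And>x. x \<in> S \<Longrightarrow> f x = g x" "Ck_on k f S"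
  shows "Ck_on k g S"
  using assms(2,3)
proof (induction k arbitrary: f g)
  case 0
  then show ?case by (simp cong: continuous_on_cong)
next
  case (Suc k)
  have d: "(g has_derivative fderiv f x) (at x)" if "x \<in> S" for x
  proof -
    have "(f has_derivative fderiv f x) (at x)"
      using Suc.prems(2) that by (intro differentiable_on_open_has_derivative[OF assms(1)]) auto
    then show ?thesis
      by (rule has_derivative_transform_within_open[OF _ assms(1) that]) (simp add: Suc.prems(1))
  qed
  have "g differentiable_on S"
    using d by (auto simp: differentiable_on_eq_differentiable_at[OF assms(1)] differentiable_def)
  moreover have "Ck_on k (\<lambda>x. fderiv g x v) S" for v
    by (rule Suc.IH[of "\<lambda>x. fderiv f x v"]) (use Suc.prems in \<open>auto simp: fderiv_eqI[OF d]\<close>)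
  ultimately show ?case by simp
qed

text \<open>Any explicit formula for the derivative can be supplied here; the choice operator in
  \<open>frechet_derivative\<close> is dealt with once.\<close>

lemma Ck_on_SucI:
  assumes "open S" "\<And>x. x \<in> S \<Longrightarrow> (f has_derivative f' x) (at x)"
    and "\<And>v. Ck_on k (\<lambda>x. f' x v) S"
  shows "Ck_on (Suc k) f S"
proof -
  have "f differentiable_on S"
    using assms(2) by (auto simp: differentiable_on_eq_differentiable_at[OF assms(1)] differentiable_def)
  moreover have "Ck_on k (\<lambda>x. fderiv f x v) S" for v
    by (rule Ck_on_cong[OF assms(1) _ assms(3)[of v]]) (simp add: fderiv_eqI[OF assms(2)])
  ultimately show ?thesis by simp
qed

lemma Ck_on_Suc_has_derivative:
  "\<lbrakk>open S; Ck_on (Suc k) f S; x \<in> S\<rbrakk> \<Longrightarrow> (f has_derivative fderiv f x) (at x)"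
  using differentiable_on_open_has_derivative by auto

lemma Ck_on_Suc_imp: "Ck_on (Suc k) f S \<Longrightarrow> Ck_on k f S"
  by (induction k arbitrary: f) (auto simp: differentiable_imp_continuous_on)

text \<open>Continuity and differentiability at points of an open set are local, and so is each
  derivative by induction. Smoothness on a manifold will be established near one point at a
  time.\<close>

lemma Ck_on_local:
  assumes "\<And>x. x \<in> S \<Longrightarrow> \<exists>T. open T \<and> x \<in> T \<and> Ck_on k f T" "open S"
  shows "Ck_on k f S"
  using assms(1)
proof (induction k arbitrary: f)
  case 0
  then show ?case
    by (fastforce simp: continuous_on_eq_continuous_at assms(2))
next
  case (Suc k)
  have "f differentiable at x" if "x \<in> S" for x
    using Suc.prems[OF that] by (auto simp: differentiable_on_eq_differentiable_at)
  moreover have "Ck_on k (\<lambda>x. fderiv f x v) S" for v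
    by (rule Suc.IH) (use Suc.prems in fastforce)
  ultimately show ?case
    using assms(2) by (simp add: differentiable_on_eq_differentiable_at)
qed

lemma Ck_on_subset:
  assumes "Ck_on k f S" "T \<subseteq> S"
  shows "Ck_on k f T"
  using assms(1)
  by (induction k arbitrary: f)
    (auto intro: continuous_on_subset[OF _ assms(2)] differentiable_on_subset[OF _ assms(2)])

lemma Ck_on_const: "open S \<Longrightarrow> Ck_on k (\<lambda>x. c) S"
proof (induction k arbitrary: c)
  case (Suc k)
  then show ?case by (intro Ck_on_SucI[where f' = "\<lambda>_ _. 0"] has_derivative_const)
qed auto

lemma Ck_on_linear:
  assumes "bounded_linear F" "open S" "Ck_on k f S"
  shows "Ck_on k (\<lambda>x. F (f x)) S"
  using assms(3)
proof (induction k arbitrary: f)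
  case 0
  then show ?case by (simp add: bounded_linear.continuous_on[OF assms(1)])
next
  case (Suc k)
  show ?case
  proof (rule Ck_on_SucI[OF assms(2)])
    fix x assume "x \<in> S"
    show "((\<lambda>x. F (f x)) has_derivative (\<lambda>v. F (fderiv f x v))) (at x)"
      by (rule bounded_linear.has_derivative[OF assms(1)])
        (rule Ck_on_Suc_has_derivative[OF assms(2) Suc.prems \<open>x \<in> S\<close>])
  qed (use Suc assms in auto)
qed

lemma Ck_on_add:
  assumes "open S" "Ck_on k f S" "Ck_on k g S"
  shows "Ck_on k (\<lambda>x. f x + g x) S"
  using assms(2,3)
proof (induction k arbitrary: f g)
  case 0
  then show ?case by (auto intro: continuous_intros)
next
  case (Suc k)
  show ?case
  proof (rule Ck_on_SucI[OF assms(1)])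
    fix x assume "x \<in> S"
    show "((\<lambda>x. f x + g x) has_derivative (\<lambda>v. fderiv f x v + fderiv g x v)) (at x)"
      by (intro has_derivative_add Ck_on_Suc_has_derivative[OF assms(1) _ \<open>x \<in> S\<close>]) (use Suc.prems in auto)
  qed (use Suc assms in auto)
qed

lemma Ck_on_bilinear:
  assumes "bounded_bilinear P" "open S" "Ck_on k f S" "Ck_on k g S"
  shows "Ck_on k (\<lambda>x. P (f x) (g x)) S"
  using assms(3,4)
proof (induction k arbitrary: f g)
  case 0
  then show ?case by (simp add: bounded_bilinear.continuous_on[OF assms(1)])
next
  case (Suc k)
  show ?case
  proof (rule Ck_on_SucI[OF assms(2)])
    fix x assume "x \<in> S"
    show "((\<lambda>x. P (f x) (g x)) has_derivative (\<lambda>v. P (f x) (fderiv g x v) + P (fderiv f x v) (g x))) (at x)"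
      by (rule bounded_bilinear.FDERIV[OF assms(1)])
        (rule Ck_on_Suc_has_derivative[OF assms(2) _ \<open>x \<in> S\<close>], use Suc.prems in auto)+
  next
    fix v
    show "Ck_on k (\<lambda>x. P (f x) (fderiv g x v) + P (fderiv f x v) (g x)) S"
      using Suc Ck_on_Suc_imp[OF Suc.prems(1)] Ck_on_Suc_imp[OF Suc.prems(2)]
      by (intro Ck_on_add[OF assms(2)] Suc.IH) auto
  qed
qed

lemma Ck_on_sum:
  assumes "open S" "\<And>i. i \<in> I \<Longrightarrow> Ck_on k (f i) S"
  shows "Ck_on k (\<lambda>x. \<Sum>i\<in>I. f i x) S"
  using assms(2)
  by (induction I rule: infinite_finite_induct) (auto intro: Ck_on_const[OF assms(1)] Ck_on_add[OF assms(1)])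

lemma Ck_on_ident: "open S \<Longrightarrow> Ck_on k (\<lambda>x. x) S"
proof (induction k)
  case (Suc k)
  then show ?case
    by (intro Ck_on_SucI[where f' = "\<lambda>_ v. v"] has_derivative_ident Ck_on_const)
qed auto

lemma Ck_on_compose:
  assumes "open S" "open T" "g ` S \<subseteq> T" "Ck_on k f T" "Ck_on k g S"
  shows "Ck_on k (\<lambda>x. f (g x)) S"
  using assms(4,5)
proof (induction k arbitrary: f)
  case 0
  then show ?case
    using assms(3) by (auto intro: continuous_on_compose2)
next
  case (Suc k)
  have df: "(f has_derivative fderiv f (g x)) (at (g x))" if "x \<in> S" for x
    using that assms(2,3) Suc.prems(1) by (intro Ck_on_Suc_has_derivative) auto
  show ?case
  proof (rule Ck_on_SucI[OF assms(1)])
    fix x assume x: "x \<in> S"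
    \<comment> \<open>In the chain rule \<open>fderiv f (g x)\<close> is applied to a vector that
      moves with x, a form to which the induction hypothesis does not apply. The basis expansion
      turns it into products of functions of class k.\<close>
    show "((\<lambda>x. f (g x)) has_derivative (\<lambda>v. \<Sum>b\<in>Basis. (fderiv g x v \<bullet> b) *\<^sub>R fderiv f (g x) b)) (at x)"
    proof -
      have comp: "((\<lambda>x. f (g x)) has_derivative (\<lambda>v. fderiv f (g x) (fderiv g x v))) (at x)"
        using has_derivative_compose[OF Ck_on_Suc_has_derivative[OF assms(1) Suc.prems(2) x] df[OF x]] .
      have l: "linear (fderiv f (g x))"
        using df[OF x] has_derivative_linear by blast
      show ?thesis
        by (rule has_derivative_eq_rhs[OF comp]) (simp only: linear_expand_Basis[OF l])
    qed
  next
    fix v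
    show "Ck_on k (\<lambda>x. \<Sum>b\<in>Basis. (fderiv g x v \<bullet> b) *\<^sub>R fderiv f (g x) b) S"
    proof (intro Ck_on_sum[OF assms(1)] Ck_on_bilinear[OF bounded_bilinear_scaleR assms(1)])
      fix b :: 'b
      show "Ck_on k (\<lambda>x. fderiv g x v \<bullet> b) S"
        using Suc.prems by (intro Ck_on_linear[OF bounded_linear_inner_left assms(1)]) auto
      show "Ck_on k (\<lambda>x. fderiv f (g x) b) S"
        using Suc.prems(1) by (intro Suc.IH Ck_on_Suc_imp[OF Suc.prems(2)]) auto
    qed
  qed
qed

subsection \<open>Smooth functions\<close>

lemma smooth_on_iff:
  "smooth_on f S \<longleftrightarrow> f differentiable_on S \<and> (\<forall>v. smooth_on (\<lambda>x. fderiv f x v) S)"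
proof
  show "f differentiable_on S \<and> (\<forall>v. smooth_on (\<lambda>x. fderiv f x v) S)" if "smooth_on f S"
    using that unfolding smooth_on_def by (metis Ck_on.simps(2))
  show "smooth_on f S" if "f differentiable_on S \<and> (\<forall>v. smooth_on (\<lambda>x. fderiv f x v) S)"
    unfolding smooth_on_def
  proof
    show "Ck_on k f S" for k
      using that by (cases k) (auto simp: smooth_on_def intro: differentiable_imp_continuous_on)
  qed
qed

lemma smooth_on_continuous_on: "smooth_on f S \<Longrightarrow> continuous_on S f"
  unfolding smooth_on_def by (metis Ck_on.simps(1))

lemma smooth_on_fderiv: "smooth_on f S \<Longrightarrow> smooth_on (\<lambda>x. fderiv f x v) S"
  using smooth_on_iff by blast

lemma smooth_on_has_derivative:
  "\<lbrakk>smooth_on f S; open S; x \<in> S\<rbrakk> \<Longrightarrow> (f has_derivative fderiv f x) (at x)"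
  using smooth_on_iff differentiable_on_open_has_derivative by blast

lemma smooth_on_differentiable:
  "\<lbrakk>smooth_on f S; open S; x \<in> S\<rbrakk> \<Longrightarrow> f differentiable at x"
  using smooth_on_has_derivative differentiable_def by blast

lemma smooth_on_linear_fderiv:
  "\<lbrakk>smooth_on f S; open S; x \<in> S\<rbrakk> \<Longrightarrow> linear (fderiv f x)"
  using smooth_on_has_derivative has_derivative_linear by blast

text \<open>Meant for families closed under differentiation, such as the functions
  \<open>flat_exp p\<close>: no order of differentiability has to be tracked.\<close>

lemma smooth_on_coinduct:
  assumes "P f"
    and "\<And>f. P f \<Longrightarrow> f differentiable_on S \<and> (\<forall>v. P (\<lambda>x. fderiv f x v))"
  shows "smooth_on f S"
proof -
  have "Ck_on k f S" if "P f" for k f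
    using that
    by (induction k arbitrary: f) (auto simp: assms(2) intro: differentiable_imp_continuous_on)
  then show ?thesis using assms(1) by (simp add: smooth_on_def)
qed

lemma smooth_on_cong:
  "\<lbrakk>open S; \<And>x. x \<in> S \<Longrightarrow> f x = g x; smooth_on f S\<rbrakk> \<Longrightarrow> smooth_on g S"
  unfolding smooth_on_def using Ck_on_cong by blast

lemma smooth_on_subset: "\<lbrakk>smooth_on f S; T \<subseteq> S\<rbrakk> \<Longrightarrow> smooth_on f T"
  unfolding smooth_on_def using Ck_on_subset by blast

lemma smooth_on_local:
  "\<lbrakk>\<And>x. x \<in> S \<Longrightarrow> \<exists>T. open T \<and> x \<in> T \<and> smooth_on f T; open S\<rbrakk> \<Longrightarrow> smooth_on f S"
  unfolding smooth_on_def using Ck_on_local[of S _ f] by meson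

lemma smooth_on_const: "open S \<Longrightarrow> smooth_on (\<lambda>x. c) S"
  by (simp add: smooth_on_def Ck_on_const)

lemma smooth_on_ident: "open S \<Longrightarrow> smooth_on (\<lambda>x. x) S"
  by (simp add: smooth_on_def Ck_on_ident)

lemma smooth_on_bounded_linear:
  "\<lbrakk>bounded_linear F; open S; smooth_on f S\<rbrakk> \<Longrightarrow> smooth_on (\<lambda>x. F (f x)) S"
  by (simp add: smooth_on_def Ck_on_linear)

lemma smooth_on_bilinear:
  "\<lbrakk>bounded_bilinear P; open S; smooth_on f S; smooth_on g S\<rbrakk> \<Longrightarrow> smooth_on (\<lambda>x. P (f x) (g x)) S"
  by (simp add: smooth_on_def Ck_on_bilinear)

lemma smooth_on_add:
  "\<lbrakk>open S; smooth_on f S; smooth_on g S\<rbrakk> \<Longrightarrow> smooth_on (\<lambda>x. f x + g x) S"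
  by (simp add: smooth_on_def Ck_on_add)

lemma smooth_on_sum:
  "\<lbrakk>open S; \<And>i. i \<in> I \<Longrightarrow> smooth_on (f i) S\<rbrakk> \<Longrightarrow> smooth_on (\<lambda>x. \<Sum>i\<in>I. f i x) S"
  by (simp add: smooth_on_def Ck_on_sum)

lemma smooth_on_compose:
  "\<lbrakk>open S; open T; g ` S \<subseteq> T; smooth_on f T; smooth_on g S\<rbrakk> \<Longrightarrow> smooth_on (\<lambda>x. f (g x)) S"
  by (simp add: smooth_on_def Ck_on_compose)

lemma smooth_on_scaleR: "\<lbrakk>open S; smooth_on f S; smooth_on g S\<rbrakk> \<Longrightarrow> smooth_on (\<lambda>x. f x *\<^sub>R g x) S"
  by (rule smooth_on_bilinear[OF bounded_bilinear_scaleR])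

lemma smooth_on_mult:
  fixes f g :: "'a::euclidean_space \<Rightarrow> real"
  shows "\<lbrakk>open S; smooth_on f S; smooth_on g S\<rbrakk> \<Longrightarrow> smooth_on (\<lambda>x. f x * g x) S"
  by (rule smooth_on_bilinear[OF bounded_bilinear_mult])

lemma smooth_on_inner: "\<lbrakk>open S; smooth_on f S; smooth_on g S\<rbrakk> \<Longrightarrow> smooth_on (\<lambda>x. f x \<bullet> g x) S"
  by (rule smooth_on_bilinear[OF bounded_bilinear_inner])

lemma smooth_on_uminus: "\<lbrakk>open S; smooth_on f S\<rbrakk> \<Longrightarrow> smooth_on (\<lambda>x. - f x) S"
  by (rule smooth_on_bounded_linear[OF bounded_linear_minus[OF bounded_linear_ident]])

lemma smooth_on_diff: "\<lbrakk>open S; smooth_on f S; smooth_on g S\<rbrakk> \<Longrightarrow> smooth_on (\<lambda>x. f x - g x) S"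
  using smooth_on_add[OF _ _ smooth_on_uminus] by fastforce

lemma smooth_on_fst: "\<lbrakk>open S; smooth_on f S\<rbrakk> \<Longrightarrow> smooth_on (\<lambda>x. fst (f x)) S"
  by (rule smooth_on_bounded_linear[OF bounded_linear_fst])

lemma smooth_on_snd: "\<lbrakk>open S; smooth_on f S\<rbrakk> \<Longrightarrow> smooth_on (\<lambda>x. snd (f x)) S"
  by (rule smooth_on_bounded_linear[OF bounded_linear_snd])

lemma smooth_on_Pair:
  assumes "open S" "smooth_on f S" "smooth_on g S"
  shows "smooth_on (\<lambda>x. (f x, g x)) S"
proof -
  have "smooth_on (\<lambda>x. (f x, 0) + (0, g x)) S"
    using assms
    by (intro smooth_on_add smooth_on_bounded_linear[where F = "\<lambda>x. (x, 0)"]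
        smooth_on_bounded_linear[where F = "\<lambda>x. (0, x)"] bounded_linear_Pair bounded_linear_ident bounded_linear_zero)
  then show ?thesis by simp
qed

lemmas smooth_intros = smooth_on_const smooth_on_ident smooth_on_add smooth_on_sum smooth_on_scaleR
  smooth_on_mult smooth_on_inner smooth_on_uminus smooth_on_diff smooth_on_fst smooth_on_snd smooth_on_Pair

text \<open>Expanding the argument in the basis leaves a finite sum of products of smooth functions.
  This handles derivatives along vector fields, changes of chart and inverse matrices alike.\<close>

lemma smooth_on_linear_family:
  assumes "open S" "\<And>x. x \<in> S \<Longrightarrow> linear (L x)" "\<And>b. b \<in> Basis \<Longrightarrow> smooth_on (\<lambda>x. L x b) S" "smooth_on f S"
  shows "smooth_on (\<lambda>x. L x (f x)) S"
proof (rule smooth_on_cong[OF assms(1)])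
  show "smooth_on (\<lambda>x. \<Sum>b\<in>Basis. (f x \<bullet> b) *\<^sub>R L x b) S"
    by (intro smooth_intros assms)
  fix x assume "x \<in> S"
  then show "(\<Sum>b\<in>Basis. (f x \<bullet> b) *\<^sub>R L x b) = L x (f x)"
    by (intro linear_expand_Basis assms)
qed

lemma smooth_on_inverse:
  fixes f :: "'a::euclidean_space \<Rightarrow> real"
  assumes "open S" "smooth_on f S" "\<And>x. x \<in> S \<Longrightarrow> f x \<noteq> 0"
  shows "smooth_on (\<lambda>x. inverse (f x)) S"
proof -
  let ?N = "- {0::real}"
  have o: "open ?N" by auto
  \<comment> \<open>The derivative of \<open>inverse\<close> is built from products of
    \<open>inverse\<close> with itself, so class k gives class k + 1.\<close>
  have "Ck_on k inverse ?N" for k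
  proof (induction k)
    case 0
    then show ?case by (auto intro!: continuous_intros)
  next
    case (Suc k)
    show ?case
    proof (rule Ck_on_SucI[OF o])
      show "(inverse has_derivative (\<lambda>v. - (inverse x * v * inverse x))) (at x)" if "x \<in> ?N" for x :: real
        using has_derivative_inverse'[of x UNIV] that by simp
      show "Ck_on k (\<lambda>x. - (inverse x * v * inverse x)) ?N" for v :: real
        by (intro Ck_on_linear[OF bounded_linear_minus[OF bounded_linear_ident] o]
            Ck_on_bilinear[OF bounded_bilinear_mult o] Suc.IH Ck_on_const o)
    qed
  qed
  then have "smooth_on inverse ?N" by (simp add: smooth_on_def)
  from assms(1) o _ this assms(2) show ?thesis
    by (rule smooth_on_compose) (use assms(3) in auto)
qed

subsection \<open>Cutoff functions\<close>

text \<open>The derivative of \<open>flat_exp p\<close> is again of this form, which makes it smooth at \<open>0\<close>.\<close>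

definition flat_exp :: "real poly \<Rightarrow> real \<Rightarrow> real" where
  "flat_exp p t = (if t \<le> 0 then 0 else poly p (inverse t) * exp (- inverse t))"

lemma tendsto_poly_div_exp: "((\<lambda>x. poly p x * exp (- x)) \<longlongrightarrow> (0::real)) at_top"
proof -
  have "((\<lambda>x. \<Sum>i\<le>degree p. coeff p i * (x ^ i / exp x)) \<longlongrightarrow> (\<Sum>i\<le>degree p. coeff p i * 0)) at_top"
    by (intro tendsto_sum tendsto_mult tendsto_const tendsto_power_div_exp_0)
  then show ?thesis
    by (simp add: poly_altdef sum_distrib_right exp_minus divide_inverse mult.assoc)
qed

text \<open>With s = 1/t one has d/dt = - s^2 d/ds, and the derivative of p(s) exp (- s) in s is (p'
  - p)(s) exp (- s); hence the polynomial s^2 (p - p').\<close>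

lemma flat_exp_DERIV:
  "(flat_exp p has_real_derivative flat_exp ([:0, 0, 1:] * (p - pderiv p)) t) (at t)"
proof -
  consider "t < 0" | "t = 0" | "t > 0" by linarith
  then show ?thesis
  proof cases
    case 1
    have "((\<lambda>_. 0) has_real_derivative 0) (at t)" by simp
    then have "(flat_exp p has_real_derivative 0) (at t)"
      by (rule has_field_derivative_transform_within_open[of _ _ _ "{..<0}"]) (use 1 in \<open>auto simp: flat_exp_def\<close>)
    then show ?thesis using 1 by (simp add: flat_exp_def)
  next
    case 3
    have inv: "(inverse has_real_derivative - (inverse t ^ Suc (Suc 0))) (at t)"
      using 3 by (intro DERIV_inverse) auto
    have "((\<lambda>t. poly p (inverse t)) has_real_derivative
        poly (pderiv p) (inverse t) * - (inverse t ^ Suc (Suc 0))) (at t)"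
      using DERIV_chain2[OF poly_DERIV inv] .
    moreover have "((\<lambda>t. exp (- inverse t)) has_real_derivative
        exp (- inverse t) * - (- (inverse t ^ Suc (Suc 0)))) (at t)"
      using DERIV_chain2[OF DERIV_exp DERIV_minus[OF inv]] .
    ultimately have "((\<lambda>t. poly p (inverse t) * exp (- inverse t)) has_real_derivative
        poly (pderiv p) (inverse t) * - (inverse t ^ Suc (Suc 0)) * exp (- inverse t) +
        exp (- inverse t) * - (- (inverse t ^ Suc (Suc 0))) * poly p (inverse t)) (at t)"
      by (rule DERIV_mult)
    also have "poly (pderiv p) (inverse t) * - (inverse t ^ Suc (Suc 0)) * exp (- inverse t) +
        exp (- inverse t) * - (- (inverse t ^ Suc (Suc 0))) * poly p (inverse t) =
        flat_exp ([:0, 0, 1:] * (p - pderiv p)) t"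
      using 3 by (simp add: flat_exp_def ring_distribs)
    finally have "((\<lambda>t. poly p (inverse t) * exp (- inverse t)) has_real_derivative
        flat_exp ([:0, 0, 1:] * (p - pderiv p)) t) (at t)" .
    then show ?thesis
      by (rule has_field_derivative_transform_within_open[of _ _ _ "{0<..}"]) (use 3 in \<open>auto simp: flat_exp_def\<close>)
  next
    case 2
    \<comment> \<open>Dividing by h multiplies p (1/h) by 1/h, so the difference quotient of
      \<open>flat_exp p\<close> at 0 is \<open>flat_exp ?q\<close>, which tends to 0 from both
      sides.\<close>
    let ?q = "[:0, 1:] * p"
    have "((\<lambda>h. flat_exp ?q h) \<longlongrightarrow> 0) (at_right 0)"
    proof -
      have "((\<lambda>h. poly ?q (inverse h) * exp (- inverse h)) \<longlongrightarrow> (0::real)) (at_right 0)"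
        by (rule filterlim_compose[OF tendsto_poly_div_exp filterlim_inverse_at_top_right])
      then show ?thesis
        by (rule Lim_transform_eventually) (auto simp: eventually_at_right_field flat_exp_def intro!: exI[of _ 1])
    qed
    moreover have "((\<lambda>h. flat_exp ?q h) \<longlongrightarrow> 0) (at_left 0)"
      by (rule Lim_transform_eventually[OF tendsto_const])
        (auto simp: eventually_at_left_field flat_exp_def intro!: exI[of _ "-1"])
    ultimately have "((\<lambda>h. flat_exp ?q h) \<longlongrightarrow> 0) (at 0)"
      by (simp add: filterlim_at_split)
    moreover have "flat_exp ?q h = (flat_exp p (0 + h) - flat_exp p 0) / h" for h
      by (simp add: flat_exp_def field_simps)
    ultimately have "(flat_exp p has_real_derivative 0) (at 0)"
      by (simp add: DERIV_def)
    then show ?thesis using 2 by (simp add: flat_exp_def)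
  qed
qed

lemma smooth_on_flat_exp: "smooth_on (flat_exp p) UNIV"
proof (rule smooth_on_coinduct[where P = "\<lambda>f. \<exists>p. f = flat_exp p"])
  fix f assume "\<exists>p. f = flat_exp p"
  then obtain p where f: "f = flat_exp p" by blast
  let ?q = "[:0, 0, 1:] * (p - pderiv p)"
  have d: "(flat_exp p has_derivative (\<lambda>v. v * flat_exp ?q t)) (at t)" for t
    using flat_exp_DERIV[of p t] by (simp add: has_field_derivative_def mult_commute_abs)
  have "(\<lambda>x. fderiv f x v) = flat_exp (smult v ?q)" for v
    by (auto simp: f fderiv_eqI[OF d] fun_eq_iff flat_exp_def)
  then show "f differentiable_on UNIV \<and> (\<forall>v. \<exists>p. (\<lambda>x. fderiv f x v) = flat_exp p)"
    using d f by (auto simp: differentiable_on_def differentiable_def)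
qed auto

text \<open>The constant polynomial 1 gives exp (- 1/t), extended by 0. The denominator is positive
  because t and 1 - t cannot both be nonpositive.\<close>

definition smooth_step :: "real \<Rightarrow> real" where
  "smooth_step t = flat_exp 1 t * inverse (flat_exp 1 t + flat_exp 1 (1 - t))"

lemma smooth_step_eq_0: "t \<le> 0 \<Longrightarrow> smooth_step t = 0"
  by (simp add: smooth_step_def flat_exp_def)

lemma smooth_step_eq_1: "1 \<le> t \<Longrightarrow> smooth_step t = 1"
  by (simp add: smooth_step_def flat_exp_def)

lemma smooth_on_smooth_step: "smooth_on smooth_step UNIV"
proof -
  have "flat_exp 1 t + flat_exp 1 (1 - t) \<noteq> 0" for t
    by (auto simp: flat_exp_def add_nonneg_eq_0_iff add_pos_pos less_imp_neq[symmetric])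
  then show ?thesis
    unfolding smooth_step_def[abs_def]
    by (intro smooth_intros smooth_on_inverse smooth_on_flat_exp
        smooth_on_compose[OF open_UNIV open_UNIV _ smooth_on_flat_exp]) auto
qed

lemma smooth_cutoff:
  fixes x :: "'e::euclidean_space"
  assumes "open U" "x \<in> U"
  obtains f V K where "smooth_on f UNIV" "open V" "x \<in> V" "compact K" "V \<subseteq> K" "K \<subseteq> U"
    "\<forall>y\<in>V. f y = (1::real)" "\<forall>y. y \<notin> K \<longrightarrow> f y = 0"
proof -
  obtain r where r: "r > 0" "cball x r \<subseteq> U"
    using assms open_contains_cball by blast
  \<comment> \<open>The squared distance keeps the function smooth at x. The argument is at least
    3/2 within distance r/2 of x, and at most 0 from distance r on.\<close>
  define f where "f y = smooth_step (2 - (2 / r\<^sup>2) * ((y - x) \<bullet> (y - x)))" for y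
  show thesis
  proof
    show "smooth_on f UNIV"
      unfolding f_def by (intro smooth_intros smooth_on_compose[OF open_UNIV open_UNIV _ smooth_on_smooth_step]) auto
    show "open (ball x (r/2))" "x \<in> ball x (r/2)" "compact (cball x r)" "ball x (r/2) \<subseteq> cball x r"
      "cball x r \<subseteq> U"
      using r by auto
    show "\<forall>y\<in>ball x (r/2). f y = 1"
    proof
      fix y assume that: "y \<in> ball x (r/2)"
      have "norm (y - x) < r / 2" using that by (simp add: dist_norm norm_minus_commute)
      then have "(norm (y - x))\<^sup>2 \<le> (r / 2)\<^sup>2" by (intro power_mono) auto
      then have "2 / r\<^sup>2 * (norm (y - x))\<^sup>2 \<le> 2 / r\<^sup>2 * (r / 2)\<^sup>2"
        by (rule mult_left_mono) simp
      also have "\<dots> = 1 / 2" using r by (simp add: power2_eq_square)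
      finally show "f y = 1"
        unfolding f_def power2_norm_eq_inner by (intro smooth_step_eq_1) simp
    qed
    show "\<forall>y. y \<notin> cball x r \<longrightarrow> f y = 0"
    proof (intro allI impI)
      fix y assume that: "y \<notin> cball x r"
      have "norm (y - x) > r" using that by (simp add: dist_norm norm_minus_commute)
      then have "(norm (y - x))\<^sup>2 \<ge> r\<^sup>2" using r by (intro power_mono) auto
      then have "2 / r\<^sup>2 * (norm (y - x))\<^sup>2 \<ge> 2 / r\<^sup>2 * r\<^sup>2"
        by (rule mult_left_mono) simp
      moreover have "2 / r\<^sup>2 * r\<^sup>2 = 2" using r by simp
      ultimately show "f y = 0"
        unfolding f_def power2_norm_eq_inner by (intro smooth_step_eq_0) simp
    qed
  qed
qed

subsection \<open>Symmetry of second derivatives\<close>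

lemma DERIV_along_line:
  fixes f :: "'a::real_normed_vector \<Rightarrow> real"
  assumes "(f has_derivative f') (at (y + a *\<^sub>R v))"
  shows "((\<lambda>t. f (y + t *\<^sub>R v)) has_real_derivative f' v) (at a)"
proof -
  have "((\<lambda>t. y + t *\<^sub>R v) has_derivative (\<lambda>t. t *\<^sub>R v)) (at a)"
    by (auto intro!: derivative_eq_intros)
  from has_derivative_compose[OF this assms]
  have "((\<lambda>t. f (y + t *\<^sub>R v)) has_derivative (\<lambda>t. f' (t *\<^sub>R v))) (at a)" .
  moreover have "(\<lambda>t. f' (t *\<^sub>R v)) = (*) (f' v)"
    using has_derivative_linear[OF assms] by (simp add: linear_cmul fun_eq_iff)
  ultimately show ?thesis by (simp add: has_field_derivative_def)
qed

text \<open>The mean value theorem is applied twice: along v to the difference of f across the side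
  \<open>s *\<^sub>R w\<close>, then along w to the directional derivative that results. The bound
  on s keeps the parallelogram inside the ball.\<close>

lemma second_difference:
  fixes f :: "'a::euclidean_space \<Rightarrow> real"
  assumes f: "smooth_on f (ball x r)" and st: "0 < s" "s * (norm v + norm w) < r"
  obtains a b where "0 \<le> a" "a \<le> s" "0 \<le> b" "b \<le> s"
    "f (x + s *\<^sub>R v + s *\<^sub>R w) - f (x + s *\<^sub>R v) - f (x + s *\<^sub>R w) + f x =
      s * s * fderiv (\<lambda>y. fderiv f y v) (x + a *\<^sub>R v + b *\<^sub>R w) w"
proof -
  have inball: "x + a *\<^sub>R v + b *\<^sub>R w \<in> ball x r" if "0 \<le> a" "a \<le> s" "0 \<le> b" "b \<le> s" for a b
  proof -
    have "norm (a *\<^sub>R v + b *\<^sub>R w) \<le> a * norm v + b * norm w"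
      using norm_triangle_ineq[of "a *\<^sub>R v" "b *\<^sub>R w"] that by simp
    also have "\<dots> \<le> s * norm v + s * norm w"
      by (intro add_mono mult_right_mono) (use that in auto)
    finally have "norm (a *\<^sub>R v + b *\<^sub>R w) < r" using st by (simp add: algebra_simps)
    moreover have "dist x (x + (a *\<^sub>R v + b *\<^sub>R w)) = norm (a *\<^sub>R v + b *\<^sub>R w)"
      by (simp add: dist_norm del: minus_add_distrib minus_add_distrib)
    ultimately show ?thesis by (simp add: add.assoc)
  qed
  define g where "g a = f (x + a *\<^sub>R v + s *\<^sub>R w) - f (x + a *\<^sub>R v)" for a
  have df: "(f has_derivative fderiv f y) (at y)" if "y \<in> ball x r" for y
    using smooth_on_has_derivative[OF f open_ball that] .
  have dg: "(g has_real_derivative fderiv f (x + a *\<^sub>R v + s *\<^sub>R w) v - fderiv f (x + a *\<^sub>R v) v) (at a)"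
    if "0 \<le> a" "a \<le> s" for a
  proof -
    have 1: "x + a *\<^sub>R v + s *\<^sub>R w \<in> ball x r" "x + a *\<^sub>R v \<in> ball x r"
      using inball[of a s] inball[of a 0] that st by auto
    have 2: "x + a *\<^sub>R v + s *\<^sub>R w = (x + s *\<^sub>R w) + a *\<^sub>R v" for a by simp
    show ?thesis
      unfolding g_def 2
      by (intro DERIV_diff DERIV_along_line df 1[unfolded 2])
  qed
  obtain a where a: "0 < a" "a < s"
    "g s - g 0 = s * (fderiv f (x + a *\<^sub>R v + s *\<^sub>R w) v - fderiv f (x + a *\<^sub>R v) v)"
    using MVT2[OF st(1) dg] by auto
  define k where "k b = fderiv f (x + a *\<^sub>R v + b *\<^sub>R w) v" for b
  have f': "smooth_on (\<lambda>y. fderiv f y v) (ball x r)" by (rule smooth_on_fderiv[OF f])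
  have dk: "(k has_real_derivative fderiv (\<lambda>y. fderiv f y v) (x + a *\<^sub>R v + b *\<^sub>R w) w) (at b)"
    if "0 \<le> b" "b \<le> s" for b
  proof -
    have 1: "x + a *\<^sub>R v + b *\<^sub>R w \<in> ball x r"
      using inball[of a b] that a by auto
    show ?thesis
      unfolding k_def
      by (intro DERIV_along_line smooth_on_has_derivative[OF f' open_ball 1])
  qed
  obtain b where b: "0 < b" "b < s"
    "k s - k 0 = s * fderiv (\<lambda>y. fderiv f y v) (x + a *\<^sub>R v + b *\<^sub>R w) w"
    using MVT2[OF st(1) dk] by auto
  show thesis
    by (rule that[of a b]) (use a b in \<open>auto simp: g_def k_def algebra_simps\<close>)
qed

text \<open>The intermediate point supplied by the mean value theorem tends to x with s, and the
  iterated derivative is continuous there.\<close>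

lemma second_fderiv_limit:
  fixes f :: "'a::euclidean_space \<Rightarrow> real"
  assumes "smooth_on f S" "open S" "x \<in> S"
  shows "((\<lambda>s. (f (x + s *\<^sub>R v + s *\<^sub>R w) - f (x + s *\<^sub>R v) - f (x + s *\<^sub>R w) + f x) / (s * s))
    \<longlongrightarrow> fderiv (\<lambda>y. fderiv f y v) x w) (at_right 0)"
proof (rule tendstoI)
  fix e :: real assume e: "e > 0"
  define g where "g y = fderiv (\<lambda>y. fderiv f y v) y w" for y
  have "smooth_on g S"
    unfolding g_def by (intro smooth_on_fderiv assms)
  then have "continuous_on S g"
    by (rule smooth_on_continuous_on)
  then have "isCont g x" using assms(2,3) continuous_on_eq_continuous_at by blast
  then obtain d where d: "d > 0" "\<And>y. dist y x < d \<Longrightarrow> dist (g y) (g x) < e"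
    using e unfolding continuous_at_eps_delta by blast
  obtain r where r: "r > 0" "ball x r \<subseteq> S" using assms open_contains_ball by blast
  \<comment> \<open>The summand 1 keeps the divisor positive when both directions vanish.\<close>
  let ?m = "min r d" and ?N = "norm v + norm w + 1"
  have N: "?N > 0" by (simp add: add_nonneg_pos)
  have "\<forall>s>0. s < ?m / ?N \<longrightarrow>
    dist ((f (x + s *\<^sub>R v + s *\<^sub>R w) - f (x + s *\<^sub>R v) - f (x + s *\<^sub>R w) + f x) / (s * s)) (g x) < e"
  proof (intro allI impI)
    fix s :: real assume s: "0 < s" "s < ?m / ?N"
    have lt: "s * (norm v + norm w) < ?m"
    proof -
      have "s * (norm v + norm w) < s * ?N" using s(1) by simp
      also have "\<dots> < ?m" using s(2) N by (simp add: pos_less_divide_eq)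
      finally show ?thesis .
    qed
    obtain a b where ab: "0 \<le> a" "a \<le> s" "0 \<le> b" "b \<le> s"
      and eq: "f (x + s *\<^sub>R v + s *\<^sub>R w) - f (x + s *\<^sub>R v) - f (x + s *\<^sub>R w) + f x =
        s * s * g (x + a *\<^sub>R v + b *\<^sub>R w)"
      unfolding g_def
      by (rule second_difference[of f x r s v w]) (use smooth_on_subset[OF assms(1) r(2)] s lt in auto)
    have "dist (x + a *\<^sub>R v + b *\<^sub>R w) x = norm (a *\<^sub>R v + b *\<^sub>R w)"
      by (simp add: dist_norm)
    also have "\<dots> \<le> a * norm v + b * norm w"
      using norm_triangle_ineq[of "a *\<^sub>R v" "b *\<^sub>R w"] ab by simp
    also have "\<dots> \<le> s * norm v + s * norm w"
      by (intro add_mono mult_right_mono) (use ab in auto)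
    finally have "dist (x + a *\<^sub>R v + b *\<^sub>R w) x < d" using lt by (simp add: algebra_simps)
    from d(2)[OF this]
    show "dist ((f (x + s *\<^sub>R v + s *\<^sub>R w) - f (x + s *\<^sub>R v) - f (x + s *\<^sub>R w) + f x) / (s * s)) (g x) < e"
      using s(1) by (simp add: eq)
  qed
  moreover have "?m / ?N > 0" using r d N by simp
  ultimately show "\<forall>\<^sub>F s in at_right 0. dist ((f (x + s *\<^sub>R v + s *\<^sub>R w) - f (x + s *\<^sub>R v)
    - f (x + s *\<^sub>R w) + f x) / (s * s)) (fderiv (\<lambda>y. fderiv f y v) x w) < e"
    unfolding eventually_at_right_field g_def by blast
qed

text \<open>The second difference quotient is symmetric in the two directions, so its two
  descriptions as a limit coincide.\<close>

lemma fderiv_symmetric_real: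
  fixes f :: "'a::euclidean_space \<Rightarrow> real"
  assumes "smooth_on f S" "open S" "x \<in> S"
  shows "fderiv (\<lambda>y. fderiv f y v) x w = fderiv (\<lambda>y. fderiv f y w) x v"
proof -
  have "f (x + s *\<^sub>R w + s *\<^sub>R v) - f (x + s *\<^sub>R w) - f (x + s *\<^sub>R v) + f x =
    f (x + s *\<^sub>R v + s *\<^sub>R w) - f (x + s *\<^sub>R v) - f (x + s *\<^sub>R w) + f x" for s
    by (simp add: add_ac)
  from second_fderiv_limit[OF assms, of w v, unfolded this] second_fderiv_limit[OF assms, of v w]
  show ?thesis
    using tendsto_unique trivial_limit_at_right_real by blast
qed

subsection \<open>Families of linear maps\<close>

text \<open>Since f vanishes at x, only the value of g there contributes, and continuity of g
  suffices. This allows an inverse to be differentiated when it is known only to be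
  continuous.\<close>

lemma has_derivative_vanishing_mult:
  fixes f :: "'a::real_normed_vector \<Rightarrow> real" and g :: "'a \<Rightarrow> 'b::real_normed_vector"
  assumes "(f has_derivative f') (at x)" "f x = 0" "isCont g x"
  shows "((\<lambda>y. f y *\<^sub>R g y) has_derivative (\<lambda>v. f' v *\<^sub>R g x)) (at x)"
proof -
  have d1: "((\<lambda>y. f y *\<^sub>R g x) has_derivative (\<lambda>v. f' v *\<^sub>R g x)) (at x)"
    by (rule has_derivative_scaleR_left[OF assms(1)])
  \<comment> \<open>This error term is of smaller order than y - x: the difference quotient of f is
    a null remainder plus a part bounded by K, and both are multiplied by a function tending to
    0.\<close>
  have "((\<lambda>y. f y *\<^sub>R (g y - g x)) has_derivative (\<lambda>v. 0)) (at x)"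
  proof (rule has_derivativeI)
    obtain K where K: "0 \<le> K" "\<And>v. norm (f' v) \<le> norm v * K"
      using bounded_linear.nonneg_bounded[OF has_derivative_bounded_linear[OF assms(1)]] by blast
    have rem: "((\<lambda>y. (f y - f x - f' (y - x)) /\<^sub>R norm (y - x)) \<longlongrightarrow> 0) (at x)"
      using assms(1) unfolding has_derivative_at_within by blast
    have gx: "((\<lambda>y. g y - g x) \<longlongrightarrow> 0) (at x)"
      using assms(3) by (simp add: isCont_def LIM_zero)
    have "((\<lambda>y. ((f y - f x - f' (y - x)) /\<^sub>R norm (y - x)) *\<^sub>R (g y - g x)) \<longlongrightarrow> 0) (at x)"
      using tendsto_scaleR[OF rem gx] by simp
    moreover have "((\<lambda>y. (f' (y - x) /\<^sub>R norm (y - x)) *\<^sub>R (g y - g x)) \<longlongrightarrow> 0) (at x)"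
    proof (rule Lim_null_comparison)
      show "\<forall>\<^sub>F y in at x. norm ((f' (y - x) /\<^sub>R norm (y - x)) *\<^sub>R (g y - g x)) \<le> K * norm (g y - g x)"
      proof (rule always_eventually, rule allI)
        fix y
        have "norm (f' (y - x) /\<^sub>R norm (y - x)) \<le> K"
        proof (cases "y = x")
          case True
          then show ?thesis using K(1) by simp
        next
          case False
          then show ?thesis using K(2)[of "y - x"] by (simp add: field_simps)
        qed
        then show "norm ((f' (y - x) /\<^sub>R norm (y - x)) *\<^sub>R (g y - g x)) \<le> K * norm (g y - g x)"
          by (simp only: norm_scaleR mult_right_mono[OF _ norm_ge_zero] real_norm_def)
      qed
      show "((\<lambda>y. K * norm (g y - g x)) \<longlongrightarrow> 0) (at x)"
        using tendsto_mult_right_zero[OF tendsto_norm_zero[OF gx]] by blast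
    qed
    ultimately have "((\<lambda>y. ((f y - f x - f' (y - x)) /\<^sub>R norm (y - x)) *\<^sub>R (g y - g x)
        + (f' (y - x) /\<^sub>R norm (y - x)) *\<^sub>R (g y - g x)) \<longlongrightarrow> 0 + 0) (at x)"
      by (rule tendsto_add)
    then show "((\<lambda>y. (f y *\<^sub>R (g y - g x) - f x *\<^sub>R (g x - g x) - 0) /\<^sub>R norm (y - x)) \<longlongrightarrow> 0) (at x)"
      by (simp add: assms(2) algebra_simps)
  qed auto
  from has_derivative_add[OF d1 this] show ?thesis
    by (simp add: algebra_simps)
qed

lemma norm_Basis_expansion_diff_le:
  fixes f g :: "'e::euclidean_space \<Rightarrow> 'b::real_normed_vector"
  assumes "linear f" "linear g"
  shows "norm (f w - g w) \<le> norm w * (\<Sum>b\<in>Basis. norm (f b - g b))"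
proof -
  have "linear (\<lambda>w. f w - g w)" using assms by (rule linear_compose_sub)
  then have "f w - g w = (\<Sum>b\<in>Basis. (w \<bullet> b) *\<^sub>R (f b - g b))"
    by (rule linear_expand_Basis[symmetric])
  also have "norm \<dots> \<le> (\<Sum>b\<in>Basis. \<bar>w \<bullet> b\<bar> * norm (f b - g b))"
    by (rule order_trans[OF norm_sum]) simp
  also have "\<dots> \<le> (\<Sum>b\<in>Basis. norm w * norm (f b - g b))"
    by (intro sum_mono mult_right_mono Basis_le_norm) auto
  finally show ?thesis by (simp add: sum_distrib_left)
qed

text \<open>A lower bound m for \<open>H x\<close> survives as m/2 for nearby \<open>H y\<close>,
  and \<open>H y\<close> maps \<open>G y e - G x e\<close> to \<open>e - H y (G x e)\<close>, which
  tends to 0.\<close>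

lemma isCont_inverse_family:
  fixes H G :: "'a::euclidean_space \<Rightarrow> 'e::euclidean_space \<Rightarrow> 'e"
  assumes S: "open S" "x \<in> S"
    and lin: "\<And>y. y \<in> S \<Longrightarrow> linear (H y)"
    and inv: "\<And>y e. y \<in> S \<Longrightarrow> G y (H y e) = e" "\<And>y e. y \<in> S \<Longrightarrow> H y (G y e) = e"
    and cont: "\<And>e. isCont (\<lambda>y. H y e) x"
  shows "isCont (\<lambda>y. G y e) x"
proof -
  have "inj (H x)" using inv(1)[OF S(2)] by (rule inj_on_inverseI)
  then obtain m where m: "m > 0" "\<And>w. m * norm w \<le> norm (H x w)"
    using linear_inj_bounded_below_pos[OF lin[OF S(2)]] by blast
  \<comment> \<open>By \<open>norm_Basis_expansion_diff_le\<close> this bounds the operator norm of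
    the difference of \<open>H y\<close> and \<open>H x\<close>.\<close>
  define d where "d y = (\<Sum>b\<in>Basis. norm (H y b - H x b))" for y
  have "isCont d x" unfolding d_def by (intro continuous_intros cont)
  then have "(d \<longlongrightarrow> 0) (at x)" by (simp add: isCont_def d_def)
  then have "\<forall>\<^sub>F y in at x. dist (d y) 0 < m / 2" by (rule tendstoD) (use m in simp)
  moreover have "\<forall>\<^sub>F y in at x. y \<in> S" using eventually_at_in_open'[OF S] .
  ultimately have "\<forall>\<^sub>F y in at x. norm (G y e - G x e) \<le> 2 / m * norm (H y (G x e) - e)"
  proof eventually_elim
    case (elim y)
    have bound: "norm u \<le> 2 / m * norm (H y u)" for u
    proof -
      have "norm (H y u - H x u) \<le> norm u * d y"
        unfolding d_def by (rule norm_Basis_expansion_diff_le) (use lin elim S in auto)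
      also have "\<dots> \<le> norm u * (m / 2)" using elim by (intro mult_left_mono) auto
      finally have "norm (H y u - H x u) \<le> norm u * (m / 2)" .
      moreover have "norm (H x u) \<le> norm (H y u) + norm (H y u - H x u)"
        by (metis norm_minus_commute norm_triangle_sub)
      ultimately have "m * norm u \<le> norm (H y u) + norm u * (m / 2)" using m(2)[of u] by linarith
      then show ?thesis using m(1) by (simp add: field_simps)
    qed
    have "H y (G y e - G x e) = e - H y (G x e)"
      using lin[OF elim(2)] inv(2)[OF elim(2)] by (simp add: linear_diff)
    with bound[of "G y e - G x e"] show ?case by (simp add: norm_minus_commute)
  qed
  moreover have "((\<lambda>y. 2 / m * norm (H y (G x e) - e)) \<longlongrightarrow> 2 / m * norm (e - e)) (at x)"
    using cont[of "G x e"] inv(2)[OF S(2), of e] by (intro tendsto_intros) (simp add: isCont_def)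
  ultimately show ?thesis
    unfolding isCont_def by (subst LIM_zero_iff[symmetric]) (auto intro: Lim_null_comparison)
qed

text \<open>Rests on the identity \<open>G y e = G x e - G y (H y (G x e) - e)\<close>: the vector
  to which \<open>G y\<close> is applied is differentiable and vanishes at x, so continuity of
  \<open>G y\<close> is enough.\<close>

lemma has_derivative_inverse_family:
  fixes H G :: "'a::euclidean_space \<Rightarrow> 'e::euclidean_space \<Rightarrow> 'e"
  assumes S: "open S" "x \<in> S"
    and lin: "\<And>y. y \<in> S \<Longrightarrow> linear (H y)"
    and inv: "\<And>y e. y \<in> S \<Longrightarrow> G y (H y e) = e" "\<And>y e. y \<in> S \<Longrightarrow> H y (G y e) = e"
    and der: "\<And>e. ((\<lambda>y. H y e) has_derivative H' e) (at x)"
  shows "((\<lambda>y. G y e) has_derivative (\<lambda>v. - (\<Sum>b\<in>Basis. (H' (G x e) v \<bullet> b) *\<^sub>R G x b))) (at x)"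
proof -
  have G: "linear (G y)" if "y \<in> S" for y
    proof (rule linearI)
    show "G y (a + b) = G y a + G y b" for a b
      using inv(1)[OF that, of "G y a + G y b"] by (simp add: linear_add[OF lin[OF that]] inv(2)[OF that])
    show "G y (r *\<^sub>R a) = r *\<^sub>R G y a" for r a
      using inv(1)[OF that, of "r *\<^sub>R G y a"] by (simp add: linear_cmul[OF lin[OF that]] inv(2)[OF that])
  qed
  have cont: "isCont (\<lambda>y. G y b) x" for b
    by (rule isCont_inverse_family[OF S lin inv]) (auto intro: has_derivative_continuous der)
  have "((\<lambda>y. \<Sum>b\<in>Basis. ((H y (G x e) - e) \<bullet> b) *\<^sub>R G y b) has_derivative
      (\<lambda>v. \<Sum>b\<in>Basis. (H' (G x e) v \<bullet> b) *\<^sub>R G x b)) (at x)"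
  proof (intro has_derivative_sum has_derivative_vanishing_mult cont)
    fix b :: 'e
    show "((\<lambda>y. (H y (G x e) - e) \<bullet> b) has_derivative (\<lambda>v. H' (G x e) v \<bullet> b)) (at x)"
      using der[of "G x e"] by (auto intro!: derivative_eq_intros)
    show "(H x (G x e) - e) \<bullet> b = 0" using inv(2)[OF S(2)] by simp
  qed
  then have "((\<lambda>y. G x e - (\<Sum>b\<in>Basis. ((H y (G x e) - e) \<bullet> b) *\<^sub>R G y b)) has_derivative
      (\<lambda>v. 0 - (\<Sum>b\<in>Basis. (H' (G x e) v \<bullet> b) *\<^sub>R G x b))) (at x)"
    by (intro has_derivative_diff has_derivative_const)
  then show ?thesis
  proof (rule has_derivative_eq_rhs[OF has_derivative_transform_within_open[OF _ S]])
    fix y assume y: "y \<in> S"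
    have "(\<Sum>b\<in>Basis. ((H y (G x e) - e) \<bullet> b) *\<^sub>R G y b) = G y (H y (G x e) - e)"
      by (rule linear_expand_Basis[OF G[OF y]])
    also have "\<dots> = G x e - G y e" using y by (simp add: linear_diff[OF G[OF y]] inv)
    finally show "G x e - (\<Sum>b\<in>Basis. ((H y (G x e) - e) \<bullet> b) *\<^sub>R G y b) = G y e" by simp
  qed simp
qed

text \<open>The derivative of an inverse, - G H' G, involves only G itself and derivatives of H, so
  G of class k is of class k + 1. Determinants are avoided.\<close>

lemma smooth_on_inverse_family:
  fixes H G :: "'a::euclidean_space \<Rightarrow> 'e::euclidean_space \<Rightarrow> 'e"
  assumes S: "open S"
    and lin: "\<And>y. y \<in> S \<Longrightarrow> linear (H y)"
    and inv: "\<And>y e. y \<in> S \<Longrightarrow> G y (H y e) = e" "\<And>y e. y \<in> S \<Longrightarrow> H y (G y e) = e"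
    and smooth: "\<And>b. b \<in> Basis \<Longrightarrow> smooth_on (\<lambda>y. H y b) S"
  shows "smooth_on (\<lambda>y. G y e) S"
proof -
  have smH: "smooth_on (\<lambda>y. H y e) S" for e
    by (rule smooth_on_linear_family[OF S lin smooth smooth_on_const[OF S]])
  define H' where "H' y e = fderiv (\<lambda>y. H y e) y" for y e
  have der: "((\<lambda>y. G y e) has_derivative (\<lambda>v. - (\<Sum>b\<in>Basis. (H' y (G y e) v \<bullet> b) *\<^sub>R G y b))) (at y)"
    if "y \<in> S" for y e
    unfolding H'_def
    by (rule has_derivative_inverse_family[OF S that lin inv]) (auto intro: smooth_on_has_derivative[OF smH S that])
  \<comment> \<open>The derivative of H is taken at the vector \<open>G y e\<close>, which moves
    with y. The expansion separates the smooth functions \<open>H' y b v\<close> from the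
    coefficients, to which the induction hypothesis applies.\<close>
  have H'_expand: "H' y w v = (\<Sum>b\<in>Basis. (w \<bullet> b) *\<^sub>R H' y b v)" if y: "y \<in> S" for y w v
  proof -
    have "((\<lambda>y. \<Sum>b\<in>Basis. (w \<bullet> b) *\<^sub>R H y b) has_derivative (\<lambda>v. \<Sum>b\<in>Basis. (w \<bullet> b) *\<^sub>R H' y b v)) (at y)"
      unfolding H'_def
      by (intro has_derivative_sum has_derivative_scaleR_right smooth_on_has_derivative[OF smH S y])
    then have "((\<lambda>y. H y w) has_derivative (\<lambda>v. \<Sum>b\<in>Basis. (w \<bullet> b) *\<^sub>R H' y b v)) (at y)"
    proof (rule has_derivative_transform_within_open[OF _ S y])
      fix z assume z: "z \<in> S"
      show "(\<Sum>b\<in>Basis. (w \<bullet> b) *\<^sub>R H z b) = H z w"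
        by (rule linear_expand_Basis[OF lin[OF z]])
    qed
    then show ?thesis unfolding H'_def by (simp add: fderiv_eqI)
  qed
  have "Ck_on k (\<lambda>y. G y e) S" for k e
  proof (induction k arbitrary: e)
    case 0
    show ?case
      using has_derivative_continuous[OF der] by (simp add: continuous_on_eq_continuous_at[OF S])
  next
    case (Suc k)
    show ?case
    proof (rule Ck_on_SucI[OF S])
      show "((\<lambda>y. G y e) has_derivative
          (\<lambda>v. - (\<Sum>b\<in>Basis. ((\<Sum>a\<in>Basis. (G y e \<bullet> a) *\<^sub>R H' y a v) \<bullet> b) *\<^sub>R G y b))) (at y)"
        if "y \<in> S" for y
        using der[OF that, of e] unfolding H'_expand[OF that, of "G y e"] .
      have "Ck_on k (\<lambda>y. H' y a v) S" for a v
        unfolding H'_def using smooth_on_fderiv[OF smH] by (simp add: smooth_on_def)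
      then show "Ck_on k (\<lambda>y. - (\<Sum>b\<in>Basis. ((\<Sum>a\<in>Basis. (G y e \<bullet> a) *\<^sub>R H' y a v) \<bullet> b) *\<^sub>R G y b)) S" for v
        by (intro Ck_on_linear[OF bounded_linear_minus[OF bounded_linear_ident] S] Ck_on_sum[OF S]
            Ck_on_bilinear[OF bounded_bilinear_scaleR S] Ck_on_linear[OF bounded_linear_inner_left S] Suc.IH)
    qed
  qed
  then show ?thesis by (simp add: smooth_on_def)
qed

text \<open>Product rule for evaluation, with the argument frozen at \<open>g x\<close> in the last
  summand. For L the differential of a function and g a vector field, that summand is the
  Hessian.\<close>

lemma has_derivative_linear_family:
  fixes L :: "'a::euclidean_space \<Rightarrow> 'e::euclidean_space \<Rightarrow> 'b::euclidean_space"
  assumes S: "open S" "x \<in> S"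
    and lin: "\<And>y. y \<in> S \<Longrightarrow> linear (L y)"
    and L: "\<And>b. b \<in> Basis \<Longrightarrow> smooth_on (\<lambda>y. L y b) S"
    and g: "(g has_derivative g') (at x)"
  shows "((\<lambda>y. L y (g y)) has_derivative (\<lambda>v. L x (g' v) + fderiv (\<lambda>y. L y (g x)) x v)) (at x)"
proof -
  have "((\<lambda>y. \<Sum>b\<in>Basis. (g y \<bullet> b) *\<^sub>R L y b) has_derivative
      (\<lambda>v. \<Sum>b\<in>Basis. (g x \<bullet> b) *\<^sub>R fderiv (\<lambda>y. L y b) x v + (g' v \<bullet> b) *\<^sub>R L x b)) (at x)"
    by (intro has_derivative_sum has_derivative_scaleR has_derivative_inner_left g
        smooth_on_has_derivative[OF L S])
  then have 1: "((\<lambda>y. L y (g y)) has_derivative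
      (\<lambda>v. \<Sum>b\<in>Basis. (g x \<bullet> b) *\<^sub>R fderiv (\<lambda>y. L y b) x v + (g' v \<bullet> b) *\<^sub>R L x b)) (at x)"
    by (rule has_derivative_transform_within_open[OF _ S]) (rule linear_expand_Basis[OF lin])
  have "((\<lambda>y. \<Sum>b\<in>Basis. (g x \<bullet> b) *\<^sub>R L y b) has_derivative
      (\<lambda>v. \<Sum>b\<in>Basis. (g x \<bullet> b) *\<^sub>R fderiv (\<lambda>y. L y b) x v)) (at x)"
    by (intro has_derivative_sum has_derivative_scaleR_right smooth_on_has_derivative[OF L S])
  then have "((\<lambda>y. L y (g x)) has_derivative
      (\<lambda>v. \<Sum>b\<in>Basis. (g x \<bullet> b) *\<^sub>R fderiv (\<lambda>y. L y b) x v)) (at x)"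
    by (rule has_derivative_transform_within_open[OF _ S]) (rule linear_expand_Basis[OF lin])
  then show ?thesis
    using 1 by (simp add: fderiv_eqI sum.distrib linear_expand_Basis[OF lin[OF S(2)]] add.commute)
qed

section \<open>Smooth atlases\<close>

text \<open>Separation and countability are left out, so that the chart calculus is available for
  the cotangent bundle before these are known for it.\<close>

locale atlas =
  fixes A :: "('m, 'e::euclidean_space) chart set"
  assumes smooth_atlas: "smooth_atlas A"
begin

lemma inj_on_chart: "c \<in> A \<Longrightarrow> inj_on (snd c) (fst c)"
  using smooth_atlas by (auto simp: smooth_atlas_def)

lemma chart_inv_chart [simp]: "\<lbrakk>c \<in> A; p \<in> fst c\<rbrakk> \<Longrightarrow> chart_inv c (snd c p) = p"
  unfolding chart_inv_def by (intro inv_into_f_f inj_on_chart)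

lemma open_chart_Int: "\<lbrakk>c \<in> A; d \<in> A\<rbrakk> \<Longrightarrow> open (snd c ` (fst c \<inter> fst d))"
  using smooth_atlas by (auto simp: smooth_atlas_def)

lemma open_chart_range: "c \<in> A \<Longrightarrow> open (snd c ` fst c)"
  using open_chart_Int[of c c] by simp

lemma smooth_on_transition: "\<lbrakk>c \<in> A; d \<in> A\<rbrakk> \<Longrightarrow> smooth_on (transition c d) (snd c ` (fst c \<inter> fst d))"
  using smooth_atlas by (auto simp: smooth_atlas_def)

lemma transition_chart [simp]: "\<lbrakk>c \<in> A; p \<in> fst c\<rbrakk> \<Longrightarrow> transition c d (snd c p) = snd d p"
  by (simp add: transition_def)

lemma points_iff: "p \<in> points A \<longleftrightarrow> (\<exists>c\<in>A. p \<in> fst c)"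
  by (auto simp: points_def)

lemma chart_at: "p \<in> points A \<Longrightarrow> chart_at A p \<in> A \<and> p \<in> fst (chart_at A p)"
  unfolding chart_at_def points_iff by (rule someI_ex) blast

lemma atlas_open_Int: "\<lbrakk>atlas_open A V; atlas_open A W\<rbrakk> \<Longrightarrow> atlas_open A (V \<inter> W)"
  using openin_Int openin_atlas_topology[OF smooth_atlas] by blast

lemma atlas_open_chart: "c \<in> A \<Longrightarrow> atlas_open A (fst c)"
  unfolding atlas_open_def points_def using open_chart_Int by (auto simp: Int_commute)

lemma open_chart_image: "\<lbrakk>c \<in> A; atlas_open A W; W \<subseteq> fst c\<rbrakk> \<Longrightarrow> open (snd c ` W)"
  by (metis atlas_open_def inf.absorb_iff1)

lemma atlas_open_points: "\<lbrakk>atlas_open A W; p \<in> W\<rbrakk> \<Longrightarrow> p \<in> points A"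
  by (auto simp: atlas_open_def)

lemma has_derivative_transition:
  "\<lbrakk>c \<in> A; d \<in> A; p \<in> fst c; p \<in> fst d\<rbrakk> \<Longrightarrow>
    (transition c d has_derivative fderiv (transition c d) (snd c p)) (at (snd c p))"
  using smooth_on_has_derivative[OF smooth_on_transition open_chart_Int] by blast

lemma linear_transition:
  "\<lbrakk>c \<in> A; d \<in> A; p \<in> fst c; p \<in> fst d\<rbrakk> \<Longrightarrow> linear (fderiv (transition c d) (snd c p))"
  using has_derivative_transition has_derivative_linear by blast

text \<open>Chain rule: on the image of the triple overlap, which is open, the transition maps
  compose. This cocycle identity is what makes \<open>coord_vec\<close> a tangent vector.\<close>

lemma fderiv_transition_comp:
  assumes "c \<in> A" "d \<in> A" "e \<in> A" "p \<in> fst c" "p \<in> fst d" "p \<in> fst e"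
  shows "fderiv (transition d e) (snd d p) (fderiv (transition c d) (snd c p) a) =
    fderiv (transition c e) (snd c p) a"
proof -
  have W: "atlas_open A (fst c \<inter> fst d \<inter> fst e)"
    using assms by (intro atlas_open_Int atlas_open_chart)
  have "(transition d e has_derivative fderiv (transition d e) (snd d p)) (at (transition c d (snd c p)))"
    using has_derivative_transition[of d e p] assms by simp
  from has_derivative_compose[OF has_derivative_transition[of c d p] this]
  have "((\<lambda>x. transition d e (transition c d x)) has_derivative
      (\<lambda>a. fderiv (transition d e) (snd d p) (fderiv (transition c d) (snd c p) a))) (at (snd c p))"
    using assms by simp
  then have "(transition c e has_derivative
      (\<lambda>a. fderiv (transition d e) (snd d p) (fderiv (transition c d) (snd c p) a))) (at (snd c p))"
    by (rule has_derivative_transform_within_open[OF _ open_chart_image[OF assms(1) W]])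
      (use assms in auto)
  then show ?thesis by (simp add: fderiv_eqI)
qed

lemma fderiv_transition_self:
  assumes "c \<in> A" "p \<in> fst c"
  shows "fderiv (transition c c) (snd c p) a = a"
proof -
  have "(transition c c has_derivative (\<lambda>a. a)) (at (snd c p))"
    by (rule has_derivative_transform_within_open[OF has_derivative_ident open_chart_range[OF assms(1)]])
      (use assms in auto)
  then show ?thesis by (simp add: fderiv_eqI)
qed

subsection \<open>Tangent vectors\<close>

lemma coord_vec_chart:
  "\<lbrakk>d \<in> A; p \<in> fst d\<rbrakk> \<Longrightarrow> coord_vec A c p a d = fderiv (transition c d) (snd c p) a"
  by (simp add: coord_vec_def)

lemma coord_vec_same [simp]: "\<lbrakk>c \<in> A; p \<in> fst c\<rbrakk> \<Longrightarrow> coord_vec A c p a c = a"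
  by (simp add: coord_vec_chart fderiv_transition_self)

lemma coord_vec_tangent [simp]: "\<lbrakk>c \<in> A; p \<in> fst c\<rbrakk> \<Longrightarrow> coord_vec A c p a \<in> tangent A p"
  unfolding tangent_def by (auto simp: coord_vec_def fderiv_transition_comp)

lemma tangent_change:
  "\<lbrakk>v \<in> tangent A p; c \<in> A; d \<in> A; p \<in> fst c; p \<in> fst d\<rbrakk> \<Longrightarrow> v d = fderiv (transition c d) (snd c p) (v c)"
  unfolding tangent_def by blast

lemma tangent_eq_0: "\<lbrakk>v \<in> tangent A p; c \<notin> A \<or> p \<notin> fst c\<rbrakk> \<Longrightarrow> v c = 0"
  unfolding tangent_def by blast

lemma coord_vec_eq: "\<lbrakk>v \<in> tangent A p; c \<in> A; p \<in> fst c\<rbrakk> \<Longrightarrow> coord_vec A c p (v c) = v"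
  unfolding coord_vec_def by (rule ext) (simp flip: tangent_change[of v p c], simp add: tangent_eq_0)

lemma tangent_eqI:
  "\<lbrakk>u \<in> tangent A p; v \<in> tangent A p; c \<in> A; p \<in> fst c; u c = v c\<rbrakk> \<Longrightarrow> u = v"
  using coord_vec_eq by metis

lemma tangent_outside: "\<lbrakk>p \<notin> points A; v \<in> tangent A p\<rbrakk> \<Longrightarrow> v = (\<lambda>_. 0)"
  by (auto simp: tangent_def points_def)

lemma tangentI:
  assumes "\<And>c. c \<notin> A \<or> p \<notin> fst c \<Longrightarrow> v c = 0"
    and "\<And>c d. \<lbrakk>c \<in> A; d \<in> A; p \<in> fst c; p \<in> fst d\<rbrakk> \<Longrightarrow> v d = fderiv (transition c d) (snd c p) (v c)"
  shows "v \<in> tangent A p"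
  using assms unfolding tangent_def by blast

lemma tangent_0: "(\<lambda>_. 0) \<in> tangent A p"
  by (rule tangentI) (auto simp: linear_0[OF linear_transition])

lemma tangent_add: "\<lbrakk>u \<in> tangent A p; v \<in> tangent A p\<rbrakk> \<Longrightarrow> (\<lambda>c. u c + v c) \<in> tangent A p"
  by (rule tangentI)
    (auto simp: linear_add[OF linear_transition] tangent_eq_0 simp flip: tangent_change)

lemma tangent_scaleR: "u \<in> tangent A p \<Longrightarrow> (\<lambda>c. r *\<^sub>R u c) \<in> tangent A p"
  by (rule tangentI)
    (auto simp: linear_cmul[OF linear_transition] tangent_eq_0 simp flip: tangent_change)

lemma coord_vec_add:
  "\<lbrakk>c \<in> A; p \<in> fst c\<rbrakk> \<Longrightarrow> coord_vec A c p (a + b) = (\<lambda>d. coord_vec A c p a d + coord_vec A c p b d)"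
  by (rule tangent_eqI[of _ p _ c]) (auto intro: tangent_add)

lemma coord_vec_scaleR:
  "\<lbrakk>c \<in> A; p \<in> fst c\<rbrakk> \<Longrightarrow> coord_vec A c p (r *\<^sub>R a) = (\<lambda>d. r *\<^sub>R coord_vec A c p a d)"
  by (rule tangent_eqI[of _ p _ c]) (auto intro: tangent_scaleR)

subsection \<open>Smoothness of functions and vector fields\<close>

lemma smooth_chart_change:
  assumes "c \<in> A" "d \<in> A" "W \<subseteq> fst c" "W \<subseteq> fst d" "atlas_open A W"
    and "smooth_on (\<lambda>x. f (chart_inv c x)) (snd c ` W)"
  shows "smooth_on (\<lambda>x. f (chart_inv d x)) (snd d ` W)"
proof -
  have o: "open (snd c ` W)" "open (snd d ` W)" using assms(1-5) by (auto intro!: open_chart_image)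
  have W: "transition d c (snd d p) = snd c p" "chart_inv c (snd c p) = p" "chart_inv d (snd d p) = p"
    if "p \<in> W" for p
    using that assms(1-4) by auto
  have "smooth_on (\<lambda>x. f (chart_inv c (transition d c x))) (snd d ` W)"
  proof (rule smooth_on_compose[OF o(2,1) _ assms(6)])
    show "smooth_on (transition d c) (snd d ` W)"
      by (rule smooth_on_subset[OF smooth_on_transition[OF assms(2,1)]]) (use assms(3,4) in blast)
    show "transition d c ` snd d ` W \<subseteq> snd c ` W" using W(1) by auto
  qed
  then show ?thesis
    by (rule smooth_on_cong[OF o(2), rotated]) (auto simp: W)
qed

lemma smooth_chart_local:
  assumes "c \<in> A"
    and "\<And>p. p \<in> fst c \<Longrightarrow> \<exists>W. atlas_open A W \<and> p \<in> W \<and> W \<subseteq> fst c \<and> smooth_on f (snd c ` W)"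
  shows "smooth_on f (snd c ` fst c)"
proof (rule smooth_on_local)
  fix x assume "x \<in> snd c ` fst c"
  then obtain p where "p \<in> fst c" "x = snd c p" by blast
  with assms show "\<exists>T. open T \<and> x \<in> T \<and> smooth_on f T"
    using open_chart_image[OF assms(1)] by (metis image_eqI)
qed (rule open_chart_range[OF assms(1)])

lemma smooth_functionD:
  "\<lbrakk>smooth_function A f; c \<in> A\<rbrakk> \<Longrightarrow> smooth_on (\<lambda>x. f (chart_inv c x)) (snd c ` fst c)"
  by (simp add: smooth_function_def comp_def)

text \<open>At each point one convenient chart may be chosen; all other charts follow by composing
  with a transition map. Functions defined by cases, such as extensions by 0, are treated this
  way.\<close>

lemma smooth_functionI_local:
  assumes "\<And>p. p \<in> points A \<Longrightarrow> \<exists>c W. c \<in> A \<and> atlas_open A W \<and> p \<in> W \<and> W \<subseteq> fst c \<and>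
    smooth_on (\<lambda>x. f (chart_inv c x)) (snd c ` W)"
  shows "smooth_function A f"
  unfolding smooth_function_def comp_def
proof (intro ballI smooth_chart_local)
  fix d p assume d: "d \<in> A" and p: "p \<in> fst d"
  then obtain c W where c: "c \<in> A" and W: "atlas_open A W" "p \<in> W" "W \<subseteq> fst c"
    and f: "smooth_on (\<lambda>x. f (chart_inv c x)) (snd c ` W)"
    using assms[of p] points_iff by blast
  have o: "atlas_open A (W \<inter> fst d)" using W d by (intro atlas_open_Int atlas_open_chart)
  have "smooth_on (\<lambda>x. f (chart_inv d x)) (snd d ` (W \<inter> fst d))"
    by (rule smooth_chart_change[OF c d _ _ o]) (use W in \<open>auto intro: smooth_on_subset[OF f]\<close>)
  then show "\<exists>W. atlas_open A W \<and> p \<in> W \<and> W \<subseteq> fst d \<and> smooth_on (\<lambda>x. f (chart_inv d x)) (snd d ` W)"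
    using o W p by blast
qed

lemma vector_field_tangent: "vector_field A X \<Longrightarrow> X p \<in> tangent A p"
  by (simp add: vector_field_def)

lemma vector_field_smooth:
  "\<lbrakk>vector_field A X; c \<in> A\<rbrakk> \<Longrightarrow> smooth_on (\<lambda>x. X (chart_inv c x) c) (snd c ` fst c)"
  by (simp add: vector_field_def)

lemma smooth_on_fderiv_transition:
  assumes "c \<in> A" "d \<in> A" "open S" "smooth_on g S" "smooth_on f S" "g ` S \<subseteq> snd c ` (fst c \<inter> fst d)"
  shows "smooth_on (\<lambda>x. fderiv (transition c d) (g x) (f x)) S"
proof (rule smooth_on_linear_family[OF assms(3) _ _ assms(5)])
  fix x assume "x \<in> S"
  then show "linear (fderiv (transition c d) (g x))"
    using assms(6) by (intro smooth_on_linear_fderiv[OF smooth_on_transition open_chart_Int] assms) auto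
next
  fix b :: 'e
  show "smooth_on (\<lambda>x. fderiv (transition c d) (g x) b) S"
    using smooth_on_compose[OF assms(3) open_chart_Int[OF assms(1,2)] assms(6)
        smooth_on_fderiv[OF smooth_on_transition[OF assms(1,2)]] assms(4)] .
qed

text \<open>As for functions, except that a change of chart also applies the derivative of the
  transition map to the component.\<close>

lemma vector_fieldI_local:
  assumes t: "\<And>p. X p \<in> tangent A p"
    and "\<And>p. p \<in> points A \<Longrightarrow> \<exists>c W. c \<in> A \<and> atlas_open A W \<and> p \<in> W \<and> W \<subseteq> fst c \<and>
      smooth_on (\<lambda>x. X (chart_inv c x) c) (snd c ` W)"
  shows "vector_field A X"
  unfolding vector_field_def
proof (intro conjI ballI allI t smooth_chart_local)
  fix d p assume d: "d \<in> A" and p: "p \<in> fst d"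
  then obtain c W where c: "c \<in> A" and W: "atlas_open A W" "p \<in> W" "W \<subseteq> fst c"
    and f: "smooth_on (\<lambda>x. X (chart_inv c x) c) (snd c ` W)"
    using assms(2)[of p] points_iff by blast
  have o: "atlas_open A (W \<inter> fst d)" using W d by (intro atlas_open_Int atlas_open_chart)
  then have open': "open (snd d ` (W \<inter> fst d))" using d by (intro open_chart_image) auto
  have "smooth_on (\<lambda>x. X (chart_inv d x) c) (snd d ` (W \<inter> fst d))"
    by (rule smooth_chart_change[OF c d _ _ o]) (use W in \<open>auto intro: smooth_on_subset[OF f]\<close>)
  moreover have "smooth_on (transition d c) (snd d ` (W \<inter> fst d))"
    by (rule smooth_on_subset[OF smooth_on_transition[OF d c]]) (use W in blast)
  ultimately have "smooth_on (\<lambda>x. fderiv (transition c d) (transition d c x) (X (chart_inv d x) c))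
      (snd d ` (W \<inter> fst d))"
    by (intro smooth_on_fderiv_transition[OF c d open']) (use W d in auto)
  then have "smooth_on (\<lambda>x. X (chart_inv d x) d) (snd d ` (W \<inter> fst d))"
    by (rule smooth_on_cong[OF open', rotated])
      (use c d W in \<open>auto simp flip: tangent_change[OF t c d]\<close>)
  then show "\<exists>W. atlas_open A W \<and> p \<in> W \<and> W \<subseteq> fst d \<and> smooth_on (\<lambda>x. X (chart_inv d x) d) (snd d ` W)"
    using o W p by blast
qed

lemma vector_fieldI:
  assumes "\<And>p. X p \<in> tangent A p" "\<And>c. c \<in> A \<Longrightarrow> smooth_on (\<lambda>x. X (chart_inv c x) c) (snd c ` fst c)"
  shows "vector_field A X"
  using assms by (simp add: vector_field_def)

lemma smooth_functionI:
  assumes "\<And>c. c \<in> A \<Longrightarrow> smooth_on (\<lambda>x. f (chart_inv c x)) (snd c ` fst c)"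
  shows "smooth_function A f"
  using assms by (simp add: smooth_function_def comp_def)

lemma smooth_function_const: "smooth_function A (\<lambda>_. r)"
  by (rule smooth_functionI) (intro smooth_on_const open_chart_range)

lemma smooth_function_add:
  "\<lbrakk>smooth_function A f; smooth_function A g\<rbrakk> \<Longrightarrow> smooth_function A (\<lambda>p. f p + g p)"
  by (rule smooth_functionI) (intro smooth_on_add open_chart_range smooth_functionD)

lemma smooth_function_uminus: "smooth_function A f \<Longrightarrow> smooth_function A (\<lambda>p. - f p)"
  by (rule smooth_functionI) (intro smooth_on_uminus open_chart_range smooth_functionD)

lemma smooth_function_mult:
  "\<lbrakk>smooth_function A f; smooth_function A g\<rbrakk> \<Longrightarrow> smooth_function A (\<lambda>p. f p * g p)"
  by (rule smooth_functionI) (intro smooth_on_mult open_chart_range smooth_functionD)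

lemma vector_field_0: "vector_field A (\<lambda>_ _. 0)"
  by (rule vector_fieldI) (intro smooth_on_const open_chart_range tangent_0; assumption)+

lemma vector_field_add:
  "\<lbrakk>vector_field A X; vector_field A Y\<rbrakk> \<Longrightarrow> vector_field A (\<lambda>p c. X p c + Y p c)"
  by (rule vector_fieldI) (intro smooth_on_add open_chart_range vector_field_smooth tangent_add vector_field_tangent; assumption)+

lemma vector_field_scaleR:
  "\<lbrakk>smooth_function A f; vector_field A X\<rbrakk> \<Longrightarrow> vector_field A (\<lambda>p c. f p *\<^sub>R X p c)"
  by (rule vector_fieldI) (intro smooth_on_scaleR open_chart_range vector_field_smooth smooth_functionD
      tangent_scaleR vector_field_tangent; assumption)+

lemma vector_field_sum:
  "(\<And>i. i \<in> I \<Longrightarrow> vector_field A (X i)) \<Longrightarrow> vector_field A (\<lambda>p c. \<Sum>i\<in>I. X i p c)"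
  by (induction I rule: infinite_finite_induct) (auto intro: vector_field_0 vector_field_add)

lemma vector_field_outside: "\<lbrakk>vector_field A X; p \<notin> points A\<rbrakk> \<Longrightarrow> X p = (\<lambda>_. 0)"
  by (rule tangent_outside) (auto intro: vector_field_tangent)

lemma vector_field_eqI:
  assumes "vector_field A X" "vector_field A Y"
    and "\<And>p c. \<lbrakk>c \<in> A; p \<in> fst c\<rbrakk> \<Longrightarrow> X p c = Y p c"
  shows "X = Y"
proof (intro ext)
  fix p c
  show "X p c = Y p c"
  proof (cases "c \<in> A \<and> p \<in> fst c")
    case False
    then show ?thesis
      using tangent_eq_0[OF vector_field_tangent[OF assms(1)], of c p]
        tangent_eq_0[OF vector_field_tangent[OF assms(2)], of c p] by simp
  qed (simp add: assms(3))
qed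

subsection \<open>Derivatives along tangent vectors\<close>

lemma smooth_function_has_derivative:
  "\<lbrakk>smooth_function A f; c \<in> A; p \<in> fst c\<rbrakk> \<Longrightarrow>
    ((\<lambda>x. f (chart_inv c x)) has_derivative fderiv (\<lambda>x. f (chart_inv c x)) (snd c p)) (at (snd c p))"
  by (intro smooth_on_has_derivative[OF smooth_functionD open_chart_range]) auto

text \<open>Chain rule with the transition map from d to c. It makes the choice of
  \<open>chart_at\<close> in \<open>derivation\<close> harmless.\<close>

lemma fderiv_chart_change:
  assumes "(\<lambda>x. f (chart_inv c x)) differentiable (at (snd c p))"
    and "c \<in> A" "d \<in> A" "p \<in> fst c" "p \<in> fst d" "v \<in> tangent A p"
  shows "fderiv (\<lambda>x. f (chart_inv d x)) (snd d p) (v d) = fderiv (\<lambda>x. f (chart_inv c x)) (snd c p) (v c)"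
proof -
  have "((\<lambda>x. f (chart_inv c x)) has_derivative fderiv (\<lambda>x. f (chart_inv c x)) (snd c p)) (at (transition d c (snd d p)))"
    unfolding transition_chart[OF assms(3,5)] using assms(1) by (simp only: frechet_derivative_works)
  from has_derivative_compose[OF has_derivative_transition[of d c p] this]
  have "((\<lambda>x. f (chart_inv c (transition d c x))) has_derivative
     (\<lambda>a. fderiv (\<lambda>x. f (chart_inv c x)) (snd c p) (fderiv (transition d c) (snd d p) a))) (at (snd d p))"
    using assms by simp
  then have "((\<lambda>x. f (chart_inv d x)) has_derivative
     (\<lambda>a. fderiv (\<lambda>x. f (chart_inv c x)) (snd c p) (fderiv (transition d c) (snd d p) a))) (at (snd d p))"
    by (rule has_derivative_transform_within_open[OF _ open_chart_Int[OF assms(3,2)]]) (use assms in auto)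
  then show ?thesis
    using tangent_change[of v p d c] assms by (simp add: fderiv_eqI)
qed

lemma derivation_chart:
  assumes "smooth_function A f" "X p \<in> tangent A p" "c \<in> A" "p \<in> fst c"
  shows "derivation A X f p = fderiv (\<lambda>x. f (chart_inv c x)) (snd c p) (X p c)"
proof -
  have "chart_at A p \<in> A \<and> p \<in> fst (chart_at A p)"
    using assms chart_at points_iff by blast
  moreover have "(\<lambda>x. f (chart_inv c x)) differentiable (at (snd c p))"
    using smooth_function_has_derivative[OF assms(1,3,4)] differentiable_def by blast
  ultimately show ?thesis
    unfolding derivation_def Let_def comp_def
    using assms by (intro fderiv_chart_change) auto
qed

lemma derivation_vector_field:
  assumes "smooth_function A f" "vector_field A X" "c \<in> A" "p \<in> fst c"
  shows "derivation A X f p = fderiv (\<lambda>x. f (chart_inv c x)) (snd c p) (X p c)"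
  using assms by (intro derivation_chart vector_field_tangent)

lemma derivation_add:
  assumes "smooth_function A f" "smooth_function A g" "vector_field A X" "p \<in> points A"
  shows "derivation A X (\<lambda>q. f q + g q) p = derivation A X f p + derivation A X g p"
proof -
  obtain c where c: "c \<in> A" "p \<in> fst c" using assms points_iff by blast
  show ?thesis
    using has_derivative_add[OF smooth_function_has_derivative[OF assms(1) c] smooth_function_has_derivative[OF assms(2) c]]
    by (simp add: derivation_vector_field[OF _ assms(3) c] assms smooth_function_add fderiv_eqI)
qed

lemma derivation_mult:
  assumes "smooth_function A f" "smooth_function A g" "vector_field A X" "p \<in> points A"
  shows "derivation A X (\<lambda>q. f q * g q) p = derivation A X f p * g p + f p * derivation A X g p"
proof -
  obtain c where c: "c \<in> A" "p \<in> fst c" using assms points_iff by blast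
  show ?thesis
    using has_derivative_mult[OF smooth_function_has_derivative[OF assms(1) c] smooth_function_has_derivative[OF assms(2) c]]
    by (simp add: derivation_vector_field[OF _ assms(3) c] assms c smooth_function_mult fderiv_eqI)
qed

lemma derivation_field_add:
  assumes "smooth_function A f" "vector_field A X" "vector_field A Y" "p \<in> points A"
  shows "derivation A (\<lambda>p c. X p c + Y p c) f p = derivation A X f p + derivation A Y f p"
proof -
  obtain c where c: "c \<in> A" "p \<in> fst c" using assms points_iff by blast
  show ?thesis
    using has_derivative_linear[OF smooth_function_has_derivative[OF assms(1) c]]
    by (simp add: derivation_chart[OF assms(1) _ c] vector_field_tangent assms tangent_add linear_add)
qed

lemma derivation_field_scaleR:
  assumes "smooth_function A f" "vector_field A X" "p \<in> points A"
  shows "derivation A (\<lambda>p c. g p *\<^sub>R X p c) f p = g p * derivation A X f p"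
proof -
  obtain c where c: "c \<in> A" "p \<in> fst c" using assms points_iff by blast
  show ?thesis
    using has_derivative_linear[OF smooth_function_has_derivative[OF assms(1) c]]
    by (simp add: derivation_chart[OF assms(1) _ c] vector_field_tangent assms tangent_scaleR linear_cmul)
qed

lemma smooth_function_derivation:
  assumes f: "smooth_function A f" and X: "vector_field A X"
  shows "smooth_function A (derivation A X f)"
proof (rule smooth_functionI)
  fix c assume c: "c \<in> A"
  let ?S = "snd c ` fst c"
  note o = open_chart_range[OF c]
  have "smooth_on (\<lambda>x. fderiv (\<lambda>x. f (chart_inv c x)) x (X (chart_inv c x) c)) ?S"
    by (rule smooth_on_linear_family[OF o _ smooth_on_fderiv[OF smooth_functionD[OF f c]] vector_field_smooth[OF X c]])
      (rule smooth_on_linear_fderiv[OF smooth_functionD[OF f c] o])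
  then show "smooth_on (\<lambda>x. derivation A X f (chart_inv c x)) ?S"
    by (rule smooth_on_cong[OF o, rotated]) (auto simp: derivation_vector_field[OF f X c] c)
qed

lemma has_derivative_derivation:
  assumes f: "smooth_function A f" and Y: "vector_field A Y" and c: "c \<in> A" "p \<in> fst c"
  defines "F \<equiv> \<lambda>x. f (chart_inv c x)"
  shows "((\<lambda>x. derivation A Y f (chart_inv c x)) has_derivative
    (\<lambda>a. fderiv F (snd c p) (fderiv (\<lambda>x. Y (chart_inv c x) c) (snd c p) a) +
      fderiv (\<lambda>x. fderiv F x (Y p c)) (snd c p) a)) (at (snd c p))"
proof -
  let ?S = "snd c ` fst c"
  note o = open_chart_range[OF c(1)]
  have p: "snd c p \<in> ?S" using c by blast
  have F: "smooth_on F ?S" unfolding F_def by (rule smooth_functionD[OF f c(1)])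
  have "((\<lambda>x. fderiv F x (Y (chart_inv c x) c)) has_derivative
      (\<lambda>a. fderiv F (snd c p) (fderiv (\<lambda>x. Y (chart_inv c x) c) (snd c p) a) +
      fderiv (\<lambda>x. fderiv F x (Y (chart_inv c (snd c p)) c)) (snd c p) a)) (at (snd c p))"
    by (rule has_derivative_linear_family[OF o p smooth_on_linear_fderiv[OF F o] smooth_on_fderiv[OF F]
          smooth_on_has_derivative[OF vector_field_smooth[OF Y c(1)] o p]])
  then show ?thesis
    unfolding chart_inv_chart[OF c]
    by (rule has_derivative_transform_within_open[OF _ o p])
      (auto simp: F_def derivation_vector_field[OF f Y c(1)] c)
qed

text \<open>In the commutator the Hessian terms cancel by symmetry of second derivatives. The claim
  is about components in a chart because it will serve to show that these components form a tangent
  vector.\<close>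

lemma fderiv_lie_bracket:
  assumes f: "smooth_function A f" and X: "vector_field A X" and Y: "vector_field A Y"
    and c: "c \<in> A" "p \<in> fst c"
  shows "fderiv (\<lambda>x. f (chart_inv c x)) (snd c p) (lie_bracket A X Y p c) =
    derivation A X (derivation A Y f) p - derivation A Y (derivation A X f) p"
proof -
  let ?F = "\<lambda>x. f (chart_inv c x)"
  have lin: "linear (fderiv ?F (snd c p))"
    by (rule has_derivative_linear[OF smooth_function_has_derivative[OF f c]])
  have "fderiv (\<lambda>x. fderiv ?F x (X p c)) (snd c p) (Y p c) = fderiv (\<lambda>x. fderiv ?F x (Y p c)) (snd c p) (X p c)"
    by (rule fderiv_symmetric_real[OF smooth_functionD[OF f c(1)] open_chart_range[OF c(1)]]) (use c in blast)
  then show ?thesis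
    using derivation_vector_field[OF smooth_function_derivation[OF f Y] X c]
      derivation_vector_field[OF smooth_function_derivation[OF f X] Y c]
    by (simp add: fderiv_eqI[OF has_derivative_derivation[OF f X c]] fderiv_eqI[OF has_derivative_derivation[OF f Y c]]
        lie_bracket_def c linear_diff[OF lin])
qed

lemma smooth_on_lie_bracket:
  assumes X: "vector_field A X" and Y: "vector_field A Y" and c: "c \<in> A"
  shows "smooth_on (\<lambda>x. lie_bracket A X Y (chart_inv c x) c) (snd c ` fst c)"
proof -
  note o = open_chart_range[OF c]
  have *: "smooth_on (\<lambda>x. fderiv (\<lambda>x. Y (chart_inv c x) c) x (X (chart_inv c x) c)) (snd c ` fst c)"
    if X: "vector_field A X" and Y: "vector_field A Y" for X Y
    by (rule smooth_on_linear_family[OF o _ smooth_on_fderiv[OF vector_field_smooth[OF Y c]] vector_field_smooth[OF X c]])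
      (rule smooth_on_linear_fderiv[OF vector_field_smooth[OF Y c] o])
  show ?thesis
    by (rule smooth_on_cong[OF o _ smooth_on_diff[OF o *[OF X Y] *[OF Y X]]]) (auto simp: lie_bracket_def c)
qed

end

section \<open>Congruence of derivations and the topology of the atlas\<close>

context atlas
begin

lemma smooth_function_cong:
  assumes "smooth_function A f" "\<And>p. p \<in> points A \<Longrightarrow> f p = g p"
  shows "smooth_function A g"
proof (rule smooth_functionI)
  fix c assume c: "c \<in> A"
  show "smooth_on (\<lambda>x. g (chart_inv c x)) (snd c ` fst c)"
    by (rule smooth_on_cong[OF open_chart_range[OF c] _ smooth_functionD[OF assms(1) c]])
      (use c in \<open>auto simp: points_iff intro!: assms(2)\<close>)
qed

lemma derivation_cong:
  assumes "smooth_function A f" "\<And>p. p \<in> points A \<Longrightarrow> f p = g p" "vector_field A X" "p \<in> points A"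
  shows "derivation A X f p = derivation A X g p"
proof -
  obtain c where c: "c \<in> A" "p \<in> fst c" using assms points_iff by blast
  have "fderiv (\<lambda>x. f (chart_inv c x)) (snd c p) = fderiv (\<lambda>x. g (chart_inv c x)) (snd c p)"
    by (rule frechet_derivative_transform_within_open[OF
          smooth_on_differentiable[OF smooth_functionD[OF assms(1) c(1)] open_chart_range[OF c(1)]]
          open_chart_range[OF c(1)]])
      (use c in \<open>auto simp: points_iff intro!: assms(2)\<close>)
  then show ?thesis
    using derivation_vector_field[OF assms(1,3) c]
      derivation_vector_field[OF smooth_function_cong[OF assms(1,2)] assms(3) c] by simp
qed

lemma topspace_atlas_topology: "topspace (atlas_topology A) = points A"
proof
  show "topspace (atlas_topology A) \<subseteq> points A"
    using openin_topspace[of "atlas_topology A"]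
    unfolding openin_atlas_topology[OF smooth_atlas] atlas_open_def by blast
  have "atlas_open A (points A)"
    unfolding atlas_open_def
  proof (intro conjI ballI)
    fix c assume c: "c \<in> A"
    then have "points A \<inter> fst c = fst c" by (auto simp: points_def)
    then show "open (snd c ` (points A \<inter> fst c))" using open_chart_range[OF c] by simp
  qed simp
  then show "points A \<subseteq> topspace (atlas_topology A)"
    by (simp add: openin_subset flip: openin_atlas_topology[OF smooth_atlas])
qed

lemma atlas_open_vimage_chart:
  assumes c: "c \<in> A" and V: "open V"
  shows "atlas_open A {p \<in> fst c. snd c p \<in> V}"
  unfolding atlas_open_def
proof (intro conjI ballI)
  fix d assume d: "d \<in> A"
  have "open (snd d ` (fst d \<inter> fst c) \<inter> transition d c -` V)"
    using continuous_on_open_vimage[OF open_chart_Int[OF d c]]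
      smooth_on_continuous_on[OF smooth_on_transition[OF d c]] V by (metis Int_commute)
  also have "snd d ` (fst d \<inter> fst c) \<inter> transition d c -` V = snd d ` ({p \<in> fst c. snd c p \<in> V} \<inter> fst d)"
    using d by force
  finally show "open (snd d ` ({p \<in> fst c. snd c p \<in> V} \<inter> fst d))" .
qed (use c in \<open>auto simp: points_def\<close>)

text \<open>Carries compact sets of the model space to compact sets of the manifold when cutoff
  functions are built.\<close>

lemma continuous_map_chart_inv:
  assumes c: "c \<in> A"
  shows "continuous_map (top_of_set (snd c ` fst c)) (atlas_topology A) (chart_inv c)"
  unfolding continuous_map_def topspace_atlas_topology
proof (intro conjI allI impI)
  show "chart_inv c \<in> topspace (top_of_set (snd c ` fst c)) \<rightarrow> points A"
    using c by (auto simp: points_def)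
  fix W assume "openin (atlas_topology A) W"
  then have "open (snd c ` (W \<inter> fst c))"
    using c by (simp add: openin_atlas_topology[OF smooth_atlas] atlas_open_def)
  moreover have "{x \<in> topspace (top_of_set (snd c ` fst c)). chart_inv c x \<in> W} = snd c ` (W \<inter> fst c)"
    using c by auto
  ultimately show "openin (top_of_set (snd c ` fst c)) {x \<in> topspace (top_of_set (snd c ` fst c)). chart_inv c x \<in> W}"
    by (simp add: openin_open_eq open_chart_range[OF c] image_mono)
qed

end

section \<open>Cutoff functions and extensions\<close>

locale manifold = atlas A for A :: "('m, 'e::euclidean_space) chart set" +
  assumes Hausdorff: "Hausdorff_space (atlas_topology A)"
begin

text \<open>Vanishing off W would be too weak: \<open>\<phi>\<close> vanishes off a set K inside W
  with open complement, hence near every point outside W. This makes its products with objects that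
  are smooth on W alone smooth everywhere.\<close>

definition cutoff :: "'m set \<Rightarrow> 'm \<Rightarrow> ('m \<Rightarrow> real) \<Rightarrow> bool" where
  "cutoff W p \<phi> \<longleftrightarrow> smooth_function A \<phi> \<and>
    (\<exists>V. atlas_open A V \<and> p \<in> V \<and> V \<subseteq> W \<and> (\<forall>q\<in>V. \<phi> q = 1)) \<and>
    (\<exists>K\<subseteq>W. atlas_open A (points A - K) \<and> (\<forall>q. q \<notin> K \<longrightarrow> \<phi> q = 0))"

lemma cutoff_smooth: "cutoff W p \<phi> \<Longrightarrow> smooth_function A \<phi>"
  by (simp add: cutoff_def)

lemma cutoff_eq_1: "cutoff W p \<phi> \<Longrightarrow> \<phi> p = 1"
  by (auto simp: cutoff_def)

lemma cutoff_eq_0: "\<lbrakk>cutoff W p \<phi>; q \<notin> W\<rbrakk> \<Longrightarrow> \<phi> q = 0"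
  by (auto simp: cutoff_def)

text \<open>A cutoff function of the model space that vanishes off a compact subset of the chart
  image is transported to the manifold and extended by 0.\<close>

lemma cutoff_exists:
  assumes c: "c \<in> A" and W: "atlas_open A W" "p \<in> W" "W \<subseteq> fst c"
  obtains \<phi> where "cutoff W p \<phi>"
proof -
  obtain f V K where f: "smooth_on f UNIV" and V: "open V" "snd c p \<in> V"
    and K: "compact K" "V \<subseteq> K" "K \<subseteq> snd c ` W"
    and f1: "\<forall>y\<in>V. f y = (1::real)" and f0: "\<forall>y. y \<notin> K \<longrightarrow> f y = 0"
    using smooth_cutoff[OF open_chart_image[OF c W(1,3)] imageI[OF W(2)]] .
  define \<phi> where "\<phi> q = (if q \<in> fst c then f (snd c q) else 0)" for q
  define K' where "K' = {q \<in> fst c. snd c q \<in> K}"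
  have K'W: "K' \<subseteq> W"
  proof
    fix q assume "q \<in> K'"
    then obtain q' where "q \<in> fst c" "q' \<in> W" "snd c q = snd c q'" using K by (auto simp: K'_def)
    then show "q \<in> W" using W(3) inj_onD[OF inj_on_chart[OF c]] by blast
  qed
  have K'_image: "K' = chart_inv c ` K"
  proof
    show "K' \<subseteq> chart_inv c ` K" unfolding K'_def using c by (auto intro!: image_eqI[where x = "snd c _"])
    show "chart_inv c ` K \<subseteq> K'" unfolding K'_def using c K(3) W(3) by (auto simp: subset_iff image_iff)
  qed
  have "compactin (top_of_set (snd c ` fst c)) K"
    using K(1) order_trans[OF K(3) image_mono[OF W(3)]] by (simp add: compactin_subtopology)
  then have "compactin (atlas_topology A) K'"
    unfolding K'_image by (rule image_compactin[OF _ continuous_map_chart_inv[OF c]])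
  \<comment> \<open>Here the Hausdorff axiom enters. Closedness of K' gives points outside the chart
    a neighbourhood on which \<open>\<phi>\<close> is 0.\<close>
  then have "closedin (atlas_topology A) K'" by (rule compactin_imp_closedin[OF Hausdorff])
  then have K'_closed: "atlas_open A (points A - K')"
    by (simp add: closedin_def topspace_atlas_topology openin_atlas_topology[OF smooth_atlas])
  have \<phi>0: "\<phi> q = 0" if "q \<notin> K'" for q
    using that f0 by (auto simp: \<phi>_def K'_def)
  have smooth: "smooth_function A \<phi>"
  proof (rule smooth_functionI_local)
    fix q assume q: "q \<in> points A"
    show "\<exists>d W. d \<in> A \<and> atlas_open A W \<and> q \<in> W \<and> W \<subseteq> fst d \<and> smooth_on (\<lambda>x. \<phi> (chart_inv d x)) (snd d ` W)"
    proof (cases "q \<in> fst c")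
      case True
      have "smooth_on (\<lambda>x. \<phi> (chart_inv c x)) (snd c ` fst c)"
        by (rule smooth_on_cong[OF open_chart_range[OF c] _ smooth_on_subset[OF f]]) (auto simp: \<phi>_def c)
      then show ?thesis using True c atlas_open_chart by blast
    next
      case False
      obtain d where d: "d \<in> A" "q \<in> fst d" using q points_iff by blast
      let ?W = "fst d \<inter> (points A - K')"
      have o: "atlas_open A ?W" using d K'_closed by (intro atlas_open_Int atlas_open_chart)
      have o2: "open (snd d ` ?W)" by (rule open_chart_image[OF d(1) o]) blast
      have "smooth_on (\<lambda>x. \<phi> (chart_inv d x)) (snd d ` ?W)"
        by (rule smooth_on_cong[OF o2 _ smooth_on_const[OF o2]]) (use d in \<open>auto simp: \<phi>0\<close>)
      moreover have "q \<in> ?W" using d q False by (auto simp: K'_def)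
      ultimately show ?thesis using d(1) o by blast
    qed
  qed
  let ?V = "{q \<in> fst c. snd c q \<in> V}"
  have "\<exists>V. atlas_open A V \<and> p \<in> V \<and> V \<subseteq> W \<and> (\<forall>q\<in>V. \<phi> q = 1)"
  proof (intro exI conjI)
    show "atlas_open A ?V" by (rule atlas_open_vimage_chart[OF c V(1)])
    show "p \<in> ?V" using W V by auto
    show "?V \<subseteq> W" using K(2) K'W by (auto simp: K'_def)
    show "\<forall>q\<in>?V. \<phi> q = 1" using f1 by (auto simp: \<phi>_def)
  qed
  moreover have "\<exists>K\<subseteq>W. atlas_open A (points A - K) \<and> (\<forall>q. q \<notin> K \<longrightarrow> \<phi> q = 0)"
    using K'W K'_closed \<phi>0 by blast
  ultimately have "cutoff W p \<phi>" using smooth by (simp add: cutoff_def)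
  then show thesis by (rule that)
qed

lemma cutoff_vanishes_near:
  assumes "cutoff W p \<phi>" "q \<in> points A" "q \<notin> W"
  obtains d V where "d \<in> A" "atlas_open A V" "q \<in> V" "V \<subseteq> fst d" "\<forall>r\<in>V. \<phi> r = 0"
proof -
  obtain K where K: "K \<subseteq> W" "atlas_open A (points A - K)" "\<forall>r. r \<notin> K \<longrightarrow> \<phi> r = 0"
    using assms(1) unfolding cutoff_def by blast
  obtain d where d: "d \<in> A" "q \<in> fst d" using assms(2) points_iff by blast
  show thesis
    by (rule that[OF d(1) atlas_open_Int[OF atlas_open_chart[OF d(1)] K(2)]]) (use assms d K in auto)
qed

text \<open>Around a point of W both factors are smooth in the chart c; around any other point the
  cutoff function vanishes identically, whatever f is there.\<close>

lemma cutoff_mult_smooth: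
  assumes \<phi>: "cutoff W p \<phi>" and c: "c \<in> A" and W: "atlas_open A W" "W \<subseteq> fst c"
    and f: "smooth_on (\<lambda>x. f (chart_inv c x)) (snd c ` W)"
  shows "smooth_function A (\<lambda>q. \<phi> q * f q)"
proof (rule smooth_functionI_local)
  fix q assume q: "q \<in> points A"
  show "\<exists>d V. d \<in> A \<and> atlas_open A V \<and> q \<in> V \<and> V \<subseteq> fst d \<and>
      smooth_on (\<lambda>x. \<phi> (chart_inv d x) * f (chart_inv d x)) (snd d ` V)"
  proof (cases "q \<in> W")
    case True
    have "smooth_on (\<lambda>x. \<phi> (chart_inv c x)) (snd c ` W)"
      by (rule smooth_on_subset[OF smooth_functionD[OF cutoff_smooth[OF \<phi>] c]]) (use W in blast)
    then have "smooth_on (\<lambda>x. \<phi> (chart_inv c x) * f (chart_inv c x)) (snd c ` W)"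
      by (intro smooth_on_mult f open_chart_image[OF c W])
    then show ?thesis using True c W by blast
  next
    case False
    obtain d V where d: "d \<in> A" and V: "atlas_open A V" "q \<in> V" "V \<subseteq> fst d" and \<phi>0: "\<forall>r\<in>V. \<phi> r = 0"
      using cutoff_vanishes_near[OF \<phi> q False] .
    have o: "open (snd d ` V)" by (rule open_chart_image[OF d V(1,3)])
    have "smooth_on (\<lambda>x. \<phi> (chart_inv d x) * f (chart_inv d x)) (snd d ` V)"
      by (rule smooth_on_cong[OF o _ smooth_on_const[OF o]]) (use d V \<phi>0 in \<open>auto simp: subset_iff\<close>)
    then show ?thesis using d V by blast
  qed
qed

lemma cutoff_scaleR_vector_field:
  assumes \<phi>: "cutoff W p \<phi>" and c: "c \<in> A" and W: "atlas_open A W" "W \<subseteq> fst c"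
    and t: "\<And>q. q \<in> W \<Longrightarrow> X q \<in> tangent A q"
    and X: "smooth_on (\<lambda>x. X (chart_inv c x) c) (snd c ` W)"
  shows "vector_field A (\<lambda>q d. \<phi> q *\<^sub>R X q d)"
proof (rule vector_fieldI_local)
  fix q show "(\<lambda>d. \<phi> q *\<^sub>R X q d) \<in> tangent A q"
    using t[of q] cutoff_eq_0[OF \<phi>, of q] tangent_0[of q] by (cases "q \<in> W") (auto intro: tangent_scaleR)
next
  fix q assume q: "q \<in> points A"
  show "\<exists>d V. d \<in> A \<and> atlas_open A V \<and> q \<in> V \<and> V \<subseteq> fst d \<and>
      smooth_on (\<lambda>x. \<phi> (chart_inv d x) *\<^sub>R X (chart_inv d x) d) (snd d ` V)"
  proof (cases "q \<in> W")
    case True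
    have "smooth_on (\<lambda>x. \<phi> (chart_inv c x)) (snd c ` W)"
      by (rule smooth_on_subset[OF smooth_functionD[OF cutoff_smooth[OF \<phi>] c]]) (use W in blast)
    then have "smooth_on (\<lambda>x. \<phi> (chart_inv c x) *\<^sub>R X (chart_inv c x) c) (snd c ` W)"
      by (intro smooth_on_scaleR X open_chart_image[OF c W])
    then show ?thesis using True c W by blast
  next
    case False
    obtain d V where d: "d \<in> A" and V: "atlas_open A V" "q \<in> V" "V \<subseteq> fst d" and \<phi>0: "\<forall>r\<in>V. \<phi> r = 0"
      using cutoff_vanishes_near[OF \<phi> q False] .
    have o: "open (snd d ` V)" by (rule open_chart_image[OF d V(1,3)])
    have "smooth_on (\<lambda>x. \<phi> (chart_inv d x) *\<^sub>R X (chart_inv d x) d) (snd d ` V)"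
      by (rule smooth_on_cong[OF o _ smooth_on_const[OF o]]) (use d V \<phi>0 in \<open>auto simp: subset_iff\<close>)
    then show ?thesis using d V by blast
  qed
qed

text \<open>Agreement holds only near p, where the cutoff function is 1, which is all that
  derivatives at p can see.\<close>

lemma extend_function:
  assumes c: "c \<in> A" and W: "atlas_open A W" "p \<in> W" "W \<subseteq> fst c"
    and F: "smooth_on F (snd c ` W)"
  obtains f V where "smooth_function A f" "atlas_open A V" "p \<in> V" "V \<subseteq> W"
    "\<forall>q\<in>V. f q = F (snd c q)"
proof -
  obtain \<phi> where \<phi>: "cutoff W p \<phi>" using cutoff_exists[OF c W] .
  have "smooth_on (\<lambda>x. F (snd c (chart_inv c x))) (snd c ` W)"
    by (rule smooth_on_cong[OF open_chart_image[OF c W(1,3)] _ F]) (use c W(3) in \<open>auto simp: subset_iff\<close>)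
  then have "smooth_function A (\<lambda>q. \<phi> q * F (snd c q))" by (rule cutoff_mult_smooth[OF \<phi> c W(1,3)])
  moreover obtain V where "atlas_open A V" "p \<in> V" "V \<subseteq> W" "\<forall>q\<in>V. \<phi> q = 1"
    using \<phi> unfolding cutoff_def by blast
  ultimately show thesis by (intro that[of "\<lambda>q. \<phi> q * F (snd c q)" V]) auto
qed

lemma extend_vector_field:
  assumes c: "c \<in> A" and W: "atlas_open A W" "p \<in> W" "W \<subseteq> fst c"
    and F: "smooth_on F (snd c ` W)"
  obtains X V where "vector_field A X" "atlas_open A V" "p \<in> V" "V \<subseteq> W"
    "\<forall>q\<in>V. X q = coord_vec A c q (F (snd c q))"
proof -
  obtain \<phi> where \<phi>: "cutoff W p \<phi>" using cutoff_exists[OF c W] .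
  let ?X = "\<lambda>q. coord_vec A c q (F (snd c q))"
  have "smooth_on (\<lambda>x. ?X (chart_inv c x) c) (snd c ` W)"
    by (rule smooth_on_cong[OF open_chart_image[OF c W(1,3)] _ F]) (use c W(3) in \<open>auto simp: subset_iff\<close>)
  then have "vector_field A (\<lambda>q d. \<phi> q *\<^sub>R ?X q d)"
    by (intro cutoff_scaleR_vector_field[OF \<phi> c W(1,3)]) (use c W(3) in auto)
  moreover obtain V where "atlas_open A V" "p \<in> V" "V \<subseteq> W" "\<forall>q\<in>V. \<phi> q = 1"
    using \<phi> unfolding cutoff_def by blast
  ultimately show thesis by (intro that[of "\<lambda>q d. \<phi> q *\<^sub>R ?X q d" V]) auto
qed

text \<open>Constant components in a chart, cut off around p. Statements about single tangent
  vectors are thereby reduced to global fields, the only arguments a connection accepts.\<close>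

lemma vector_field_through:
  assumes "v \<in> tangent A p"
  obtains X where "vector_field A X" "X p = v"
proof (cases "p \<in> points A")
  case True
  then obtain c where c: "c \<in> A" "p \<in> fst c" using points_iff by blast
  obtain X V where X: "vector_field A X" and V: "atlas_open A V" "p \<in> V" "V \<subseteq> fst c"
    and eq: "\<forall>q\<in>V. X q = coord_vec A c q (v c)"
    using extend_vector_field[OF c(1) atlas_open_chart[OF c(1)] c(2) order_refl
        smooth_on_const[OF open_chart_range[OF c(1)], of "v c"]] .
  show thesis
    by (rule that[OF X]) (simp add: bspec[OF eq V(2)] coord_vec_eq[OF assms c])
next
  case False
  then have "v = (\<lambda>_. 0)" using assms by (rule tangent_outside)
  then show thesis by (intro that[OF vector_field_0]) simp
qed

text \<open>The coordinate functions of the chart, extended from a neighbourhood of p to the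
  manifold, serve as test functions.\<close>

lemma chart_vector_eqI:
  assumes c: "c \<in> A" "p \<in> fst c"
    and "\<And>f. smooth_function A f \<Longrightarrow> fderiv (\<lambda>x. f (chart_inv c x)) (snd c p) a = fderiv (\<lambda>x. f (chart_inv c x)) (snd c p) b"
  shows "a = b"
proof (rule euclidean_eqI)
  fix e :: 'e assume "e \<in> Basis"
  have e: "smooth_on (\<lambda>x. x \<bullet> e) (snd c ` fst c)"
    by (intro smooth_intros open_chart_range c)
  obtain f V where f: "smooth_function A f" and V: "atlas_open A V" "p \<in> V" "V \<subseteq> fst c"
    and eq: "\<forall>q\<in>V. f q = snd c q \<bullet> e"
    using extend_function[OF c(1) atlas_open_chart[OF c(1)] c(2) order_refl e] .
  have "((\<lambda>x. x \<bullet> e) has_derivative (\<lambda>a. a \<bullet> e)) (at (snd c p))"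
    by (auto intro!: derivative_eq_intros)
  then have "((\<lambda>x. f (chart_inv c x)) has_derivative (\<lambda>a. a \<bullet> e)) (at (snd c p))"
    by (rule has_derivative_transform_within_open[OF _ open_chart_image[OF c(1) V(1,3)]])
      (use c V eq in \<open>auto simp: subset_iff\<close>)
  then show "a \<bullet> e = b \<bullet> e" using assms(3)[OF f] by (simp add: fderiv_eqI)
qed

lemma tangent_eqI_derivation:
  assumes "X p \<in> tangent A p" "Y p \<in> tangent A p" "p \<in> points A"
    and "\<And>f. smooth_function A f \<Longrightarrow> derivation A X f p = derivation A Y f p"
  shows "X p = Y p"
proof -
  obtain c where c: "c \<in> A" "p \<in> fst c" using assms points_iff by blast
  have "X p c = Y p c"
    using assms(4) by (intro chart_vector_eqI[OF c]) (simp add: derivation_chart[OF _ _ c] assms(1,2))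
  then show ?thesis using tangent_eqI[OF assms(1,2) c] by blast
qed

lemma vector_field_eqI_derivation:
  assumes "vector_field A X" "vector_field A Y"
    and "\<And>f p. \<lbrakk>smooth_function A f; p \<in> points A\<rbrakk> \<Longrightarrow> derivation A X f p = derivation A Y f p"
  shows "X = Y"
proof
  fix p show "X p = Y p"
  proof (cases "p \<in> points A")
    case True
    then show ?thesis using tangent_eqI_derivation[of X p Y] vector_field_tangent assms by blast
  next
    case False
    then show ?thesis using vector_field_outside[OF assms(1)] vector_field_outside[OF assms(2)] by simp
  qed
qed

text \<open>The number \<open>l f\<close> does not depend on the chart: all components of v induce
  the same derivation, and since functions separate vectors, the transition maps relate them. For a
  bracket, \<open>l\<close> is the commutator.\<close>

lemma tangentI_derivation:
  assumes "\<And>c. c \<notin> A \<or> p \<notin> fst c \<Longrightarrow> v c = 0"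
    and "\<And>c f. \<lbrakk>c \<in> A; p \<in> fst c; smooth_function A f\<rbrakk> \<Longrightarrow> fderiv (\<lambda>x. f (chart_inv c x)) (snd c p) (v c) = l f"
  shows "v \<in> tangent A p"
proof (rule tangentI[OF assms(1)])
  fix c d assume cd: "c \<in> A" "d \<in> A" "p \<in> fst c" "p \<in> fst d"
  show "v d = fderiv (transition c d) (snd c p) (v c)"
  proof (rule chart_vector_eqI[OF cd(2,4)])
    fix f assume f: "smooth_function A f"
    have "fderiv (\<lambda>x. f (chart_inv d x)) (snd d p) (coord_vec A c p (v c) d) =
        fderiv (\<lambda>x. f (chart_inv c x)) (snd c p) (coord_vec A c p (v c) c)"
      using cd smooth_function_has_derivative[OF f cd(1,3)]
      by (intro fderiv_chart_change) (auto simp: differentiable_def)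
    then show "fderiv (\<lambda>x. f (chart_inv d x)) (snd d p) (v d) =
        fderiv (\<lambda>x. f (chart_inv d x)) (snd d p) (fderiv (transition c d) (snd c p) (v c))"
      using cd by (simp add: assms(2) f) (simp add: coord_vec_chart)
  qed
qed auto

section \<open>Lie brackets as commutators of derivations\<close>

lemma vector_field_lie_bracket:
  assumes "vector_field A X" "vector_field A Y"
  shows "vector_field A (lie_bracket A X Y)"
proof (rule vector_fieldI)
  show "lie_bracket A X Y p \<in> tangent A p" for p
  proof (rule tangentI_derivation)
    show "lie_bracket A X Y p c = 0" if "c \<notin> A \<or> p \<notin> fst c" for c
      using that by (auto simp: lie_bracket_def)
  qed (rule fderiv_lie_bracket[OF _ assms])
qed (rule smooth_on_lie_bracket[OF assms])

lemma derivation_lie_bracket: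
  assumes "smooth_function A f" "vector_field A X" "vector_field A Y" "p \<in> points A"
  shows "derivation A (lie_bracket A X Y) f p =
    derivation A X (derivation A Y f) p - derivation A Y (derivation A X f) p"
proof -
  obtain c where c: "c \<in> A" "p \<in> fst c" using assms points_iff by blast
  show ?thesis
    using derivation_vector_field[OF assms(1) vector_field_lie_bracket[OF assms(2,3)] c]
      fderiv_lie_bracket[OF assms(1-3) c] by simp
qed

text \<open>Both sides are compared as derivations; the product rule for
  \<open>f p * derivation A X g p\<close> along Y leaves the extra term.\<close>

lemma lie_bracket_scaleR_left:
  assumes f: "smooth_function A f" and X: "vector_field A X" and Y: "vector_field A Y"
  shows "lie_bracket A (\<lambda>p c. f p *\<^sub>R X p c) Y =
    (\<lambda>p c. f p *\<^sub>R lie_bracket A X Y p c + (- derivation A Y f p) *\<^sub>R X p c)"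
proof (rule vector_field_eqI_derivation)
  have fX: "vector_field A (\<lambda>p c. f p *\<^sub>R X p c)" by (rule vector_field_scaleR[OF f X])
  have b: "vector_field A (lie_bracket A X Y)" by (rule vector_field_lie_bracket[OF X Y])
  have fb: "vector_field A (\<lambda>p c. f p *\<^sub>R lie_bracket A X Y p c)" by (rule vector_field_scaleR[OF f b])
  have gX: "vector_field A (\<lambda>p c. (- derivation A Y f p) *\<^sub>R X p c)"
    by (rule vector_field_scaleR[OF smooth_function_uminus[OF smooth_function_derivation[OF f Y]] X])
  show "vector_field A (lie_bracket A (\<lambda>p c. f p *\<^sub>R X p c) Y)"
    by (rule vector_field_lie_bracket[OF fX Y])
  show "vector_field A (\<lambda>p c. f p *\<^sub>R lie_bracket A X Y p c + (- derivation A Y f p) *\<^sub>R X p c)"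
    by (rule vector_field_add[OF fb gX])
  fix g p assume g: "smooth_function A g" and p: "p \<in> points A"
  have "derivation A Y (derivation A (\<lambda>p c. f p *\<^sub>R X p c) g) p = derivation A Y (\<lambda>p. f p * derivation A X g p) p"
    by (rule derivation_cong[OF smooth_function_derivation[OF g fX] _ Y p]) (rule derivation_field_scaleR[OF g X])
  also have "\<dots> = derivation A Y f p * derivation A X g p + f p * derivation A Y (derivation A X g) p"
    by (rule derivation_mult[OF f smooth_function_derivation[OF g X] Y p])
  finally show "derivation A (lie_bracket A (\<lambda>p c. f p *\<^sub>R X p c) Y) g p =
      derivation A (\<lambda>p c. f p *\<^sub>R lie_bracket A X Y p c + (- derivation A Y f p) *\<^sub>R X p c) g p"
    unfolding derivation_field_add[OF g fb gX p] derivation_field_scaleR[OF g b p] derivation_field_scaleR[OF g X p]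
      derivation_lie_bracket[OF g fX Y p] derivation_lie_bracket[OF g X Y p]
      derivation_field_scaleR[OF smooth_function_derivation[OF g Y] X p]
    by (simp add: algebra_simps)
qed

lemma lie_bracket_add_left:
  assumes X: "vector_field A X" and Z: "vector_field A Z" and Y: "vector_field A Y"
  shows "lie_bracket A (\<lambda>p c. X p c + Z p c) Y = (\<lambda>p c. lie_bracket A X Y p c + lie_bracket A Z Y p c)"
proof (rule vector_field_eqI_derivation)
  have XZ: "vector_field A (\<lambda>p c. X p c + Z p c)" by (rule vector_field_add[OF X Z])
  note b = vector_field_lie_bracket[OF X Y] vector_field_lie_bracket[OF Z Y]
  show "vector_field A (lie_bracket A (\<lambda>p c. X p c + Z p c) Y)"
    by (rule vector_field_lie_bracket[OF XZ Y])
  show "vector_field A (\<lambda>p c. lie_bracket A X Y p c + lie_bracket A Z Y p c)"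
    by (rule vector_field_add[OF b])
  fix g p assume g: "smooth_function A g" and p: "p \<in> points A"
  have "derivation A Y (derivation A (\<lambda>p c. X p c + Z p c) g) p = derivation A Y (\<lambda>p. derivation A X g p + derivation A Z g p) p"
    by (rule derivation_cong[OF smooth_function_derivation[OF g XZ] _ Y p]) (rule derivation_field_add[OF g X Z])
  also have "\<dots> = derivation A Y (derivation A X g) p + derivation A Y (derivation A Z g) p"
    by (rule derivation_add[OF smooth_function_derivation[OF g X] smooth_function_derivation[OF g Z] Y p])
  finally show "derivation A (lie_bracket A (\<lambda>p c. X p c + Z p c) Y) g p =
      derivation A (\<lambda>p c. lie_bracket A X Y p c + lie_bracket A Z Y p c) g p"
    unfolding derivation_field_add[OF g b p] derivation_lie_bracket[OF g XZ Y p]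
      derivation_lie_bracket[OF g X Y p] derivation_lie_bracket[OF g Z Y p]
      derivation_field_add[OF smooth_function_derivation[OF g Y] X Z p]
    by simp
qed

lemma lie_bracket_swap: "lie_bracket A X Y = (\<lambda>p c. (- 1) *\<^sub>R lie_bracket A Y X p c)"
  by (auto simp: lie_bracket_def fun_eq_iff)

section \<open>Tensorial operations\<close>

text \<open>Linearity over smooth functions for an expression already evaluated at p. Values in any
  real vector space cover components of a curvature as well as the real-valued Codazzi
  expression.\<close>

definition tensorial :: "'m \<Rightarrow> (('m, 'e) vfield \<Rightarrow> 'c::real_vector) \<Rightarrow> bool" where
  "tensorial p T \<longleftrightarrow>
    (\<forall>X Y. vector_field A X \<and> vector_field A Y \<longrightarrow> T (\<lambda>q c. X q c + Y q c) = T X + T Y) \<and>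
    (\<forall>f X. smooth_function A f \<and> vector_field A X \<longrightarrow> T (\<lambda>q c. f q *\<^sub>R X q c) = f p *\<^sub>R T X)"

lemma tensorialI:
  assumes "\<And>X Y. \<lbrakk>vector_field A X; vector_field A Y\<rbrakk> \<Longrightarrow> T (\<lambda>q c. X q c + Y q c) = T X + T Y"
    and "\<And>f X. \<lbrakk>smooth_function A f; vector_field A X\<rbrakk> \<Longrightarrow> T (\<lambda>q c. f q *\<^sub>R X q c) = f p *\<^sub>R T X"
  shows "tensorial p T"
  using assms by (simp add: tensorial_def)

lemma tensorial_add:
  "\<lbrakk>tensorial p T; vector_field A X; vector_field A Y\<rbrakk> \<Longrightarrow> T (\<lambda>q c. X q c + Y q c) = T X + T Y"
  by (simp add: tensorial_def)

lemma tensorial_scaleR: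
  "\<lbrakk>tensorial p T; smooth_function A f; vector_field A X\<rbrakk> \<Longrightarrow> T (\<lambda>q c. f q *\<^sub>R X q c) = f p *\<^sub>R T X"
  by (simp add: tensorial_def)

lemma tensorial_0: "tensorial p T \<Longrightarrow> T (\<lambda>_ _. 0) = 0"
  using tensorial_scaleR[OF _ smooth_function_const[of 0] vector_field_0, of p T] by simp

lemma tensorial_sum:
  assumes T: "tensorial p T"
    and "\<And>i. i \<in> I \<Longrightarrow> smooth_function A (f i)" "\<And>i. i \<in> I \<Longrightarrow> vector_field A (X i)"
  shows "T (\<lambda>q c. \<Sum>i\<in>I. f i q *\<^sub>R X i q c) = (\<Sum>i\<in>I. f i p *\<^sub>R T (X i))"
  using assms(2,3)
proof (induction I rule: infinite_finite_induct)
  case (insert i I)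
  then have "T (\<lambda>q c. f i q *\<^sub>R X i q c + (\<Sum>i\<in>I. f i q *\<^sub>R X i q c)) =
      T (\<lambda>q c. f i q *\<^sub>R X i q c) + T (\<lambda>q c. \<Sum>i\<in>I. f i q *\<^sub>R X i q c)"
    by (intro tensorial_add[OF T] vector_field_sum vector_field_scaleR) auto
  moreover have "T (\<lambda>q c. f i q *\<^sub>R X i q c) = f i p *\<^sub>R T (X i)"
    by (intro tensorial_scaleR[OF T] insert.prems) auto
  ultimately show ?case using insert by simp
qed (auto simp: tensorial_0[OF T])

text \<open>Multiplied by the square of a cutoff function, X becomes a combination of global fields
  with global coefficients, and the coefficients vanish at p together with X.\<close>

lemma tensorial_eq_0:
  assumes T: "tensorial p T" and X: "vector_field A X" "X p = (\<lambda>_. 0)" and p: "p \<in> points A"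
  shows "T X = 0"
proof -
  obtain c where c: "c \<in> A" "p \<in> fst c" using p points_iff by blast
  note cc = atlas_open_chart[OF c(1)]
  obtain \<phi> where \<phi>: "cutoff (fst c) p \<phi>" using cutoff_exists[OF c(1) cc c(2) order_refl] .
  have f: "smooth_function A (\<lambda>q. \<phi> q * (X q c \<bullet> b))" for b
    by (rule cutoff_mult_smooth[OF \<phi> c(1) cc order_refl])
      (intro smooth_intros open_chart_range vector_field_smooth X c)
  have "smooth_on (\<lambda>x. coord_vec A c (chart_inv c x) b c) (snd c ` fst c)" for b
    by (rule smooth_on_cong[OF open_chart_range[OF c(1)] _ smooth_on_const[OF open_chart_range[OF c(1)]]])
      (use c in auto)
  then have E: "vector_field A (\<lambda>q d. \<phi> q *\<^sub>R coord_vec A c q b d)" for b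
    by (intro cutoff_scaleR_vector_field[OF \<phi> c(1) cc order_refl]) (use c in auto)
  \<comment> \<open>One factor \<open>\<phi>\<close> makes the coefficients global functions, the
    other makes the coordinate fields global.\<close>
  have eq: "(\<lambda>q d. (\<phi> q * \<phi> q) *\<^sub>R X q d) =
      (\<lambda>q d. \<Sum>b\<in>Basis. (\<phi> q * (X q c \<bullet> b)) *\<^sub>R (\<phi> q *\<^sub>R coord_vec A c q b d))"
  proof (rule vector_field_eqI)
    show "vector_field A (\<lambda>q d. (\<phi> q * \<phi> q) *\<^sub>R X q d)"
      by (intro vector_field_scaleR smooth_function_mult cutoff_smooth[OF \<phi>] X)
    show "vector_field A (\<lambda>q d. \<Sum>b\<in>Basis. (\<phi> q * (X q c \<bullet> b)) *\<^sub>R (\<phi> q *\<^sub>R coord_vec A c q b d))"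
      by (intro vector_field_sum vector_field_scaleR[OF f E])
    fix q d assume d: "d \<in> A" "q \<in> fst d"
    show "(\<phi> q * \<phi> q) *\<^sub>R X q d = (\<Sum>b\<in>Basis. (\<phi> q * (X q c \<bullet> b)) *\<^sub>R (\<phi> q *\<^sub>R coord_vec A c q b d))"
    proof (cases "q \<in> fst c")
      case True
      have "X q d = (\<Sum>b\<in>Basis. (X q c \<bullet> b) *\<^sub>R coord_vec A c q b d)"
        using d c True
        by (simp add: coord_vec_chart linear_expand_Basis[OF linear_transition] flip: tangent_change[OF vector_field_tangent[OF X(1)]])
      then show ?thesis by (simp add: scaleR_sum_right mult_ac)
    next
      case False
      then show ?thesis using cutoff_eq_0[OF \<phi>] by simp
    qed
  qed
  have "T (\<lambda>q d. (\<phi> q * \<phi> q) *\<^sub>R X q d) = (\<phi> p * \<phi> p) *\<^sub>R T X"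
    by (rule tensorial_scaleR[OF T smooth_function_mult[OF cutoff_smooth[OF \<phi>] cutoff_smooth[OF \<phi>]] X(1)])
  then show ?thesis
    unfolding eq tensorial_sum[OF T f E] by (simp add: cutoff_eq_1[OF \<phi>] X(2))
qed

lemma tensorial_cong:
  assumes T: "tensorial p T" and X: "vector_field A X" and Y: "vector_field A Y"
    and eq: "X p = Y p" and p: "p \<in> points A"
  shows "T X = T Y"
proof -
  have m: "vector_field A (\<lambda>q c. (- 1) *\<^sub>R Y q c)" by (intro vector_field_scaleR smooth_function_const Y)
  have "T (\<lambda>q c. X q c + (- 1) *\<^sub>R Y q c) = 0"
    by (rule tensorial_eq_0[OF T vector_field_add[OF X m] _ p]) (simp add: eq)
  moreover have "T (\<lambda>q c. X q c + (- 1) *\<^sub>R Y q c) = T X + T (\<lambda>q c. (- 1) *\<^sub>R Y q c)"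
    by (rule tensorial_add[OF T X m])
  moreover have "T (\<lambda>q c. (- 1) *\<^sub>R Y q c) = (- 1) *\<^sub>R T Y"
    by (rule tensorial_scaleR[OF T smooth_function_const Y])
  ultimately show ?thesis by simp
qed

end

section \<open>Tensor fields and affine connections\<close>

definition tensor_coords ::
  "('m, 'e::euclidean_space) chart set \<Rightarrow> ('m, 'e) tensor \<Rightarrow> ('m, 'e) chart \<Rightarrow> 'm \<Rightarrow> 'e \<Rightarrow> 'e \<Rightarrow> real" where
  "tensor_coords A k c p a b = k p (coord_vec A c p a) (coord_vec A c p b)"

context atlas
begin

lemma tensor_add_left:
  "\<lbrakk>tensor_field A k; p \<in> points A; u \<in> tangent A p; v \<in> tangent A p; w \<in> tangent A p\<rbrakk> \<Longrightarrow>
    k p (\<lambda>c. u c + v c) w = k p u w + k p v w"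
  unfolding tensor_field_def by blast

lemma tensor_add_right:
  "\<lbrakk>tensor_field A k; p \<in> points A; u \<in> tangent A p; v \<in> tangent A p; w \<in> tangent A p\<rbrakk> \<Longrightarrow>
    k p w (\<lambda>c. u c + v c) = k p w u + k p w v"
  unfolding tensor_field_def by blast

lemma tensor_scaleR_left:
  "\<lbrakk>tensor_field A k; p \<in> points A; u \<in> tangent A p; w \<in> tangent A p\<rbrakk> \<Longrightarrow>
    k p (\<lambda>c. r *\<^sub>R u c) w = r * k p u w"
  unfolding tensor_field_def by blast

lemma tensor_scaleR_right:
  "\<lbrakk>tensor_field A k; p \<in> points A; u \<in> tangent A p; w \<in> tangent A p\<rbrakk> \<Longrightarrow>
    k p w (\<lambda>c. r *\<^sub>R u c) = r * k p w u"
  unfolding tensor_field_def by blast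

lemmas tensor_bilinear = tensor_add_left tensor_add_right tensor_scaleR_left tensor_scaleR_right

lemma tensor_coords_linear:
  assumes k: "tensor_field A k" and c: "c \<in> A" "p \<in> fst c"
  shows "linear (\<lambda>b. tensor_coords A k c p a b)" "linear (\<lambda>a. tensor_coords A k c p a b)"
proof -
  have p: "p \<in> points A" using c points_iff by blast
  show "linear (\<lambda>b. tensor_coords A k c p a b)" "linear (\<lambda>a. tensor_coords A k c p a b)"
    by (rule linearI; simp add: tensor_coords_def c coord_vec_add coord_vec_scaleR tensor_bilinear[OF k p])+
qed

lemma tensor_eq_coords:
  assumes "c \<in> A" "p \<in> fst c" "u \<in> tangent A p" "v \<in> tangent A p"
  shows "k p u v = tensor_coords A k c p (u c) (v c)"
  using assms by (simp add: tensor_coords_def coord_vec_eq)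

text \<open>The base point is passed through a map g because on the cotangent bundle it is the first
  half of the coordinates.\<close>

lemma smooth_on_tensor_coords:
  assumes k: "tensor_field A k" and c: "c \<in> A"
    and S: "open S" "g ` S \<subseteq> snd c ` fst c" "smooth_on g S"
    and f: "smooth_on f S" "smooth_on f' S"
  shows "smooth_on (\<lambda>x. tensor_coords A k c (chart_inv c (g x)) (f x) (f' x)) S"
proof -
  have p: "chart_inv c (g x) \<in> fst c" if "x \<in> S" for x
    using S(2) that c by auto
  have "smooth_on (\<lambda>x. tensor_coords A k c (chart_inv c (g x)) a b) S" if "a \<in> Basis" "b \<in> Basis" for a b
  proof -
    have "smooth_on (\<lambda>x. tensor_coords A k c (chart_inv c x) a b) (snd c ` fst c)"
      using k c that unfolding tensor_field_def tensor_coords_def by blast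
    from smooth_on_compose[OF S(1) open_chart_range[OF c] S(2) this S(3)] show ?thesis .
  qed
  note basis = this
  have left: "smooth_on (\<lambda>x. tensor_coords A k c (chart_inv c (g x)) a (f' x)) S" if "a \<in> Basis" for a
    by (rule smooth_on_linear_family[OF S(1) tensor_coords_linear(1)[OF k c p] basis[OF that] f(2)])
  show ?thesis
    by (rule smooth_on_linear_family[where L = "\<lambda>x a. tensor_coords A k c (chart_inv c (g x)) a (f' x)",
          OF S(1) tensor_coords_linear(2)[OF k c p] left f(1)])
qed

lemma smooth_function_tensor:
  assumes k: "tensor_field A k" and X: "vector_field A X" and Y: "vector_field A Y"
  shows "smooth_function A (\<lambda>p. k p (X p) (Y p))"
proof (rule smooth_functionI)
  fix c assume c: "c \<in> A"
  note o = open_chart_range[OF c]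
  have "smooth_on (\<lambda>x. tensor_coords A k c (chart_inv c x) (X (chart_inv c x) c) (Y (chart_inv c x) c)) (snd c ` fst c)"
    by (rule smooth_on_tensor_coords[OF k c o _ smooth_on_ident[OF o]]) (auto intro: vector_field_smooth X Y c)
  then show "smooth_on (\<lambda>x. k (chart_inv c x) (X (chart_inv c x)) (Y (chart_inv c x))) (snd c ` fst c)"
    by (rule smooth_on_cong[OF o, rotated])
      (use c in \<open>auto simp: tensor_eq_coords[OF c _ vector_field_tangent[OF X] vector_field_tangent[OF Y]]\<close>)
qed

end

locale connection = manifold A for A :: "('m, 'e::euclidean_space) chart set" +
  fixes D :: "('m, 'e) connection"
  assumes affine: "affine_connection A D"
begin

lemma D_vector_field: "\<lbrakk>vector_field A X; vector_field A Y\<rbrakk> \<Longrightarrow> vector_field A (D X Y)"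
  using affine by (simp add: affine_connection_def)

lemma D_tangent: "\<lbrakk>vector_field A X; vector_field A Y\<rbrakk> \<Longrightarrow> D X Y p \<in> tangent A p"
  using D_vector_field vector_field_tangent by blast

lemma D_add_left:
  "\<lbrakk>vector_field A X; vector_field A Y; vector_field A Z\<rbrakk> \<Longrightarrow>
    D (\<lambda>p c. X p c + Y p c) Z = (\<lambda>p c. D X Z p c + D Y Z p c)"
  using affine by (simp add: affine_connection_def)

lemma D_add_right:
  "\<lbrakk>vector_field A X; vector_field A Y; vector_field A Z\<rbrakk> \<Longrightarrow>
    D Z (\<lambda>p c. X p c + Y p c) = (\<lambda>p c. D Z X p c + D Z Y p c)"
  using affine by (simp add: affine_connection_def)

lemma D_scaleR_left:
  "\<lbrakk>smooth_function A f; vector_field A X; vector_field A Y\<rbrakk> \<Longrightarrow>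
    D (\<lambda>p c. f p *\<^sub>R X p c) Y = (\<lambda>p c. f p *\<^sub>R D X Y p c)"
  using affine by (simp add: affine_connection_def)

lemma D_scaleR_right:
  "\<lbrakk>smooth_function A f; vector_field A X; vector_field A Y\<rbrakk> \<Longrightarrow>
    D X (\<lambda>p c. f p *\<^sub>R Y p c) = (\<lambda>p c. derivation A X f p *\<^sub>R Y p c + f p *\<^sub>R D X Y p c)"
  using affine by (simp add: affine_connection_def)

lemma tensorial_D: "vector_field A Y \<Longrightarrow> tensorial p (\<lambda>X. D X Y p c)"
  by (rule tensorialI) (simp_all add: D_add_left D_scaleR_left)

lemma D_pointwise:
  assumes "vector_field A X" "vector_field A X'" "vector_field A Y" "X p = X' p" "p \<in> points A"
  shows "D X Y p = D X' Y p"
  by (rule ext) (rule tensorial_cong[OF tensorial_D[OF assms(3)] assms(1,2,4,5)])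

lemma D_0_right:
  assumes "vector_field A X"
  shows "D X (\<lambda>_ _. 0) = (\<lambda>_ _. 0)"
proof -
  have "D X (\<lambda>p c. 0 + 0) = (\<lambda>p c. D X (\<lambda>_ _. 0) p c + D X (\<lambda>_ _. 0) p c)"
    using D_add_right[OF vector_field_0 vector_field_0 assms] .
  then have "D X (\<lambda>_ _. 0) p c = D X (\<lambda>_ _. 0) p c + D X (\<lambda>_ _. 0) p c" for p c
    unfolding add_0 by (rule fun_cong[OF fun_cong])
  then show ?thesis by (intro ext) (metis add_cancel_left_right)
qed

text \<open>The second argument is not tensorial, but it is local: \<open>\<phi>\<close> times Y and
  \<open>\<phi>\<close> times Y' are equal fields. In the Leibniz rule at p the terms with the
  derivative of \<open>\<phi>\<close> agree because Y p = Y' p, and \<open>\<phi> p\<close> is 1 in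
  the others.\<close>

lemma D_local:
  assumes X: "vector_field A X" and Y: "vector_field A Y" "vector_field A Y'"
    and W: "atlas_open A W" "p \<in> W" "\<And>q. q \<in> W \<Longrightarrow> Y q = Y' q"
  shows "D X Y p = D X Y' p"
proof -
  obtain c where c: "c \<in> A" "p \<in> fst c" using atlas_open_points[OF W(1,2)] points_iff by blast
  have V: "atlas_open A (W \<inter> fst c)" "p \<in> W \<inter> fst c"
    using W c by (auto intro: atlas_open_Int atlas_open_chart)
  obtain \<phi> where \<phi>: "cutoff (W \<inter> fst c) p \<phi>" using cutoff_exists[OF c(1) V Int_lower2] .
  have "(\<lambda>q d. \<phi> q *\<^sub>R Y q d) = (\<lambda>q d. \<phi> q *\<^sub>R Y' q d)"
  proof (intro ext)
    fix q d show "\<phi> q *\<^sub>R Y q d = \<phi> q *\<^sub>R Y' q d"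
      using W(3)[of q] cutoff_eq_0[OF \<phi>, of q] by (cases "q \<in> W") auto
  qed
  from arg_cong[where f = "D X", OF this]
  have "(\<lambda>p c. derivation A X \<phi> p *\<^sub>R Y p c + \<phi> p *\<^sub>R D X Y p c) =
      (\<lambda>p c. derivation A X \<phi> p *\<^sub>R Y' p c + \<phi> p *\<^sub>R D X Y' p c)"
    unfolding D_scaleR_right[OF cutoff_smooth[OF \<phi>] X Y(1)] D_scaleR_right[OF cutoff_smooth[OF \<phi>] X Y(2)] .
  from fun_cong[OF this, of p] show ?thesis
    by (simp add: cutoff_eq_1[OF \<phi>] W(3)[OF W(2)] fun_eq_iff)
qed

lemma D_sum_right:
  assumes X: "vector_field A X"
    and "\<And>i. i \<in> I \<Longrightarrow> smooth_function A (f i)" "\<And>i. i \<in> I \<Longrightarrow> vector_field A (Y i)"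
  shows "D X (\<lambda>p c. \<Sum>i\<in>I. f i p *\<^sub>R Y i p c) =
    (\<lambda>p c. \<Sum>i\<in>I. derivation A X (f i) p *\<^sub>R Y i p c + f i p *\<^sub>R D X (Y i) p c)"
  using assms(2,3)
proof (induction I rule: infinite_finite_induct)
  case (insert i I)
  have "D X (\<lambda>p c. f i p *\<^sub>R Y i p c + (\<Sum>i\<in>I. f i p *\<^sub>R Y i p c)) =
      (\<lambda>p c. D X (\<lambda>p c. f i p *\<^sub>R Y i p c) p c + D X (\<lambda>p c. \<Sum>i\<in>I. f i p *\<^sub>R Y i p c) p c)"
    by (intro D_add_right X vector_field_sum vector_field_scaleR insert.prems) auto
  then show ?case using insert X by (simp add: D_scaleR_right)
qed (simp_all add: D_0_right X)

subsection \<open>Christoffel symbols\<close>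

text \<open>Two choices of extensions give the same value, as D is tensorial in the first field and
  local in the second. This gives the definite description its meaning.\<close>

lemma christoffel_eq:
  assumes X: "vector_field A X" and Y: "vector_field A Y" and c: "c \<in> A"
    and W: "atlas_open A W" "p \<in> W" "W \<subseteq> fst c"
    and eq: "\<And>q. q \<in> W \<Longrightarrow> X q = coord_vec A c q i" "\<And>q. q \<in> W \<Longrightarrow> Y q = coord_vec A c q j"
  shows "christoffel A D c p i j = D X Y p c"
  unfolding christoffel_def openin_atlas_topology[OF smooth_atlas]
proof (rule the_equality)
  show "\<exists>X' Y' W. vector_field A X' \<and> vector_field A Y' \<and> atlas_open A W \<and> p \<in> W \<and> W \<subseteq> fst c \<and>
      (\<forall>q\<in>W. X' q = coord_vec A c q i \<and> Y' q = coord_vec A c q j) \<and> D X Y p c = D X' Y' p c"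
    using assms by blast
next
  fix w
  assume "\<exists>X' Y' W. vector_field A X' \<and> vector_field A Y' \<and> atlas_open A W \<and> p \<in> W \<and> W \<subseteq> fst c \<and>
      (\<forall>q\<in>W. X' q = coord_vec A c q i \<and> Y' q = coord_vec A c q j) \<and> w = D X' Y' p c"
  then obtain X' Y' W' where X': "vector_field A X'" and Y': "vector_field A Y'"
    and W': "atlas_open A W'" "p \<in> W'" and eq': "\<forall>q\<in>W'. X' q = coord_vec A c q i \<and> Y' q = coord_vec A c q j"
    and w: "w = D X' Y' p c" by blast
  have "D X' Y' p = D X Y' p"
    using D_pointwise[OF X' X Y'] eq(1)[OF W(2)] eq' W'(2) atlas_open_points[OF W(1,2)] by simp
  also have "\<dots> = D X Y p"
    by (rule D_local[OF X Y' Y atlas_open_Int[OF W(1) W'(1)]]) (use W W' eq eq' in auto)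
  finally show "w = D X Y p c" using w by simp
qed

text \<open>Coordinate fields exist on the chart domain only; these cut-off copies are global and
  coincide with them where \<open>\<phi>\<close> is 1.\<close>

definition chart_frame :: "('m \<Rightarrow> real) \<Rightarrow> ('m, 'e) chart \<Rightarrow> 'e \<Rightarrow> ('m, 'e) vfield" where
  "chart_frame \<phi> c b = (\<lambda>q d. \<phi> q *\<^sub>R coord_vec A c q b d)"

lemma vector_field_chart_frame:
  assumes \<phi>: "cutoff (fst c) p \<phi>" and c: "c \<in> A"
  shows "vector_field A (chart_frame \<phi> c b)"
  unfolding chart_frame_def
proof (rule cutoff_scaleR_vector_field[OF \<phi> c atlas_open_chart[OF c] order_refl])
  show "smooth_on (\<lambda>x. coord_vec A c (chart_inv c x) b c) (snd c ` fst c)"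
    by (rule smooth_on_cong[OF open_chart_range[OF c] _ smooth_on_const[OF open_chart_range[OF c]]])
      (use c in auto)
qed (use c in auto)

text \<open>One cut-off frame computes the symbols at all points of a neighbourhood, so there they
  are components of a smooth field.\<close>

lemma smooth_on_christoffel:
  assumes c: "c \<in> A"
  shows "smooth_on (\<lambda>x. christoffel A D c (chart_inv c x) i j) (snd c ` fst c)"
proof (rule smooth_chart_local[OF c])
  fix p assume p: "p \<in> fst c"
  obtain \<phi> where \<phi>: "cutoff (fst c) p \<phi>" using cutoff_exists[OF c atlas_open_chart[OF c] p order_refl] .
  then obtain V where V: "atlas_open A V" "p \<in> V" "V \<subseteq> fst c" and \<phi>1: "\<forall>q\<in>V. \<phi> q = 1"
    unfolding cutoff_def by blast
  note E = vector_field_chart_frame[OF \<phi> c]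
  have "smooth_on (\<lambda>x. christoffel A D c (chart_inv c x) i j) (snd c ` V)"
  proof (rule smooth_on_cong[OF open_chart_image[OF c V(1,3)]])
    show "smooth_on (\<lambda>x. D (chart_frame \<phi> c i) (chart_frame \<phi> c j) (chart_inv c x) c) (snd c ` V)"
      by (rule smooth_on_subset[OF vector_field_smooth[OF D_vector_field[OF E E] c]]) (use V in blast)
    fix x assume "x \<in> snd c ` V"
    then have "chart_inv c x \<in> V" using c V(3) by auto
    then show "D (chart_frame \<phi> c i) (chart_frame \<phi> c j) (chart_inv c x) c = christoffel A D c (chart_inv c x) i j"
      by (intro christoffel_eq[symmetric, OF E E c V(1) _ V(3)]) (use \<phi>1 in \<open>auto simp: chart_frame_def\<close>)
  qed
  then show "\<exists>W. atlas_open A W \<and> p \<in> W \<and> W \<subseteq> fst c \<and>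
      smooth_on (\<lambda>x. christoffel A D c (chart_inv c x) i j) (snd c ` W)"
    using V by blast
qed

text \<open>The bilinear extension of the Christoffel symbols: a fills the index of the direction of
  differentiation, b that of the differentiated field.\<close>

definition connection_form :: "('m, 'e) chart \<Rightarrow> 'm \<Rightarrow> 'e \<Rightarrow> 'e \<Rightarrow> 'e" where
  "connection_form c p a b = (\<Sum>i\<in>Basis. \<Sum>l\<in>Basis. ((a \<bullet> i) * (b \<bullet> l)) *\<^sub>R christoffel A D c p i l)"

lemma linear_connection_form:
  "linear (\<lambda>a. connection_form c p a b)" "linear (\<lambda>b. connection_form c p a b)"
  unfolding connection_form_def
  by (rule linearI; simp add: inner_add_left algebra_simps sum.distrib scaleR_sum_right)+

text \<open>Near p, Y is a combination of the global copies of the coordinate fields, to which the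
  Leibniz rule applies. The derivatives of the coefficients add up to the derivative of the
  component of Y.\<close>

lemma D_chart:
  assumes X: "vector_field A X" and Y: "vector_field A Y" and c: "c \<in> A" "p \<in> fst c"
  shows "D X Y p c = fderiv (\<lambda>x. Y (chart_inv c x) c) (snd c p) (X p c) + connection_form c p (X p c) (Y p c)"
proof -
  note cc = atlas_open_chart[OF c(1)]
  have p: "p \<in> points A" using c points_iff by blast
  obtain \<phi> where \<phi>: "cutoff (fst c) p \<phi>" using cutoff_exists[OF c(1) cc c(2) order_refl] .
  then obtain V where V: "atlas_open A V" "p \<in> V" "V \<subseteq> fst c" and \<phi>1: "\<forall>q\<in>V. \<phi> q = 1"
    unfolding cutoff_def by blast
  define E where "E = chart_frame \<phi> c"
  have E: "vector_field A (E b)" for b unfolding E_def by (rule vector_field_chart_frame[OF \<phi> c(1)])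
  have EV: "E b q = coord_vec A c q b" if "q \<in> V" for b q
    using \<phi>1 that by (simp add: E_def chart_frame_def)
  define f where "f l q = \<phi> q * (Y q c \<bullet> l)" for l q
  have f: "smooth_function A (f l)" for l
    unfolding f_def
    by (rule cutoff_mult_smooth[OF \<phi> c(1) cc order_refl])
      (intro smooth_intros open_chart_range vector_field_smooth Y c)
  have "D X Y p = D X (\<lambda>q d. \<Sum>l\<in>Basis. f l q *\<^sub>R E l q d) p"
  proof (rule D_local[OF X Y vector_field_sum[OF vector_field_scaleR[OF f E]] V(1,2)])
    fix q assume q: "q \<in> V"
    have qc: "q \<in> fst c" using q V(3) by blast
    have v: "Y q \<in> tangent A q" by (rule vector_field_tangent[OF Y])
    show "Y q = (\<lambda>d. \<Sum>l\<in>Basis. f l q *\<^sub>R E l q d)"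
    proof
      fix d
      show "Y q d = (\<Sum>l\<in>Basis. f l q *\<^sub>R E l q d)"
      proof (cases "d \<in> A \<and> q \<in> fst d")
        case True
        then show ?thesis
          using q \<phi>1 tangent_change[OF v c(1) _ qc, of d]
          by (simp add: EV[OF q] f_def coord_vec_chart linear_expand_Basis[OF linear_transition[OF c(1) _ qc]])
      next
        case False
        then show ?thesis using tangent_eq_0[OF v, of d] by (auto simp: EV[OF q] coord_vec_def)
      qed
    qed
  qed
  also have "\<dots> = (\<lambda>c. \<Sum>l\<in>Basis. derivation A X (f l) p *\<^sub>R E l p c + f l p *\<^sub>R D X (E l) p c)"
    by (rule fun_cong[OF D_sum_right[OF X f E]])
  finally have 1: "D X Y p c = (\<Sum>l\<in>Basis. derivation A X (f l) p *\<^sub>R l + (Y p c \<bullet> l) *\<^sub>R D X (E l) p c)"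
    using c \<phi>1 V(2) by (simp add: EV[OF V(2)] f_def)
  have 2: "derivation A X (f l) p = fderiv (\<lambda>x. Y (chart_inv c x) c) (snd c p) (X p c) \<bullet> l" for l
  proof -
    have "((\<lambda>x. Y (chart_inv c x) c) has_derivative fderiv (\<lambda>x. Y (chart_inv c x) c) (snd c p)) (at (snd c p))"
      by (rule smooth_on_has_derivative[OF vector_field_smooth[OF Y c(1)] open_chart_range[OF c(1)]])
        (use c in blast)
    then have "((\<lambda>x. Y (chart_inv c x) c \<bullet> l) has_derivative (\<lambda>a. fderiv (\<lambda>x. Y (chart_inv c x) c) (snd c p) a \<bullet> l)) (at (snd c p))"
      by (rule has_derivative_inner_left)
    then have "((\<lambda>x. f l (chart_inv c x)) has_derivative (\<lambda>a. fderiv (\<lambda>x. Y (chart_inv c x) c) (snd c p) a \<bullet> l)) (at (snd c p))"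
      by (rule has_derivative_transform_within_open[OF _ open_chart_image[OF c(1) V(1,3)]])
        (use c V \<phi>1 in \<open>auto simp: f_def subset_iff\<close>)
    then show ?thesis
      by (simp add: derivation_vector_field[OF f X c] fderiv_eqI)
  qed
  \<comment> \<open>X is replaced by a combination of frame fields with constant coefficients. The
    two agree at p alone, which suffices in the tensorial argument.\<close>
  have 3: "D X (E l) p c = (\<Sum>i\<in>Basis. (X p c \<bullet> i) *\<^sub>R christoffel A D c p i l)" for l
  proof -
    have vf: "vector_field A (\<lambda>q d. \<Sum>i\<in>Basis. (X p c \<bullet> i) *\<^sub>R E i q d)"
      by (intro vector_field_sum vector_field_scaleR smooth_function_const E)
    have eq: "X p = (\<lambda>d. \<Sum>i\<in>Basis. (X p c \<bullet> i) *\<^sub>R E i p d)"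
    proof (rule tangent_eqI[OF _ _ c])
      show "X p \<in> tangent A p" by (rule vector_field_tangent[OF X])
      show "(\<lambda>d. \<Sum>i\<in>Basis. (X p c \<bullet> i) *\<^sub>R E i p d) \<in> tangent A p"
        by (rule vector_field_tangent[OF vf])
      show "X p c = (\<Sum>i\<in>Basis. (X p c \<bullet> i) *\<^sub>R E i p c)"
        using c by (simp add: EV[OF V(2)] euclidean_representation)
    qed
    have "D X (E l) p c = D (\<lambda>q d. \<Sum>i\<in>Basis. (X p c \<bullet> i) *\<^sub>R E i q d) (E l) p c"
      by (rule fun_cong[OF D_pointwise[OF X vf E eq p]])
    also have "\<dots> = (\<Sum>i\<in>Basis. (X p c \<bullet> i) *\<^sub>R D (E i) (E l) p c)"
      by (rule tensorial_sum[OF tensorial_D[OF E] smooth_function_const E])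
    also have "\<dots> = (\<Sum>i\<in>Basis. (X p c \<bullet> i) *\<^sub>R christoffel A D c p i l)"
      using christoffel_eq[OF E E c(1) V EV EV] by simp
    finally show ?thesis .
  qed
  have "connection_form c p (X p c) (Y p c) =
      (\<Sum>l\<in>Basis. (Y p c \<bullet> l) *\<^sub>R (\<Sum>i\<in>Basis. (X p c \<bullet> i) *\<^sub>R christoffel A D c p i l))"
    unfolding connection_form_def by (subst sum.swap) (simp add: scaleR_sum_right mult_ac)
  then show ?thesis
    by (simp add: 1 2 3 sum.distrib euclidean_representation)
qed

subsection \<open>Curvature and the Codazzi equation are tensorial\<close>

text \<open>The Leibniz rule for \<open>D Y\<close> produces the term - (Y f) D X Z, and the bracket
  contributes its opposite.\<close>

lemma curvature_scaleR_1:
  assumes "smooth_function A f" "vector_field A X" "vector_field A Y" "vector_field A Z"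
  shows "curvature A D (\<lambda>p c. f p *\<^sub>R X p c) Y Z = (\<lambda>p c. f p *\<^sub>R curvature A D X Y Z p c)"
proof -
  note [simp] = assms D_vector_field vector_field_lie_bracket vector_field_scaleR vector_field_add
    smooth_function_derivation smooth_function_uminus
  have "D (lie_bracket A (\<lambda>p c. f p *\<^sub>R X p c) Y) Z =
      (\<lambda>p c. f p *\<^sub>R D (lie_bracket A X Y) Z p c + (- derivation A Y f p) *\<^sub>R D X Z p c)"
    unfolding lie_bracket_scaleR_left[OF assms(1-3)]
    by (simp add: D_add_left D_scaleR_left del: scaleR_minus_left)
  then show ?thesis
    by (simp add: curvature_def D_scaleR_left D_scaleR_right fun_eq_iff algebra_simps)
qed

lemma curvature_add_1:
  assumes "vector_field A X" "vector_field A X'" "vector_field A Y" "vector_field A Z"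
  shows "curvature A D (\<lambda>p c. X p c + X' p c) Y Z = (\<lambda>p c. curvature A D X Y Z p c + curvature A D X' Y Z p c)"
proof -
  note [simp] = assms D_vector_field vector_field_lie_bracket
  show ?thesis
    unfolding curvature_def lie_bracket_add_left[OF assms(1-3)]
    by (simp add: D_add_left D_add_right fun_eq_iff)
qed

lemma curvature_swap:
  assumes "vector_field A X" "vector_field A Y" "vector_field A Z"
  shows "curvature A D X Y Z = (\<lambda>p c. (- 1) *\<^sub>R curvature A D Y X Z p c)"
proof -
  have "D (lie_bracket A X Y) Z = (\<lambda>p c. (- 1) *\<^sub>R D (lie_bracket A Y X) Z p c)"
    unfolding lie_bracket_swap[of X Y]
    by (rule D_scaleR_left) (auto intro: smooth_function_const vector_field_lie_bracket assms)
  then show ?thesis by (simp add: curvature_def fun_eq_iff)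
qed

text \<open>The mixed first-order terms cancel, and the second derivatives of f combine to the
  commutator minus the bracket, which is 0.\<close>

lemma curvature_scaleR_3:
  assumes "smooth_function A f" "vector_field A X" "vector_field A Y" "vector_field A Z" "p \<in> points A"
  shows "curvature A D X Y (\<lambda>p c. f p *\<^sub>R Z p c) p c = f p *\<^sub>R curvature A D X Y Z p c"
proof -
  note [simp] = assms D_vector_field vector_field_lie_bracket vector_field_scaleR vector_field_add
    smooth_function_derivation
  show ?thesis
    by (simp add: curvature_def D_scaleR_right D_add_right derivation_lie_bracket algebra_simps)
qed

lemma curvature_add_3:
  assumes "vector_field A X" "vector_field A Y" "vector_field A Z" "vector_field A Z'"
  shows "curvature A D X Y (\<lambda>p c. Z p c + Z' p c) = (\<lambda>p c. curvature A D X Y Z p c + curvature A D X Y Z' p c)"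
proof -
  note [simp] = assms D_vector_field vector_field_lie_bracket
  show ?thesis by (simp add: curvature_def D_add_right fun_eq_iff)
qed

text \<open>One argument is replaced at a time; the second is brought into the first slot by
  antisymmetry and back.\<close>

lemma curvature_pointwise:
  assumes X: "vector_field A X" "vector_field A X'" "X p = X' p"
    and Y: "vector_field A Y" "vector_field A Y'" "Y p = Y' p"
    and Z: "vector_field A Z" "vector_field A Z'" "Z p = Z' p"
    and p: "p \<in> points A"
  shows "curvature A D X Y Z p = curvature A D X' Y' Z' p"
proof
  fix c
  have 1: "tensorial p (\<lambda>X. curvature A D X Y Z p c)" if "vector_field A Y" "vector_field A Z" for Y Z
    by (rule tensorialI) (simp_all add: that curvature_scaleR_1 curvature_add_1)
  have 3: "tensorial p (\<lambda>Z. curvature A D X Y Z p c)" if "vector_field A X" "vector_field A Y" for X Y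
    by (rule tensorialI) (simp_all add: that p curvature_scaleR_3 curvature_add_3)
  have "curvature A D X Y Z p c = curvature A D X' Y Z p c"
    by (rule tensorial_cong[OF 1[OF Y(1) Z(1)] X p])
  also have "\<dots> = (- 1) *\<^sub>R curvature A D Y X' Z p c"
    unfolding curvature_swap[OF X(2) Y(1) Z(1)] ..
  also have "curvature A D Y X' Z p c = curvature A D Y' X' Z p c"
    by (rule tensorial_cong[OF 1[OF X(2) Z(1)] Y p])
  also have "(- 1) *\<^sub>R curvature A D Y' X' Z p c = curvature A D X' Y' Z p c"
    unfolding curvature_swap[OF X(2) Y(2) Z(1)] ..
  also have "\<dots> = curvature A D X' Y' Z' p c"
    by (rule tensorial_cong[OF 3[OF X(2) Y(2)] Z p])
  finally show "curvature A D X Y Z p c = curvature A D X' Y' Z' p c" .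
qed

text \<open>The left-hand side of the quasi-statistical condition, written without the torsion.\<close>

definition codazzi :: "('m, 'e) tensor \<Rightarrow> ('m, 'e) vfield \<Rightarrow> ('m, 'e) vfield \<Rightarrow> ('m, 'e) vfield \<Rightarrow> 'm \<Rightarrow> real" where
  "codazzi k X Y Z p =
    derivation A X (\<lambda>q. k q (Y q) (Z q)) p - derivation A Y (\<lambda>q. k q (X q) (Z q)) p
    - k p (Y p) (D X Z p) + k p (X p) (D Y Z p) - k p (lie_bracket A X Y p) (Z p)"

text \<open>The terms k (D X Y, Z) and k (D Y X, Z) of the covariant derivatives occur in the
  torsion term with opposite signs, so only its bracket remains.\<close>

lemma codazzi_eq_cov_deriv:
  assumes k: "tensor_field A k" and X: "vector_field A X" and Y: "vector_field A Y" and Z: "vector_field A Z"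
    and p: "p \<in> points A"
  shows "cov_deriv A D k X Y Z p - cov_deriv A D k Y X Z p + k p (torsion A D X Y p) (Z p) = codazzi k X Y Z p"
proof -
  note t = D_tangent[OF X Y] D_tangent[OF Y X] vector_field_tangent[OF vector_field_lie_bracket[OF X Y]]
    vector_field_tangent[OF Z]
  have eq: "torsion A D X Y p = (\<lambda>c. D X Y p c + (- 1) *\<^sub>R (D Y X p c + lie_bracket A X Y p c))"
    by (simp add: torsion_def fun_eq_iff)
  have "k p (torsion A D X Y p) (Z p) =
      k p (D X Y p) (Z p) + (- 1) * (k p (D Y X p) (Z p) + k p (lie_bracket A X Y p) (Z p))"
    unfolding eq by (simp only: tensor_bilinear[OF k p] t tangent_add tangent_scaleR)
  then show ?thesis by (simp add: cov_deriv_def codazzi_def)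
qed

lemma codazzi_swap:
  assumes k: "tensor_field A k" and X: "vector_field A X" and Y: "vector_field A Y" and Z: "vector_field A Z"
    and p: "p \<in> points A"
  shows "codazzi k X Y Z p = - codazzi k Y X Z p"
proof -
  have "k p (lie_bracket A X Y p) (Z p) = (- 1) * k p (lie_bracket A Y X p) (Z p)"
    unfolding lie_bracket_swap[of X Y]
    by (rule tensor_scaleR_left[OF k p]) (auto intro: vector_field_tangent vector_field_lie_bracket X Y Z)
  then show ?thesis by (simp add: codazzi_def)
qed

text \<open>Under multiplication by f the derivative along Y yields - (Y f) k (X, Z), and the
  bracket term yields the opposite.\<close>

lemma tensorial_codazzi_1:
  assumes k: "tensor_field A k" and Y: "vector_field A Y" and Z: "vector_field A Z" and p: "p \<in> points A"
  shows "tensorial p (\<lambda>X. codazzi k X Y Z p)"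
proof (rule tensorialI)
  fix X X' assume X: "vector_field A X" and X': "vector_field A X'"
  have "derivation A Y (\<lambda>q. k q (\<lambda>c. X q c + X' q c) (Z q)) p = derivation A Y (\<lambda>q. k q (X q) (Z q) + k q (X' q) (Z q)) p"
    by (rule derivation_cong[OF smooth_function_tensor[OF k vector_field_add[OF X X'] Z] _ Y p])
      (simp add: tensor_add_left[OF k] vector_field_tangent X X' Z)
  also have "\<dots> = derivation A Y (\<lambda>q. k q (X q) (Z q)) p + derivation A Y (\<lambda>q. k q (X' q) (Z q)) p"
    by (intro derivation_add smooth_function_tensor k X X' Y Z p)
  finally show "codazzi k (\<lambda>q c. X q c + X' q c) Y Z p = codazzi k X Y Z p + codazzi k X' Y Z p"
    by (simp add: codazzi_def derivation_field_add[OF smooth_function_tensor[OF k Y Z] X X' p]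
        lie_bracket_add_left[OF X X' Y] D_add_left[OF X X' Z] tensor_bilinear[OF k p] D_tangent
        vector_field_tangent vector_field_lie_bracket X X' Y Z)
next
  fix f X assume f: "smooth_function A f" and X: "vector_field A X"
  have "derivation A Y (\<lambda>q. k q (\<lambda>c. f q *\<^sub>R X q c) (Z q)) p = derivation A Y (\<lambda>q. f q * k q (X q) (Z q)) p"
    by (rule derivation_cong[OF smooth_function_tensor[OF k vector_field_scaleR[OF f X] Z] _ Y p])
      (simp add: tensor_scaleR_left[OF k] vector_field_tangent X Z)
  also have "\<dots> = derivation A Y f p * k p (X p) (Z p) + f p * derivation A Y (\<lambda>q. k q (X q) (Z q)) p"
    by (intro derivation_mult f smooth_function_tensor k X Y Z p)
  finally show "codazzi k (\<lambda>q c. f q *\<^sub>R X q c) Y Z p = f p *\<^sub>R codazzi k X Y Z p"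
    by (simp add: codazzi_def derivation_field_scaleR[OF smooth_function_tensor[OF k Y Z] X p]
        lie_bracket_scaleR_left[OF f X Y] D_scaleR_left[OF f X Z] tensor_bilinear[OF k p] D_tangent tangent_scaleR
        vector_field_tangent vector_field_lie_bracket X Y Z algebra_simps del: scaleR_minus_left)
qed

text \<open>The terms with X f and Y f cancel between each derivative of k and the D Z in the same
  direction.\<close>

lemma tensorial_codazzi_3:
  assumes k: "tensor_field A k" and X: "vector_field A X" and Y: "vector_field A Y" and p: "p \<in> points A"
  shows "tensorial p (\<lambda>Z. codazzi k X Y Z p)"
proof (rule tensorialI)
  fix Z Z' assume Z: "vector_field A Z" and Z': "vector_field A Z'"
  have "derivation A X (\<lambda>q. k q (Y q) (\<lambda>c. Z q c + Z' q c)) p =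
      derivation A X (\<lambda>q. k q (Y q) (Z q)) p + derivation A X (\<lambda>q. k q (Y q) (Z' q)) p"
    if X: "vector_field A X" and Y: "vector_field A Y" for X Y
  proof -
    have "derivation A X (\<lambda>q. k q (Y q) (\<lambda>c. Z q c + Z' q c)) p = derivation A X (\<lambda>q. k q (Y q) (Z q) + k q (Y q) (Z' q)) p"
      by (rule derivation_cong[OF smooth_function_tensor[OF k Y vector_field_add[OF Z Z']] _ X p])
        (simp add: tensor_add_right[OF k] vector_field_tangent Z Z' Y)
    also have "\<dots> = derivation A X (\<lambda>q. k q (Y q) (Z q)) p + derivation A X (\<lambda>q. k q (Y q) (Z' q)) p"
      by (intro derivation_add smooth_function_tensor k X Z Z' Y p)
    finally show ?thesis .
  qed
  from this[OF X Y] this[OF Y X]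
  show "codazzi k X Y (\<lambda>q c. Z q c + Z' q c) p = codazzi k X Y Z p + codazzi k X Y Z' p"
    by (simp add: codazzi_def D_add_right[OF Z Z'] tensor_bilinear[OF k p] D_tangent
        vector_field_tangent vector_field_lie_bracket X Y Z Z')
next
  fix f Z assume f: "smooth_function A f" and Z: "vector_field A Z"
  have "derivation A X (\<lambda>q. k q (Y q) (\<lambda>c. f q *\<^sub>R Z q c)) p =
      derivation A X f p * k p (Y p) (Z p) + f p * derivation A X (\<lambda>q. k q (Y q) (Z q)) p"
    if X: "vector_field A X" and Y: "vector_field A Y" for X Y
  proof -
    have "derivation A X (\<lambda>q. k q (Y q) (\<lambda>c. f q *\<^sub>R Z q c)) p = derivation A X (\<lambda>q. f q * k q (Y q) (Z q)) p"
      by (rule derivation_cong[OF smooth_function_tensor[OF k Y vector_field_scaleR[OF f Z]] _ X p])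
        (simp add: tensor_scaleR_right[OF k] vector_field_tangent Y Z)
    also have "\<dots> = derivation A X f p * k p (Y p) (Z p) + f p * derivation A X (\<lambda>q. k q (Y q) (Z q)) p"
      by (intro derivation_mult f smooth_function_tensor k X Y Z p)
    finally show ?thesis .
  qed
  from this[OF X Y] this[OF Y X]
  show "codazzi k X Y (\<lambda>q c. f q *\<^sub>R Z q c) p = f p *\<^sub>R codazzi k X Y Z p"
    by (simp add: codazzi_def D_scaleR_right[OF f _ Z] tensor_bilinear[OF k p] D_tangent tangent_scaleR
        vector_field_tangent vector_field_lie_bracket X Y Z algebra_simps)
qed

lemma codazzi_pointwise:
  assumes k: "tensor_field A k"
    and X: "vector_field A X" "vector_field A X'" "X p = X' p"
    and Y: "vector_field A Y" "vector_field A Y'" "Y p = Y' p"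
    and Z: "vector_field A Z" "vector_field A Z'" "Z p = Z' p"
    and p: "p \<in> points A"
  shows "codazzi k X Y Z p = codazzi k X' Y' Z' p"
proof -
  have "codazzi k X Y Z p = codazzi k X' Y Z p"
    by (rule tensorial_cong[OF tensorial_codazzi_1[OF k Y(1) Z(1) p] X p])
  also have "\<dots> = - codazzi k Y X' Z p" by (rule codazzi_swap[OF k X(2) Y(1) Z(1) p])
  also have "codazzi k Y X' Z p = codazzi k Y' X' Z p"
    by (rule tensorial_cong[OF tensorial_codazzi_1[OF k X(2) Z(1) p] Y p])
  also have "- codazzi k Y' X' Z p = codazzi k X' Y' Z p" by (rule codazzi_swap[OF k X(2) Y(2) Z(1) p, symmetric])
  also have "\<dots> = codazzi k X' Y' Z' p"
    by (rule tensorial_cong[OF tensorial_codazzi_3[OF k X(2) Y(2) p] Z p])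
  finally show ?thesis .
qed

end

section \<open>The cotangent bundle as a manifold\<close>

text \<open>Inverse of \<open>covec_coords\<close>. The value 0 off the tangent space is the
  normalisation imposed by \<open>cotangent\<close>, by which covectors agreeing on tangent vectors
  are equal as functions.\<close>

definition covec :: "('m, 'e::euclidean_space) chart set \<Rightarrow> ('m, 'e) chart \<Rightarrow> 'm \<Rightarrow> 'e \<Rightarrow> ('m, 'e) covec" where
  "covec A c p y = (\<lambda>v. if v \<in> tangent A p then y \<bullet> v c else 0)"

context atlas
begin

lemma covec_cotangent: "covec A c p y \<in> cotangent A p"
  unfolding cotangent_def covec_def by (auto simp: tangent_add tangent_scaleR inner_add_right)

lemma covec_apply: "v \<in> tangent A p \<Longrightarrow> covec A c p y v = y \<bullet> v c"
  by (simp add: covec_def)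

lemma cotangent_add: "\<lbrakk>\<alpha> \<in> cotangent A p; u \<in> tangent A p; v \<in> tangent A p\<rbrakk> \<Longrightarrow> \<alpha> (\<lambda>c. u c + v c) = \<alpha> u + \<alpha> v"
  unfolding cotangent_def by blast

lemma cotangent_scaleR: "\<lbrakk>\<alpha> \<in> cotangent A p; v \<in> tangent A p\<rbrakk> \<Longrightarrow> \<alpha> (\<lambda>c. r *\<^sub>R v c) = r * \<alpha> v"
  unfolding cotangent_def by blast

lemma cotangentI:
  assumes "\<And>u v. \<lbrakk>u \<in> tangent A p; v \<in> tangent A p\<rbrakk> \<Longrightarrow> \<alpha> (\<lambda>c. u c + v c) = \<alpha> u + \<alpha> v"
    and "\<And>r v. v \<in> tangent A p \<Longrightarrow> \<alpha> (\<lambda>c. r *\<^sub>R v c) = r * \<alpha> v"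
    and "\<And>v. v \<notin> tangent A p \<Longrightarrow> \<alpha> v = 0"
  shows "\<alpha> \<in> cotangent A p"
  using assms unfolding cotangent_def by blast

lemma cotangent_eqI:
  assumes "\<alpha> \<in> cotangent A p" "\<beta> \<in> cotangent A p" "\<And>v. v \<in> tangent A p \<Longrightarrow> \<alpha> v = \<beta> v"
  shows "\<alpha> = \<beta>"
proof
  fix v show "\<alpha> v = \<beta> v"
    using assms by (cases "v \<in> tangent A p") (auto simp: cotangent_def)
qed

lemma covec_coords_inner:
  assumes \<alpha>: "\<alpha> \<in> cotangent A p" and c: "c \<in> A" "p \<in> fst c"
  shows "covec_coords A c p \<alpha> \<bullet> a = \<alpha> (coord_vec A c p a)"
proof -
  have "linear (\<lambda>a. \<alpha> (coord_vec A c p a))"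
    by (rule linearI) (simp_all add: c coord_vec_add coord_vec_scaleR cotangent_add[OF \<alpha>] cotangent_scaleR[OF \<alpha>])
  from linear_expand_Basis[OF this, of a] show ?thesis
    by (simp add: covec_coords_def inner_sum_left inner_commute[of a] mult.commute)
qed

lemma cotangent_apply:
  assumes "\<alpha> \<in> cotangent A p" "c \<in> A" "p \<in> fst c" "v \<in> tangent A p"
  shows "\<alpha> v = covec_coords A c p \<alpha> \<bullet> v c"
  by (simp add: covec_coords_inner[OF assms(1-3)] coord_vec_eq[OF assms(4,2,3)])

lemma covec_covec_coords:
  "\<lbrakk>\<alpha> \<in> cotangent A p; c \<in> A; p \<in> fst c\<rbrakk> \<Longrightarrow> covec A c p (covec_coords A c p \<alpha>) = \<alpha>"
  by (rule cotangent_eqI) (auto simp: covec_cotangent covec_apply simp flip: cotangent_apply)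

lemma covec_coords_covec:
  assumes "c \<in> A" "p \<in> fst c"
  shows "covec_coords A c p (covec A c p y) = y"
  by (rule euclidean_eqI) (simp add: covec_coords_inner[OF covec_cotangent assms] covec_apply assms)

section \<open>Charts and topology of the cotangent bundle\<close>

abbreviation cobundle :: "('m \<times> ('m, 'e) covec, 'e \<times> 'e) chart set" where
  "cobundle \<equiv> cotangent_bundle A"

lemma fst_cotangent_chart: "q \<in> fst (cotangent_chart A c) \<longleftrightarrow> fst q \<in> fst c \<and> snd q \<in> cotangent A (fst q)"
  by (cases q) (simp add: cotangent_chart_def)

lemma snd_cotangent_chart:
  "snd (cotangent_chart A c) q = (snd c (fst q), covec_coords A c (fst q) (snd q))"
  by (cases q) (simp add: cotangent_chart_def)

lemma bundle_chart: "c \<in> A \<Longrightarrow> cotangent_chart A c \<in> cobundle"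
  by (simp add: cotangent_bundle_def)

lemma bundle_chartE:
  assumes "C \<in> cobundle"
  obtains c where "c \<in> A" "C = cotangent_chart A c"
  using assms by (auto simp: cotangent_bundle_def)

lemma points_bundle: "q \<in> points cobundle \<longleftrightarrow> fst q \<in> points A \<and> snd q \<in> cotangent A (fst q)"
  by (auto simp: points_def cotangent_bundle_def fst_cotangent_chart)

lemma inj_on_cotangent_chart:
  assumes c: "c \<in> A"
  shows "inj_on (snd (cotangent_chart A c)) (fst (cotangent_chart A c))"
proof (rule inj_onI)
  fix q q' assume q: "q \<in> fst (cotangent_chart A c)" "q' \<in> fst (cotangent_chart A c)"
    and eq: "snd (cotangent_chart A c) q = snd (cotangent_chart A c) q'"
  have fst: "fst q = fst q'"
    using eq q inj_onD[OF inj_on_chart[OF c]] by (simp add: snd_cotangent_chart fst_cotangent_chart)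
  have "snd q = covec A c (fst q) (covec_coords A c (fst q) (snd q))"
    using q c by (simp add: covec_covec_coords fst_cotangent_chart)
  also have "covec_coords A c (fst q) (snd q) = covec_coords A c (fst q') (snd q')"
    using eq by (simp add: snd_cotangent_chart)
  also have "covec A c (fst q) (covec_coords A c (fst q') (snd q')) = snd q'"
    using q c fst by (simp add: covec_covec_coords fst_cotangent_chart)
  finally show "q = q'" using fst by (simp add: prod_eqI)
qed

text \<open>Bundle charts contain whole fibres, on which \<open>covec\<close> provides all
  coordinate vectors.\<close>

lemma cotangent_chart_image:
  assumes c: "c \<in> A" and W: "W \<subseteq> fst c"
  shows "snd (cotangent_chart A c) ` {q \<in> fst (cotangent_chart A c). fst q \<in> W} = (snd c ` W) \<times> UNIV"
proof
  show "snd (cotangent_chart A c) ` {q \<in> fst (cotangent_chart A c). fst q \<in> W} \<subseteq> (snd c ` W) \<times> UNIV"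
    by (auto simp: snd_cotangent_chart)
  show "(snd c ` W) \<times> UNIV \<subseteq> snd (cotangent_chart A c) ` {q \<in> fst (cotangent_chart A c). fst q \<in> W}"
  proof clarify
    fix p y assume p: "p \<in> W"
    then have "snd (cotangent_chart A c) (p, covec A c p y) = (snd c p, y)"
      using c W by (auto simp: snd_cotangent_chart covec_coords_covec)
    moreover have "(p, covec A c p y) \<in> fst (cotangent_chart A c)"
      using p W by (auto simp: fst_cotangent_chart covec_cotangent)
    ultimately show "(snd c p, y) \<in> snd (cotangent_chart A c) ` {q \<in> fst (cotangent_chart A c). fst q \<in> W}"
      using p by (metis (mono_tags, lifting) fst_conv image_eqI mem_Collect_eq)
  qed
qed

lemma cotangent_chart_range:
  assumes c: "c \<in> A"
  shows "snd (cotangent_chart A c) ` fst (cotangent_chart A c) = (snd c ` fst c) \<times> UNIV"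
proof -
  have "{q \<in> fst (cotangent_chart A c). fst q \<in> fst c} = fst (cotangent_chart A c)"
    by (auto simp: fst_cotangent_chart)
  with cotangent_chart_image[OF c order_refl] show ?thesis by simp
qed

lemma cotangent_chart_Int:
  assumes c: "c \<in> A"
  shows "snd (cotangent_chart A c) ` (fst (cotangent_chart A c) \<inter> fst (cotangent_chart A d)) =
    (snd c ` (fst c \<inter> fst d)) \<times> UNIV"
proof -
  have "{q \<in> fst (cotangent_chart A c). fst q \<in> fst c \<inter> fst d} = fst (cotangent_chart A c) \<inter> fst (cotangent_chart A d)"
    by (auto simp: fst_cotangent_chart)
  with cotangent_chart_image[OF c Int_lower1, of "fst d"] show ?thesis by simp
qed

lemma chart_inv_cotangent_chart:
  assumes c: "c \<in> A" "p \<in> fst c"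
  shows "chart_inv (cotangent_chart A c) (snd c p, y) = (p, covec A c p y)"
proof -
  have "snd (cotangent_chart A c) (p, covec A c p y) = (snd c p, y)"
    using c by (auto simp: snd_cotangent_chart covec_coords_covec)
  moreover have "(p, covec A c p y) \<in> fst (cotangent_chart A c)"
    using c by (auto simp: fst_cotangent_chart covec_cotangent)
  ultimately show ?thesis
    unfolding chart_inv_def using inv_into_f_f[OF inj_on_cotangent_chart[OF c(1)]] by metis
qed

text \<open>Components of a covector change by the transpose of the derivative of the inverse
  transition map, taken at the image point.\<close>

lemma transition_cotangent_chart:
  assumes c: "c \<in> A" "p \<in> fst c" and d: "d \<in> A" "p \<in> fst d"
  shows "transition (cotangent_chart A c) (cotangent_chart A d) (snd c p, y) =
    (snd d p, \<Sum>l\<in>Basis. (y \<bullet> fderiv (transition d c) (snd d p) l) *\<^sub>R l)"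
  using c d
  by (simp add: transition_def chart_inv_cotangent_chart snd_cotangent_chart covec_coords_def[of A d]
      covec_apply coord_vec_chart)

lemma smooth_atlas_bundle: "smooth_atlas cobundle"
  unfolding smooth_atlas_def
proof (intro conjI ballI)
  fix C assume "C \<in> cobundle"
  then obtain c where c: "c \<in> A" "C = cotangent_chart A c" by (rule bundle_chartE)
  then show "inj_on (snd C) (fst C)" by (simp add: inj_on_cotangent_chart)
  fix E assume "E \<in> cobundle"
  then obtain d where d: "d \<in> A" "E = cotangent_chart A d" by (rule bundle_chartE)
  let ?S = "(snd c ` (fst c \<inter> fst d)) \<times> (UNIV :: 'e set)"
  have eq: "snd C ` (fst C \<inter> fst E) = ?S"
    using cotangent_chart_Int[OF c(1)] c d by simp
  have o: "open ?S" by (intro open_Times open_chart_Int c d open_UNIV)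
  show "open (snd C ` (fst C \<inter> fst E))" unfolding eq by (rule o)
  have fst: "smooth_on fst ?S" and snd: "smooth_on snd ?S"
    using smooth_on_fst[OF o smooth_on_ident[OF o]] smooth_on_snd[OF o smooth_on_ident[OF o]] by auto
  have t: "smooth_on (\<lambda>z. transition c d (fst z)) ?S"
    by (rule smooth_on_compose[OF o open_chart_Int _ smooth_on_transition fst]) (use c d in auto)
  \<comment> \<open>The point \<open>snd d p\<close> is written as
    \<open>transition c d (fst z)\<close>, a smooth function of the coordinates, so that derivatives
    taken there depend smoothly on z.\<close>
  have "smooth_on (\<lambda>z. (transition c d (fst z),
      \<Sum>l\<in>Basis. (snd z \<bullet> fderiv (transition d c) (transition c d (fst z)) l) *\<^sub>R l)) ?S"
    by (intro smooth_on_Pair t smooth_intros snd smooth_on_fderiv_transition o c(1) d(1))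
      (use c(1) d(1) in auto)
  then show "smooth_on (transition C E) (snd C ` (fst C \<inter> fst E))"
    unfolding eq
    by (rule smooth_on_cong[OF o, rotated]) (use c d in \<open>auto simp: transition_cotangent_chart\<close>)
qed

lemma atlas_open_vimage_fst:
  assumes W: "atlas_open A W"
  shows "atlas_open cobundle {q \<in> points cobundle. fst q \<in> W}"
  unfolding atlas_open_def
proof (intro conjI ballI)
  fix C assume "C \<in> cobundle"
  then obtain c where c: "c \<in> A" "C = cotangent_chart A c" by (rule bundle_chartE)
  have "{q \<in> points cobundle. fst q \<in> W} \<inter> fst C = {q \<in> fst (cotangent_chart A c). fst q \<in> W \<inter> fst c}"
    using c by (auto simp: points_bundle fst_cotangent_chart points_iff)
  then have "snd C ` ({q \<in> points cobundle. fst q \<in> W} \<inter> fst C) = (snd c ` (W \<inter> fst c)) \<times> UNIV"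
    using cotangent_chart_image[OF c(1) Int_lower2, of W] c(2) by simp
  moreover have "open (snd c ` (W \<inter> fst c))"
    by (intro open_chart_image atlas_open_Int W atlas_open_chart c Int_lower2)
  ultimately show "open (snd C ` ({q \<in> points cobundle. fst q \<in> W} \<inter> fst C))"
    by (simp add: open_Times)
qed auto

end

lemma (in atlas) atlas_bundle: "atlas (cotangent_bundle A)"
  by (rule atlas.intro) (rule smooth_atlas_bundle)

text \<open>Covectors at different points are separated by preimages of open sets of the base;
  covectors at the same point lie in a common chart, where the model space separates them.\<close>

lemma (in atlas) Hausdorff_bundle:
  assumes "Hausdorff_space (atlas_topology A)"
  shows "Hausdorff_space (atlas_topology cobundle)"
  unfolding Hausdorff_space_def openin_atlas_topology[OF smooth_atlas_bundle]
proof (intro allI impI, elim conjE)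
  interpret B: atlas cobundle by (rule atlas_bundle)
  fix q q' assume "q \<in> topspace (atlas_topology cobundle)" "q' \<in> topspace (atlas_topology cobundle)" "q \<noteq> q'"
  then have q: "q \<in> points cobundle" "q' \<in> points cobundle" by (simp_all add: B.topspace_atlas_topology)
  show "\<exists>U V. atlas_open cobundle U \<and> atlas_open cobundle V \<and> q \<in> U \<and> q' \<in> V \<and> disjnt U V"
  proof (cases "fst q = fst q'")
    case False
    then obtain U V where UV: "atlas_open A U" "atlas_open A V" "fst q \<in> U" "fst q' \<in> V" "disjnt U V"
      using assms q unfolding Hausdorff_space_def openin_atlas_topology[OF smooth_atlas] topspace_atlas_topology
      by (metis points_bundle)
    show ?thesis
      by (rule exI[of _ "{q \<in> points cobundle. fst q \<in> U}"], rule exI[of _ "{q \<in> points cobundle. fst q \<in> V}"])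
        (use UV q in \<open>auto simp: atlas_open_vimage_fst disjnt_def\<close>)
  next
    case True
    obtain c where c: "c \<in> A" "fst q \<in> fst c" using q points_bundle points_iff by blast
    let ?C = "cotangent_chart A c"
    have qc: "q \<in> fst ?C" "q' \<in> fst ?C" using q c True by (auto simp: fst_cotangent_chart points_bundle)
    then have ne: "snd ?C q \<noteq> snd ?C q'"
      using \<open>q \<noteq> q'\<close> inj_onD[OF inj_on_cotangent_chart[OF c(1)]] by blast
    obtain U V where UV: "open U" "open V" "snd ?C q \<in> U" "snd ?C q' \<in> V" "U \<inter> V = {}"
      using hausdorff[OF ne] by (elim exE conjE) (rule that)
    show ?thesis
    proof (intro exI conjI)
      show "atlas_open cobundle {q \<in> fst ?C. snd ?C q \<in> U}" "atlas_open cobundle {q \<in> fst ?C. snd ?C q \<in> V}"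
        by (intro B.atlas_open_vimage_chart bundle_chart c UV)+
    qed (use UV qc in \<open>auto simp: disjnt_def\<close>)
  qed
qed

text \<open>A Lindelof argument: one chart is picked for each basic open set that fits into some
  chart.\<close>

lemma (in atlas) countable_cover:
  assumes "second_countable (atlas_topology A)"
  obtains A' where "A' \<subseteq> A" "countable A'" "points A \<subseteq> (\<Union>c\<in>A'. fst c)"
proof -
  obtain \<B> where \<B>: "countable \<B>" "\<forall>U p. atlas_open A U \<and> p \<in> U \<longrightarrow> (\<exists>V\<in>\<B>. p \<in> V \<and> V \<subseteq> U)"
    using assms unfolding second_countable_def openin_atlas_topology[OF smooth_atlas]
    by (elim exE conjE) (rule that)
  define pick where "pick V = (SOME c. c \<in> A \<and> V \<subseteq> fst c)" for V :: "'m set"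
  let ?\<B> = "{V \<in> \<B>. \<exists>c\<in>A. V \<subseteq> fst c}"
  have pick: "pick V \<in> A \<and> V \<subseteq> fst (pick V)" if "V \<in> ?\<B>" for V
    unfolding pick_def by (rule someI_ex) (use that in blast)
  show thesis
  proof (rule that[of "pick ` ?\<B>"])
    show "pick ` ?\<B> \<subseteq> A" using pick by blast
    show "countable (pick ` ?\<B>)" using \<B>(1) by (intro countable_image countable_subset[OF _ \<B>(1)]) auto
    show "points A \<subseteq> (\<Union>c\<in>pick ` ?\<B>. fst c)"
    proof
      fix p assume "p \<in> points A"
      then obtain c where c: "c \<in> A" "p \<in> fst c" using points_iff by blast
      obtain V where V: "V \<in> \<B>" "p \<in> V" "V \<subseteq> fst c" using \<B>(2) atlas_open_chart[OF c(1)] c(2) by blast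
      then have "V \<in> ?\<B>" using c by blast
      then show "p \<in> (\<Union>c\<in>pick ` ?\<B>. fst c)" using pick[of V] V(2) by blast
    qed
  qed
qed

text \<open>A countable basis of the model space is pulled back along the countably many
  charts.\<close>

lemma (in atlas) second_countableI:
  assumes "A' \<subseteq> A" "countable A'" "points A \<subseteq> (\<Union>c\<in>A'. fst c)"
  shows "second_countable (atlas_topology A)"
proof -
  obtain \<B> :: "'e set set" where \<B>: "countable \<B>" "topological_basis \<B>"
    using ex_countable_basis by blast
  define \<C> where "\<C> = (\<lambda>(c, V). {p \<in> fst c. snd c p \<in> V}) ` (A' \<times> \<B>)"
  show ?thesis
    unfolding second_countable_def openin_atlas_topology[OF smooth_atlas]
  proof (intro exI conjI ballI allI impI)
    show "countable \<C>" unfolding \<C>_def using assms(2) \<B>(1) by (intro countable_image countable_SIGMA) auto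
    fix V assume "V \<in> \<C>"
    then show "atlas_open A V"
      unfolding \<C>_def using assms(1) topological_basis_open[OF \<B>(2)]
      by (auto intro!: atlas_open_vimage_chart)
  next
    fix U p assume U: "atlas_open A U \<and> p \<in> U"
    then obtain c where c: "c \<in> A'" "c \<in> A" "p \<in> fst c" using assms atlas_open_points by blast
    have "open (snd c ` (U \<inter> fst c))"
      using U c by (intro open_chart_image atlas_open_Int atlas_open_chart) auto
    then obtain V where V: "V \<in> \<B>" "snd c p \<in> V" "V \<subseteq> snd c ` (U \<inter> fst c)"
      using topological_basisE[OF \<B>(2), of "snd c ` (U \<inter> fst c)" "snd c p"] U c by blast
    have "{q \<in> fst c. snd c q \<in> V} \<subseteq> U"
    proof clarify
      fix q assume q: "q \<in> fst c" "snd c q \<in> V"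
      then obtain q' where "q' \<in> U" "q' \<in> fst c" "snd c q = snd c q'" using V(3) by blast
      then show "q \<in> U" using inj_onD[OF inj_on_chart[OF c(2)]] q(1) by metis
    qed
    moreover have "{q \<in> fst c. snd c q \<in> V} \<in> \<C>" unfolding \<C>_def using c V by force
    ultimately show "\<exists>V\<in>\<C>. p \<in> V \<and> V \<subseteq> U"
      by (intro bexI[of _ "{q \<in> fst c. snd c q \<in> V}"] conjI) (use c V in auto)
  qed
qed

lemma smooth_manifold_cotangent_bundle:
  assumes "smooth_manifold A"
  shows "smooth_manifold (cotangent_bundle A)"
proof -
  interpret atlas A using assms by (simp add: atlas_def smooth_manifold_def)
  interpret B: atlas cobundle by (rule atlas_bundle)
  obtain A' where A': "A' \<subseteq> A" "countable A'" "points A \<subseteq> (\<Union>c\<in>A'. fst c)"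
    using countable_cover assms by (auto simp: smooth_manifold_def)
  have "second_countable (atlas_topology cobundle)"
  proof (rule B.second_countableI)
    show "cotangent_chart A ` A' \<subseteq> cobundle" using A' by (auto simp: cotangent_bundle_def)
    show "countable (cotangent_chart A ` A')" using A' by blast
    show "points cobundle \<subseteq> (\<Union>C\<in>cotangent_chart A ` A'. fst C)"
      using A'(3) by (fastforce simp: points_bundle fst_cotangent_chart)
  qed
  then show ?thesis
    using assms Hausdorff_bundle smooth_atlas_bundle by (simp add: smooth_manifold_def)
qed

section \<open>Horizontal and vertical lifts\<close>

context manifold
begin

lemma manifold_bundle: "manifold cobundle"
  by (intro manifold.intro atlas_bundle manifold_axioms.intro Hausdorff_bundle Hausdorff)

end

context connection
begin

interpretation B: manifold cobundle by (rule manifold_bundle)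

lemma open_bundle_chart: "c \<in> A \<Longrightarrow> open ((snd c ` fst c) \<times> (UNIV :: 'e set))"
  by (intro open_Times open_chart_range open_UNIV)

lemma smooth_on_chart_times:
  assumes "c \<in> A" "smooth_on f (snd c ` fst c)"
  shows "smooth_on (\<lambda>z. f (fst z)) ((snd c ` fst c) \<times> (UNIV :: 'e set))"
  using open_bundle_chart[OF assms(1)] open_chart_range[OF assms(1)] assms(2)
  by (intro smooth_on_compose[OF _ _ _ assms(2)] smooth_on_fst smooth_on_ident) auto

lemma smooth_on_snd_times:
  assumes "c \<in> A"
  shows "smooth_on snd ((snd c ` fst c) \<times> (UNIV :: 'e set))"
  using smooth_on_snd[OF open_bundle_chart[OF assms] smooth_on_ident[OF open_bundle_chart[OF assms]]] .

section \<open>Test functions on the cotangent bundle and their derivatives\<close>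

lemma smooth_function_base:
  assumes f: "smooth_function A f"
  shows "smooth_function cobundle (\<lambda>q. f (fst q))"
proof (rule B.smooth_functionI)
  fix C assume "C \<in> cobundle"
  then obtain c where c: "c \<in> A" "C = cotangent_chart A c" by (rule bundle_chartE)
  show "smooth_on (\<lambda>z. f (fst (chart_inv C z))) (snd C ` fst C)"
    unfolding c(2) cotangent_chart_range[OF c(1)]
    by (rule smooth_on_cong[OF open_bundle_chart[OF c(1)] _ smooth_on_chart_times[OF c(1) smooth_functionD[OF f c(1)]]])
      (use c(1) in \<open>auto simp: chart_inv_cotangent_chart\<close>)
qed

lemma smooth_function_eval:
  assumes Z: "vector_field A Z"
  shows "smooth_function cobundle (\<lambda>q. snd q (Z (fst q)))"
proof (rule B.smooth_functionI)
  fix C assume "C \<in> cobundle"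
  then obtain c where c: "c \<in> A" "C = cotangent_chart A c" by (rule bundle_chartE)
  show "smooth_on (\<lambda>z. snd (chart_inv C z) (Z (fst (chart_inv C z)))) (snd C ` fst C)"
    unfolding c(2) cotangent_chart_range[OF c(1)]
  proof (rule smooth_on_cong[OF open_bundle_chart[OF c(1)]])
    show "smooth_on (\<lambda>z. snd z \<bullet> Z (chart_inv c (fst z)) c) ((snd c ` fst c) \<times> UNIV)"
      by (intro smooth_on_inner open_bundle_chart c(1) smooth_on_snd_times
          smooth_on_chart_times[OF c(1) vector_field_smooth[OF Z c(1)]])
  qed (use c(1) in \<open>auto simp: chart_inv_cotangent_chart covec_apply vector_field_tangent[OF Z]\<close>)
qed

lemma fderiv_base:
  assumes f: "smooth_function A f" and c: "c \<in> A" "p \<in> fst c"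
  shows "fderiv (\<lambda>z. f (fst (chart_inv (cotangent_chart A c) z))) (snd c p, y) (a, \<eta>) =
    fderiv (\<lambda>x. f (chart_inv c x)) (snd c p) a"
proof -
  have "((\<lambda>x. f (chart_inv c x)) has_derivative fderiv (\<lambda>x. f (chart_inv c x)) (snd c p)) (at (fst (snd c p, y)))"
    using smooth_function_has_derivative[OF f c] by simp
  from has_derivative_compose[OF has_derivative_fst[OF has_derivative_ident] this]
  have "((\<lambda>z. f (chart_inv c (fst z))) has_derivative (\<lambda>w. fderiv (\<lambda>x. f (chart_inv c x)) (snd c p) (fst w))) (at (snd c p, y))" .
  then have "((\<lambda>z. f (fst (chart_inv (cotangent_chart A c) z))) has_derivative
      (\<lambda>w. fderiv (\<lambda>x. f (chart_inv c x)) (snd c p) (fst w))) (at (snd c p, y))"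
    by (rule has_derivative_transform_within_open[OF _ open_bundle_chart[OF c(1)]])
      (use c in \<open>auto simp: chart_inv_cotangent_chart\<close>)
  then show ?thesis by (simp add: fderiv_eqI)
qed

lemma fderiv_eval:
  assumes Z: "vector_field A Z" and c: "c \<in> A" "p \<in> fst c"
  shows "fderiv (\<lambda>z. snd (chart_inv (cotangent_chart A c) z) (Z (fst (chart_inv (cotangent_chart A c) z))))
      (snd c p, y) (a, \<eta>) = \<eta> \<bullet> Z p c + y \<bullet> fderiv (\<lambda>x. Z (chart_inv c x) c) (snd c p) a"
proof -
  let ?Z = "\<lambda>x. Z (chart_inv c x) c"
  have "(?Z has_derivative fderiv ?Z (snd c p)) (at (snd c p))"
    by (rule smooth_on_has_derivative[OF vector_field_smooth[OF Z c(1)] open_chart_range[OF c(1)]]) (use c in blast)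
  then have "(?Z has_derivative fderiv ?Z (snd c p)) (at (fst (snd c p, y)))" by simp
  from has_derivative_compose[OF has_derivative_fst[OF has_derivative_ident] this]
  have "((\<lambda>z. ?Z (fst z)) has_derivative (\<lambda>w. fderiv ?Z (snd c p) (fst w))) (at (snd c p, y))" .
  from has_derivative_inner[OF has_derivative_snd[OF has_derivative_ident] this]
  have "((\<lambda>z. snd z \<bullet> ?Z (fst z)) has_derivative
      (\<lambda>w. y \<bullet> fderiv ?Z (snd c p) (fst w) + snd w \<bullet> Z p c)) (at (snd c p, y))"
    using c by simp
  then have "((\<lambda>z. snd (chart_inv (cotangent_chart A c) z) (Z (fst (chart_inv (cotangent_chart A c) z)))) has_derivative
      (\<lambda>w. y \<bullet> fderiv ?Z (snd c p) (fst w) + snd w \<bullet> Z p c)) (at (snd c p, y))"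
    by (rule has_derivative_transform_within_open[OF _ open_bundle_chart[OF c(1)]])
      (use c in \<open>auto simp: chart_inv_cotangent_chart covec_apply vector_field_tangent[OF Z]\<close>)
  then show ?thesis by (simp add: fderiv_eqI)
qed

text \<open>Tangency is asked at q alone, so this also applies to the constant map with a single
  vector as value and to fields known only at q.\<close>

lemma derivation_base:
  assumes f: "smooth_function A f" and c: "c \<in> A" "fst q \<in> fst c" and q: "q \<in> points cobundle"
    and \<xi>: "\<Xi> q \<in> tangent cobundle q"
  shows "derivation cobundle \<Xi> (\<lambda>q. f (fst q)) q =
    fderiv (\<lambda>x. f (chart_inv c x)) (snd c (fst q)) (fst (\<Xi> q (cotangent_chart A c)))"
proof -
  have "q \<in> fst (cotangent_chart A c)" using c q by (simp add: fst_cotangent_chart points_bundle)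
  from B.derivation_chart[of _ \<Xi>, OF smooth_function_base[OF f] \<xi> bundle_chart[OF c(1)] this]
  show ?thesis
    using fderiv_base[OF f c, of _ "fst (\<Xi> q (cotangent_chart A c))" "snd (\<Xi> q (cotangent_chart A c))"]
    by (simp add: snd_cotangent_chart)
qed

lemma derivation_eval:
  assumes Z: "vector_field A Z" and c: "c \<in> A" "fst q \<in> fst c" and q: "q \<in> points cobundle"
    and \<xi>: "\<Xi> q \<in> tangent cobundle q"
  shows "derivation cobundle \<Xi> (\<lambda>q. snd q (Z (fst q))) q =
    snd (\<Xi> q (cotangent_chart A c)) \<bullet> Z (fst q) c +
    covec_coords A c (fst q) (snd q) \<bullet> fderiv (\<lambda>x. Z (chart_inv c x) c) (snd c (fst q)) (fst (\<Xi> q (cotangent_chart A c)))"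
proof -
  have "q \<in> fst (cotangent_chart A c)" using c q by (simp add: fst_cotangent_chart points_bundle)
  from B.derivation_chart[of _ \<Xi>, OF smooth_function_eval[OF Z] \<xi> bundle_chart[OF c(1)] this]
  show ?thesis
    using fderiv_eval[OF Z c, of _ "fst (\<Xi> q (cotangent_chart A c))" "snd (\<Xi> q (cotangent_chart A c))"]
    by (simp add: snd_cotangent_chart)
qed

lemma bundle_chart_at: "\<lbrakk>q \<in> points cobundle; fst q \<in> fst c\<rbrakk> \<Longrightarrow> q \<in> fst (cotangent_chart A c)"
  by (simp add: fst_cotangent_chart points_bundle)

lemma bundle_tangent_eqI:
  assumes q: "q \<in> points cobundle" and t: "\<Xi> q \<in> tangent cobundle q" "\<Theta> q \<in> tangent cobundle q"
    and base: "\<And>f. smooth_function A f \<Longrightarrow>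
      derivation cobundle \<Xi> (\<lambda>q. f (fst q)) q = derivation cobundle \<Theta> (\<lambda>q. f (fst q)) q"
    and eval: "\<And>Z. vector_field A Z \<Longrightarrow>
      derivation cobundle \<Xi> (\<lambda>q. snd q (Z (fst q))) q = derivation cobundle \<Theta> (\<lambda>q. snd q (Z (fst q))) q"
  shows "\<Xi> q = \<Theta> q"
proof -
  obtain c where c: "c \<in> A" "fst q \<in> fst c" using q points_bundle points_iff by blast
  let ?C = "cotangent_chart A c"
  have 1: "fst (\<Xi> q ?C) = fst (\<Theta> q ?C)"
  proof (rule chart_vector_eqI[OF c])
    fix f assume f: "smooth_function A f"
    show "fderiv (\<lambda>x. f (chart_inv c x)) (snd c (fst q)) (fst (\<Xi> q ?C)) =
        fderiv (\<lambda>x. f (chart_inv c x)) (snd c (fst q)) (fst (\<Theta> q ?C))"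
      using base[OF f] derivation_base[of _ _ _ \<Xi>, OF f c q t(1)] derivation_base[of _ _ _ \<Theta>, OF f c q t(2)] by simp
  qed
  \<comment> \<open>The first halves being equal, the terms with the derivative of Z agree, and
    fields through the basis vectors read off the second halves.\<close>
  have 2: "snd (\<Xi> q ?C) = snd (\<Theta> q ?C)"
  proof (rule euclidean_eqI)
    fix b :: 'e
    obtain Z where Z: "vector_field A Z" "Z (fst q) = coord_vec A c (fst q) b"
      using vector_field_through[OF coord_vec_tangent[OF c]] .
    show "snd (\<Xi> q ?C) \<bullet> b = snd (\<Theta> q ?C) \<bullet> b"
      using eval[OF Z(1)] derivation_eval[of _ _ _ \<Xi>, OF Z(1) c q t(1)] derivation_eval[of _ _ _ \<Theta>, OF Z(1) c q t(2)]
      by (simp add: Z(2) c 1)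
  qed
  show ?thesis
    by (rule B.tangent_eqI[OF t bundle_chart[OF c(1)] bundle_chart_at[OF q c(2)]]) (rule prod_eqI[OF 1 2])
qed

text \<open>The fibre component of the horizontal lift at the covector with coordinates \<open>y\<close>.\<close>

definition hcomp :: "('m, 'e) chart \<Rightarrow> 'm \<Rightarrow> 'e \<Rightarrow> 'e \<Rightarrow> 'e" where
  "hcomp c p y a = (\<Sum>l\<in>Basis. (y \<bullet> connection_form c p a l) *\<^sub>R l)"

lemma hcomp_inner: "hcomp c p y a \<bullet> b = y \<bullet> connection_form c p a b"
proof -
  have "linear (\<lambda>b. y \<bullet> connection_form c p a b)"
    using linear_connection_form(2)[of c p a] by (simp add: linear_iff inner_add_right)
  from linear_expand_Basis[OF this, of b] show ?thesis
    by (simp add: hcomp_def inner_sum_left inner_commute[of b] mult.commute)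
qed

lemma linear_hcomp: "linear (hcomp c p y)"
  by (rule linearI; rule euclidean_eqI)
    (simp_all add: hcomp_inner inner_add_left inner_add_right linear_add[OF linear_connection_form(1)]
      linear_cmul[OF linear_connection_form(1)])

section \<open>The lifts in an arbitrary chart\<close>

lemma hlift_chart_at:
  fixes q defines "c \<equiv> chart_at A (fst q)"
  shows "hlift A D q u = coord_vec cobundle (cotangent_chart A c) q
    (u c, hcomp c (fst q) (covec_coords A c (fst q) (snd q)) (u c))"
proof -
  have "(\<Sum>i\<in>Basis. \<Sum>k\<in>Basis. (u c \<bullet> i) * (y \<bullet> k) * (christoffel A D c p i l \<bullet> k)) =
      y \<bullet> connection_form c p (u c) l" if "l \<in> Basis" for y p l
  proof -
    have "connection_form c p (u c) l = (\<Sum>i\<in>Basis. (u c \<bullet> i) *\<^sub>R christoffel A D c p i l)"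
      unfolding connection_form_def
    proof (rule sum.cong[OF refl])
      fix i
      have "(\<Sum>m\<in>Basis. ((u c \<bullet> i) * (l \<bullet> m)) *\<^sub>R christoffel A D c p i m) =
          (\<Sum>m\<in>Basis. if m = l then (u c \<bullet> i) *\<^sub>R christoffel A D c p i m else 0)"
        by (rule sum.cong[OF refl]) (use that in \<open>auto simp: inner_Basis\<close>)
      then show "(\<Sum>m\<in>Basis. ((u c \<bullet> i) * (l \<bullet> m)) *\<^sub>R christoffel A D c p i m) =
          (u c \<bullet> i) *\<^sub>R christoffel A D c p i l"
        using that by simp
    qed
    then have "y \<bullet> connection_form c p (u c) l = (\<Sum>i\<in>Basis. (u c \<bullet> i) * (y \<bullet> christoffel A D c p i l))"
      by (simp add: inner_sum_right)
    also have "\<dots> = (\<Sum>i\<in>Basis. (u c \<bullet> i) * (\<Sum>k\<in>Basis. (y \<bullet> k) * (christoffel A D c p i l \<bullet> k)))"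
      by (subst euclidean_inner[of y]) (rule refl)
    finally show ?thesis by (simp add: sum_distrib_left mult_ac)
  qed
  then show ?thesis
    by (simp add: hlift_def Let_def c_def hcomp_def)
qed

text \<open>The fibre component paired with Z gives the Christoffel term that the derivative of the
  components of Z lacks to be D U Z. No chart occurs on the right-hand sides, whence the invariance
  of the lift.\<close>

lemma derivation_hcomp:
  assumes q: "q \<in> points cobundle" and c: "c \<in> A" "fst q \<in> fst c" and U: "vector_field A U"
  defines "\<Xi> \<equiv> \<lambda>_. coord_vec cobundle (cotangent_chart A c) q
    (U (fst q) c, hcomp c (fst q) (covec_coords A c (fst q) (snd q)) (U (fst q) c))"
  shows "smooth_function A f \<Longrightarrow> derivation cobundle \<Xi> (\<lambda>q. f (fst q)) q = derivation A U f (fst q)"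
    and "vector_field A Z \<Longrightarrow> derivation cobundle \<Xi> (\<lambda>q. snd q (Z (fst q))) q = snd q (D U Z (fst q))"
proof -
  note C = bundle_chart[OF c(1)] bundle_chart_at[OF q c(2)]
  have t: "\<Xi> q \<in> tangent cobundle q"
    unfolding \<Xi>_def by (rule B.coord_vec_tangent[OF C])
  show "derivation cobundle \<Xi> (\<lambda>q. f (fst q)) q = derivation A U f (fst q)" if f: "smooth_function A f"
    using derivation_base[of _ _ _ \<Xi>, OF f c q t] derivation_vector_field[OF f U c] C by (simp add: \<Xi>_def)
  show "derivation cobundle \<Xi> (\<lambda>q. snd q (Z (fst q))) q = snd q (D U Z (fst q))" if Z: "vector_field A Z"
  proof -
    have "snd q (D U Z (fst q)) = covec_coords A c (fst q) (snd q) \<bullet> D U Z (fst q) c"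
      using q by (intro cotangent_apply D_tangent U Z c) (simp add: points_bundle)
    then show ?thesis
      using derivation_eval[of _ _ _ \<Xi>, OF Z c q t] C
      by (simp add: \<Xi>_def hcomp_inner D_chart[OF U Z c] inner_add_right)
  qed
qed

lemma hlift_chart:
  assumes q: "q \<in> points cobundle" and c: "c \<in> A" "fst q \<in> fst c" and u: "u \<in> tangent A (fst q)"
  shows "hlift A D q u = coord_vec cobundle (cotangent_chart A c) q
    (u c, hcomp c (fst q) (covec_coords A c (fst q) (snd q)) (u c))"
proof -
  let ?\<Xi> = "\<lambda>c (_ :: 'm \<times> ('m, 'e) covec). coord_vec cobundle (cotangent_chart A c) q
    (u c, hcomp c (fst q) (covec_coords A c (fst q) (snd q)) (u c))"
  obtain U where U: "vector_field A U" "U (fst q) = u" using vector_field_through[OF u] .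
  have d: "chart_at A (fst q) \<in> A" "fst q \<in> fst (chart_at A (fst q))"
    using chart_at q points_bundle by blast+
  have t: "?\<Xi> c q \<in> tangent cobundle q" if "c \<in> A" "fst q \<in> fst c" for c
    by (rule B.coord_vec_tangent[OF bundle_chart[OF that(1)] bundle_chart_at[OF q that(2)]])
  have "?\<Xi> (chart_at A (fst q)) q = ?\<Xi> c q"
    by (rule bundle_tangent_eqI[of q "?\<Xi> (chart_at A (fst q))" "?\<Xi> c", OF q t[OF d] t[OF c]])
      (simp_all add: derivation_hcomp[OF q d U(1), unfolded U(2)] derivation_hcomp[OF q c U(1), unfolded U(2)])
  then show ?thesis by (simp add: hlift_chart_at)
qed

text \<open>The chart-free description here is that functions of the base point are sent to 0 and
  evaluation at Z is sent to \<open>\<beta> (Z (fst q))\<close>.\<close>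

lemma vlift_chart:
  assumes q: "q \<in> points cobundle" and c: "c \<in> A" "fst q \<in> fst c" and \<beta>: "\<beta> \<in> cotangent A (fst q)"
  shows "vlift A q \<beta> = coord_vec cobundle (cotangent_chart A c) q (0, covec_coords A c (fst q) \<beta>)"
proof -
  let ?\<Xi> = "\<lambda>c (_ :: 'm \<times> ('m, 'e) covec). coord_vec cobundle (cotangent_chart A c) q (0, covec_coords A c (fst q) \<beta>)"
  have d: "chart_at A (fst q) \<in> A" "fst q \<in> fst (chart_at A (fst q))"
    using chart_at q points_bundle by blast+
  have t: "?\<Xi> c q \<in> tangent cobundle q" if "c \<in> A" "fst q \<in> fst c" for c
    by (rule B.coord_vec_tangent[OF bundle_chart[OF that(1)] bundle_chart_at[OF q that(2)]])
  have base: "derivation cobundle (?\<Xi> c) (\<lambda>q. f (fst q)) q = 0"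
    if f: "smooth_function A f" and c: "c \<in> A" "fst q \<in> fst c" for f c
    using derivation_base[of _ _ _ "?\<Xi> c", OF f c q t[OF c]] bundle_chart[OF c(1)] bundle_chart_at[OF q c(2)]
      linear_0[OF has_derivative_linear[OF smooth_function_has_derivative[OF f c]]] by simp
  have eval: "derivation cobundle (?\<Xi> c) (\<lambda>q. snd q (Z (fst q))) q = \<beta> (Z (fst q))"
    if Z: "vector_field A Z" and c: "c \<in> A" "fst q \<in> fst c" for Z c
  proof -
    have "linear (fderiv (\<lambda>x. Z (chart_inv c x) c) (snd c (fst q)))"
      by (rule smooth_on_linear_fderiv[OF vector_field_smooth[OF Z c(1)] open_chart_range[OF c(1)]]) (use c in blast)
    then show ?thesis
      using derivation_eval[of _ _ _ "?\<Xi> c", OF Z c q t[OF c]] bundle_chart[OF c(1)] bundle_chart_at[OF q c(2)]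
        cotangent_apply[OF \<beta> c vector_field_tangent[OF Z]] by (simp add: linear_0)
  qed
  have "?\<Xi> (chart_at A (fst q)) q = ?\<Xi> c q"
    by (rule bundle_tangent_eqI[of q "?\<Xi> (chart_at A (fst q))" "?\<Xi> c", OF q t[OF d] t[OF c]]) (simp_all add: base eval d c)
  then show ?thesis by (simp add: vlift_def Let_def)
qed

definition lift :: "'m \<times> ('m, 'e) covec \<Rightarrow> ('m, 'e) tvec \<Rightarrow> ('m, 'e) covec \<Rightarrow>
    ('m \<times> ('m, 'e) covec, 'e \<times> 'e) tvec" where
  "lift q u \<beta> = (\<lambda>C. hlift A D q u C + vlift A q \<beta> C)"

lemma hlift_tangent:
  assumes "q \<in> points cobundle" "u \<in> tangent A (fst q)"
  shows "hlift A D q u \<in> tangent cobundle q"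
proof -
  obtain c where c: "c \<in> A" "fst q \<in> fst c" using assms(1) points_bundle points_iff by blast
  show ?thesis
    unfolding hlift_chart[OF assms(1) c assms(2)]
    by (rule B.coord_vec_tangent[OF bundle_chart[OF c(1)] bundle_chart_at[OF assms(1) c(2)]])
qed

lemma vlift_tangent:
  assumes "q \<in> points cobundle" "\<beta> \<in> cotangent A (fst q)"
  shows "vlift A q \<beta> \<in> tangent cobundle q"
proof -
  obtain c where c: "c \<in> A" "fst q \<in> fst c" using assms(1) points_bundle points_iff by blast
  show ?thesis
    unfolding vlift_chart[OF assms(1) c assms(2)]
    by (rule B.coord_vec_tangent[OF bundle_chart[OF c(1)] bundle_chart_at[OF assms(1) c(2)]])
qed

lemma lift_tangent:
  assumes "q \<in> points cobundle" "u \<in> tangent A (fst q)" "\<beta> \<in> cotangent A (fst q)"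
  shows "lift q u \<beta> \<in> tangent cobundle q"
  unfolding lift_def by (intro B.tangent_add hlift_tangent vlift_tangent assms)

text \<open>No chart of the bundle contains q, so each component is the default 0, whatever chart
  \<open>chart_at\<close> picks.\<close>

lemma hlift_outside: "q \<notin> points cobundle \<Longrightarrow> hlift A D q u = (\<lambda>_. 0)"
  by (auto simp: hlift_chart_at coord_vec_def B.points_iff fun_eq_iff)

lemma vlift_outside: "q \<notin> points cobundle \<Longrightarrow> vlift A q \<beta> = (\<lambda>_. 0)"
  by (auto simp: vlift_def Let_def coord_vec_def B.points_iff fun_eq_iff)

lemma lift_in_chart:
  assumes "q \<in> points cobundle" "u \<in> tangent A (fst q)" "\<beta> \<in> cotangent A (fst q)" "c \<in> A" "fst q \<in> fst c"
  shows "lift q u \<beta> (cotangent_chart A c) =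
    (u c, hcomp c (fst q) (covec_coords A c (fst q) (snd q)) (u c) + covec_coords A c (fst q) \<beta>)"
  using assms bundle_chart[OF assms(4)] bundle_chart_at[OF assms(1,5)]
  by (simp add: lift_def hlift_chart vlift_chart)

lemma lift_inject:
  assumes q: "q \<in> points cobundle" and u: "u \<in> tangent A (fst q)" "u' \<in> tangent A (fst q)"
    and \<beta>: "\<beta> \<in> cotangent A (fst q)" "\<beta>' \<in> cotangent A (fst q)" and eq: "lift q u \<beta> = lift q u' \<beta>'"
  shows "u = u' \<and> \<beta> = \<beta>'"
proof -
  obtain c where c: "c \<in> A" "fst q \<in> fst c" using q points_bundle points_iff by blast
  have eq': "lift q u \<beta> (cotangent_chart A c) = lift q u' \<beta>' (cotangent_chart A c)" using eq by simp
  then have 1: "u c = u' c"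
    by (simp add: lift_in_chart q u \<beta> c)
  have "covec_coords A c (fst q) \<beta> = covec_coords A c (fst q) \<beta>'"
    using eq' by (simp add: lift_in_chart q u \<beta> c 1)
  then have "\<beta> = \<beta>'"
    using covec_covec_coords[OF \<beta>(1) c] covec_covec_coords[OF \<beta>(2) c] by metis
  with tangent_eqI[OF u c 1] show ?thesis by blast
qed

text \<open>The splitting made explicit: the first half is the base vector, and subtracting the
  fibre component of its horizontal lift from the second half leaves the coordinates of the
  covector.\<close>

lemma lift_coords:
  assumes q: "q \<in> points cobundle" and \<xi>: "\<xi> \<in> tangent cobundle q" and c: "c \<in> A" "fst q \<in> fst c"
  shows "\<xi> = lift q (coord_vec A c (fst q) (fst (\<xi> (cotangent_chart A c))))
    (covec A c (fst q) (snd (\<xi> (cotangent_chart A c)) -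
      hcomp c (fst q) (covec_coords A c (fst q) (snd q)) (fst (\<xi> (cotangent_chart A c)))))"
    (is "\<xi> = lift q ?u ?\<beta>")
proof (rule B.tangent_eqI[OF \<xi> lift_tangent[OF q _ covec_cotangent] bundle_chart[OF c(1)] bundle_chart_at[OF q c(2)]])
  show "\<xi> (cotangent_chart A c) = lift q ?u ?\<beta> (cotangent_chart A c)"
    using c by (simp add: lift_in_chart[OF q _ covec_cotangent c] covec_coords_covec)
qed (use c in simp)

lemma lift_cases:
  assumes "q \<in> points cobundle" "\<xi> \<in> tangent cobundle q"
  obtains u \<beta> where "u \<in> tangent A (fst q)" "\<beta> \<in> cotangent A (fst q)" "\<xi> = lift q u \<beta>"
proof -
  obtain c where c: "c \<in> A" "fst q \<in> fst c" using assms(1) points_bundle points_iff by blast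
  show thesis
    by (rule that[OF coord_vec_tangent[OF c] covec_cotangent lift_coords[OF assms c]])
qed

section \<open>Lifted fields: smoothness and action on test functions\<close>

lemma vector_field_hlift:
  assumes X: "vector_field A X"
  shows "vector_field cobundle (hlift_field A D X)"
  unfolding hlift_field_def
proof (rule B.vector_fieldI)
  show "hlift A D q (X (fst q)) \<in> tangent cobundle q" for q
    using hlift_tangent[OF _ vector_field_tangent[OF X]] hlift_outside B.tangent_0
    by (cases "q \<in> points cobundle") simp_all
  fix C assume "C \<in> cobundle"
  then obtain c where c: "c \<in> A" "C = cotangent_chart A c" by (rule bundle_chartE)
  let ?S = "(snd c ` fst c) \<times> (UNIV :: 'e set)"
  have con: "smooth_on (\<lambda>z. christoffel A D c (chart_inv c (fst z)) i l) ?S" for i l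
    by (rule smooth_on_chart_times[OF c(1) smooth_on_christoffel[OF c(1)]])
  have X': "smooth_on (\<lambda>z. X (chart_inv c (fst z)) c) ?S"
    by (rule smooth_on_chart_times[OF c(1) vector_field_smooth[OF X c(1)]])
  show "smooth_on (\<lambda>z. hlift A D (chart_inv C z) (X (fst (chart_inv C z))) C) (snd C ` fst C)"
    unfolding c(2) cotangent_chart_range[OF c(1)]
  proof (rule smooth_on_cong[OF open_bundle_chart[OF c(1)]])
    show "smooth_on (\<lambda>z. (X (chart_inv c (fst z)) c,
        hcomp c (chart_inv c (fst z)) (snd z) (X (chart_inv c (fst z)) c))) ?S"
      unfolding hcomp_def connection_form_def
      by (intro smooth_on_Pair X' smooth_intros con smooth_on_snd_times[OF c(1)] open_bundle_chart[OF c(1)])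
    fix z :: "'e \<times> 'e" assume "z \<in> ?S"
    then obtain p y where p: "p \<in> fst c" "z = (snd c p, y)" by auto
    have "(p, covec A c p y) \<in> points cobundle"
      using c p by (auto simp: points_bundle covec_cotangent points_iff)
    moreover have "(p, covec A c p y) \<in> fst (cotangent_chart A c)"
      using p by (simp add: fst_cotangent_chart covec_cotangent)
    ultimately show "(X (chart_inv c (fst z)) c, hcomp c (chart_inv c (fst z)) (snd z) (X (chart_inv c (fst z)) c)) =
        hlift A D (chart_inv (cotangent_chart A c) z) (X (fst (chart_inv (cotangent_chart A c) z))) (cotangent_chart A c)"
      using c(1) p bundle_chart[OF c(1)]
      by (simp add: chart_inv_cotangent_chart hlift_chart vector_field_tangent[OF X] covec_coords_covec)
  qed
qed

lemma vector_field_vlift: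
  assumes \<beta>: "one_form A \<beta>"
  shows "vector_field cobundle (vlift_field A \<beta>)"
  unfolding vlift_field_def
proof (rule B.vector_fieldI)
  have t: "\<beta> p \<in> cotangent A p" for p using \<beta> by (simp add: one_form_def)
  show "vlift A q (\<beta> (fst q)) \<in> tangent cobundle q" for q
    using vlift_tangent[OF _ t] vlift_outside B.tangent_0
    by (cases "q \<in> points cobundle") simp_all
  fix C assume "C \<in> cobundle"
  then obtain c where c: "c \<in> A" "C = cotangent_chart A c" by (rule bundle_chartE)
  let ?S = "(snd c ` fst c) \<times> (UNIV :: 'e set)"
  have "smooth_on (\<lambda>x. covec_coords A c (chart_inv c x) (\<beta> (chart_inv c x))) (snd c ` fst c)"
    unfolding covec_coords_def
    using \<beta> c(1) by (intro smooth_intros open_chart_range) (auto simp: one_form_def)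
  from smooth_on_chart_times[OF c(1) this]
  have sm: "smooth_on (\<lambda>z. covec_coords A c (chart_inv c (fst z)) (\<beta> (chart_inv c (fst z)))) ?S" .
  show "smooth_on (\<lambda>z. vlift A (chart_inv C z) (\<beta> (fst (chart_inv C z))) C) (snd C ` fst C)"
    unfolding c(2) cotangent_chart_range[OF c(1)]
  proof (rule smooth_on_cong[OF open_bundle_chart[OF c(1)]])
    show "smooth_on (\<lambda>z. (0 :: 'e, covec_coords A c (chart_inv c (fst z)) (\<beta> (chart_inv c (fst z))))) ?S"
      by (intro smooth_on_Pair sm smooth_on_const open_bundle_chart[OF c(1)])
    fix z :: "'e \<times> 'e" assume "z \<in> ?S"
    then obtain p y where p: "p \<in> fst c" "z = (snd c p, y)" by auto
    have "(p, covec A c p y) \<in> points cobundle"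
      using c p by (auto simp: points_bundle covec_cotangent points_iff)
    moreover have "(p, covec A c p y) \<in> fst (cotangent_chart A c)"
      using p by (simp add: fst_cotangent_chart covec_cotangent)
    ultimately show "(0, covec_coords A c (chart_inv c (fst z)) (\<beta> (chart_inv c (fst z)))) =
        vlift A (chart_inv (cotangent_chart A c) z) (\<beta> (fst (chart_inv (cotangent_chart A c) z))) (cotangent_chart A c)"
      using c(1) p bundle_chart[OF c(1)]
      by (simp add: chart_inv_cotangent_chart vlift_chart t)
  qed
qed

text \<open>Formulated for any \<open>\<Xi>\<close> whose value at q is the lift, in order to cover
  brackets, whose decomposition is known at one point only.\<close>

lemma derivation_lift:
  assumes q: "q \<in> points cobundle" and U: "vector_field A U" and \<beta>: "\<beta> \<in> cotangent A (fst q)"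
    and \<Xi>: "\<Xi> q = lift q (U (fst q)) \<beta>"
  shows "smooth_function A f \<Longrightarrow> derivation cobundle \<Xi> (\<lambda>q. f (fst q)) q = derivation A U f (fst q)"
    and "vector_field A Z \<Longrightarrow>
      derivation cobundle \<Xi> (\<lambda>q. snd q (Z (fst q))) q = snd q (D U Z (fst q)) + \<beta> (Z (fst q))"
proof -
  obtain c where c: "c \<in> A" "fst q \<in> fst c" using q points_bundle points_iff by blast
  note u = vector_field_tangent[OF U]
  have t: "\<Xi> q \<in> tangent cobundle q" unfolding \<Xi> by (rule lift_tangent[OF q u \<beta>])
  show "derivation cobundle \<Xi> (\<lambda>q. f (fst q)) q = derivation A U f (fst q)" if f: "smooth_function A f"
    using derivation_base[of _ _ _ \<Xi>, OF f c q t] derivation_vector_field[OF f U c]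
    by (simp add: \<Xi> lift_in_chart[OF q u \<beta> c])
  show "derivation cobundle \<Xi> (\<lambda>q. snd q (Z (fst q))) q = snd q (D U Z (fst q)) + \<beta> (Z (fst q))"
    if Z: "vector_field A Z"
  proof -
    have "snd q (D U Z (fst q)) = covec_coords A c (fst q) (snd q) \<bullet> D U Z (fst q) c"
      using q by (intro cotangent_apply D_tangent U Z c) (simp add: points_bundle)
    then show ?thesis
      using derivation_eval[of _ _ _ \<Xi>, OF Z c q t] cotangent_apply[OF \<beta> c vector_field_tangent[OF Z]]
      by (simp add: \<Xi> lift_in_chart[OF q u \<beta> c] hcomp_inner D_chart[OF U Z c] inner_add_left inner_add_right)
  qed
qed

end

section \<open>The Sasaki tensor\<close>

locale nondegenerate_connection = connection A D
  for A :: "('m, 'e::euclidean_space) chart set" and D :: "('m, 'e) connection" +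
  fixes h :: "('m, 'e) tensor"
  assumes h: "tensor_field A h" and nondegenerate: "nondegenerate A h"
begin

interpretation B: manifold cobundle by (rule manifold_bundle)

section \<open>The isomorphism induced by h and its inverse in charts\<close>

lemma lower_apply: "\<lbrakk>p \<in> points A; v \<in> tangent A p\<rbrakk> \<Longrightarrow> lower A h p u v = h p u v"
  by (simp add: lower_def)

lemma lower_cotangent: "u \<in> tangent A p \<Longrightarrow> lower A h p u \<in> cotangent A p"
  by (rule cotangentI) (auto simp: lower_def tensor_bilinear[OF h] tangent_add tangent_scaleR)

lemma inj_on_lower: "inj_on (lower A h p) (tangent A p)"
proof (cases "p \<in> points A")
  case False
  show ?thesis
  proof (rule inj_onI)
    fix u v assume u: "u \<in> tangent A p" and v: "v \<in> tangent A p"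
    show "u = v" using tangent_outside[OF False u] tangent_outside[OF False v] by simp
  qed
next
  case True
  show ?thesis
  proof (rule inj_onI)
    fix u v assume u: "u \<in> tangent A p" and v: "v \<in> tangent A p" and eq: "lower A h p u = lower A h p v"
    let ?w = "\<lambda>c. u c + (- 1) *\<^sub>R v c"
    have w: "?w \<in> tangent A p" by (intro tangent_add tangent_scaleR u v)
    have "h p ?w z = 0" if z: "z \<in> tangent A p" for z
    proof -
      have "h p ?w z = h p u z + (- 1) * h p v z"
        by (simp only: tensor_bilinear[OF h True] u v z tangent_scaleR)
      then show ?thesis using fun_cong[OF eq, of z] by (simp add: lower_apply True z)
    qed
    then have "?w = (\<lambda>_. 0)" using nondegenerate True w unfolding nondegenerate_def by blast
    then show "u = v" by (simp add: fun_eq_iff)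
  qed
qed

lemma raise_lower: "u \<in> tangent A p \<Longrightarrow> raise A h p (lower A h p u) = u"
  unfolding raise_def by (rule inv_into_f_f[OF inj_on_lower])

text \<open>The matrix of h in a chart. As in \<open>lower\<close>, the vector goes into the left
  slot, which matters because h is not symmetric.\<close>

definition lower_coords :: "('m, 'e) chart \<Rightarrow> 'm \<Rightarrow> 'e \<Rightarrow> 'e" where
  "lower_coords c p a = (\<Sum>l\<in>Basis. tensor_coords A h c p a l *\<^sub>R l)"

definition raise_coords :: "('m, 'e) chart \<Rightarrow> 'm \<Rightarrow> 'e \<Rightarrow> 'e" where
  "raise_coords c p = inv (lower_coords c p)"

lemma lower_coords_inner:
  assumes "c \<in> A" "p \<in> fst c"
  shows "lower_coords c p a \<bullet> b = tensor_coords A h c p a b"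
  using linear_expand_Basis[OF tensor_coords_linear(1)[OF h assms], of b a]
  by (simp add: lower_coords_def inner_sum_left inner_commute[of b] mult.commute)

lemma linear_lower_coords:
  assumes "c \<in> A" "p \<in> fst c"
  shows "linear (lower_coords c p)"
  by (rule linearI; rule euclidean_eqI)
    (simp_all add: lower_coords_inner[OF assms] inner_add_left
      linear_add[OF tensor_coords_linear(2)[OF h assms]] linear_cmul[OF tensor_coords_linear(2)[OF h assms]])

lemma covec_coords_lower:
  assumes u: "u \<in> tangent A p" and c: "c \<in> A" "p \<in> fst c"
  shows "covec_coords A c p (lower A h p u) = lower_coords c p (u c)"
proof (rule euclidean_eqI)
  fix b :: 'e
  have "p \<in> points A" using c points_iff by blast
  then show "covec_coords A c p (lower A h p u) \<bullet> b = lower_coords c p (u c) \<bullet> b"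
    using u c by (simp add: covec_coords_inner[OF lower_cotangent] lower_coords_inner lower_apply
        tensor_coords_def coord_vec_eq)
qed

text \<open>Injectivity comes from nondegeneracy in the left slot, and a linear injection of a
  finite-dimensional space into itself is onto. Surjectivity of \<open>lower\<close> has its source
  here.\<close>

lemma bij_lower_coords:
  assumes c: "c \<in> A" "p \<in> fst c"
  shows "bij (lower_coords c p)"
proof -
  have "inj (lower_coords c p)"
  proof (rule injI)
    fix a b assume eq: "lower_coords c p a = lower_coords c p b"
    note t = coord_vec_tangent[OF c]
    have "covec_coords A c p (lower A h p (coord_vec A c p a)) = covec_coords A c p (lower A h p (coord_vec A c p b))"
      using eq c by (simp add: covec_coords_lower)
    then have "lower A h p (coord_vec A c p a) = lower A h p (coord_vec A c p b)"
      using covec_covec_coords[OF lower_cotangent[OF t] c] by metis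
    then have "coord_vec A c p a = coord_vec A c p b" using inj_onD[OF inj_on_lower] t by blast
    then show "a = b" using coord_vec_same[OF c] by metis
  qed
  then show ?thesis
    using linear_injective_imp_surjective[OF linear_lower_coords[OF c]] by (simp add: bij_def)
qed

lemma raise_lower_coords:
  assumes "c \<in> A" "p \<in> fst c"
  shows "raise_coords c p (lower_coords c p a) = a" "lower_coords c p (raise_coords c p a) = a"
  using bij_lower_coords[OF assms]
  by (simp_all add: raise_coords_def bij_is_inj bij_is_surj surj_f_inv_f)

lemma linear_raise_coords:
  assumes "c \<in> A" "p \<in> fst c"
  shows "linear (raise_coords c p)"
proof (rule linearI)
  note L = linear_lower_coords[OF assms] and r = raise_lower_coords[OF assms]
  show "raise_coords c p (a + b) = raise_coords c p a + raise_coords c p b" for a b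
    using r(1)[of "raise_coords c p a + raise_coords c p b"] by (simp add: linear_add[OF L] r(2))
  show "raise_coords c p (s *\<^sub>R a) = s *\<^sub>R raise_coords c p a" for s a
    using r(1)[of "s *\<^sub>R raise_coords c p a"] by (simp add: linear_cmul[OF L] r(2))
qed

text \<open>The matrix of h is smooth and invertible at every point of the chart, hence so is its
  inverse.\<close>

lemma smooth_on_raise_coords:
  assumes c: "c \<in> A"
  shows "smooth_on (\<lambda>x. raise_coords c (chart_inv c x) e) (snd c ` fst c)"
proof (rule smooth_on_inverse_family[where H = "\<lambda>x. lower_coords c (chart_inv c x)"])
  note o = open_chart_range[OF c]
  show "open (snd c ` fst c)" by (rule o)
  have p: "chart_inv c x \<in> fst c" if "x \<in> snd c ` fst c" for x using that c by auto
  show "linear (lower_coords c (chart_inv c x))" if "x \<in> snd c ` fst c" for x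
    by (rule linear_lower_coords[OF c p[OF that]])
  show "raise_coords c (chart_inv c x) (lower_coords c (chart_inv c x) e) = e"
    "lower_coords c (chart_inv c x) (raise_coords c (chart_inv c x) e) = e" if "x \<in> snd c ` fst c" for x e
    by (rule raise_lower_coords[OF c p[OF that]])+
  show "smooth_on (\<lambda>x. lower_coords c (chart_inv c x) b) (snd c ` fst c)" for b
    unfolding lower_coords_def
    by (intro smooth_intros o smooth_on_tensor_coords[OF h c o _ smooth_on_ident[OF o]]) auto
qed

text \<open>Exhibits a preimage of \<open>\<beta>\<close> under \<open>lower\<close>, so that
  \<open>inv_into\<close> is a genuine inverse on the cotangent space.\<close>

lemma raise_eq:
  assumes \<beta>: "\<beta> \<in> cotangent A p" and c: "c \<in> A" "p \<in> fst c"
  shows "raise A h p \<beta> = coord_vec A c p (raise_coords c p (covec_coords A c p \<beta>))"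
proof -
  let ?u = "coord_vec A c p (raise_coords c p (covec_coords A c p \<beta>))"
  have u: "?u \<in> tangent A p" by (rule coord_vec_tangent[OF c])
  have "covec_coords A c p (lower A h p ?u) = covec_coords A c p \<beta>"
    using c by (simp add: covec_coords_lower[OF u c] raise_lower_coords)
  then have "lower A h p ?u = \<beta>"
    using covec_covec_coords[OF lower_cotangent[OF u] c] covec_covec_coords[OF \<beta> c] by metis
  then show ?thesis using raise_lower[OF u] by simp
qed

lemma raise_tangent:
  assumes "\<beta> \<in> cotangent A p" "p \<in> points A"
  shows "raise A h p \<beta> \<in> tangent A p" "lower A h p (raise A h p \<beta>) = \<beta>"
proof -
  obtain c where c: "c \<in> A" "p \<in> fst c" using assms(2) points_iff by blast
  show t: "raise A h p \<beta> \<in> tangent A p"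
    unfolding raise_eq[OF assms(1) c] by (rule coord_vec_tangent[OF c])
  have "covec_coords A c p (lower A h p (raise A h p \<beta>)) = covec_coords A c p \<beta>"
    unfolding covec_coords_lower[OF t c] using c by (simp add: raise_eq[OF assms(1) c] raise_lower_coords)
  then show "lower A h p (raise A h p \<beta>) = \<beta>"
    using covec_covec_coords[OF lower_cotangent[OF t] c] covec_covec_coords[OF assms(1) c] by metis
qed

text \<open>The raised covector stands in the slot that \<open>lower\<close> fills. This turns one
  of the two inverses in the Sasaki tensor into an evaluation.\<close>

lemma h_raise:
  assumes "\<alpha> \<in> cotangent A p" "v \<in> tangent A p" "p \<in> points A"
  shows "h p (raise A h p \<alpha>) v = \<alpha> v"
  using raise_tangent(2)[OF assms(1,3)] lower_apply[OF assms(3,2)] by metis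

lemma one_form_lower:
  assumes X: "vector_field A X"
  shows "one_form A (\<lambda>p. lower A h p (X p))"
  unfolding one_form_def
proof (intro conjI allI ballI)
  show "lower A h p (X p) \<in> cotangent A p" for p by (rule lower_cotangent[OF vector_field_tangent[OF X]])
  fix c and a :: 'e assume c: "c \<in> A"
  note o = open_chart_range[OF c]
  have "smooth_on (\<lambda>x. tensor_coords A h c (chart_inv c x) (X (chart_inv c x) c) a) (snd c ` fst c)"
    by (intro smooth_on_tensor_coords[OF h c o _ smooth_on_ident[OF o]] vector_field_smooth X c smooth_on_const o) auto
  then show "smooth_on (\<lambda>x. lower A h (chart_inv c x) (X (chart_inv c x)) (coord_vec A c (chart_inv c x) a)) (snd c ` fst c)"
  proof (rule smooth_on_cong[OF o, rotated])
    fix x assume "x \<in> snd c ` fst c"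
    then have p: "chart_inv c x \<in> fst c" using c by auto
    then have "chart_inv c x \<in> points A" using c points_iff by blast
    then show "tensor_coords A h c (chart_inv c x) (X (chart_inv c x) c) a =
        lower A h (chart_inv c x) (X (chart_inv c x)) (coord_vec A c (chart_inv c x) a)"
      using c p by (simp add: lower_apply tensor_coords_def coord_vec_eq[OF vector_field_tangent[OF X]])
  qed
qed

section \<open>The Sasaki tensor in charts and its nondegeneracy\<close>

text \<open>The splitting into lifts is unique by \<open>lift_inject\<close>, so the definite
  description has exactly one candidate.\<close>

lemma sasaki_lift:
  assumes q: "q \<in> points cobundle" and u: "u \<in> tangent A (fst q)" "v \<in> tangent A (fst q)"
    and \<alpha>: "\<alpha> \<in> cotangent A (fst q)" "\<beta> \<in> cotangent A (fst q)"
  shows "sasaki A h D q (lift q u \<alpha>) (lift q v \<beta>) =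
    h (fst q) u v + h (fst q) (raise A h (fst q) \<alpha>) (raise A h (fst q) \<beta>)"
  unfolding sasaki_def
proof (rule the_equality)
  show "\<exists>u' v' \<alpha>' \<beta>'. u' \<in> tangent A (fst q) \<and> v' \<in> tangent A (fst q) \<and>
      \<alpha>' \<in> cotangent A (fst q) \<and> \<beta>' \<in> cotangent A (fst q) \<and>
      lift q u \<alpha> = (\<lambda>C. hlift A D q u' C + vlift A q \<alpha>' C) \<and>
      lift q v \<beta> = (\<lambda>C. hlift A D q v' C + vlift A q \<beta>' C) \<and>
      h (fst q) u v + h (fst q) (raise A h (fst q) \<alpha>) (raise A h (fst q) \<beta>) =
      h (fst q) u' v' + h (fst q) (raise A h (fst q) \<alpha>') (raise A h (fst q) \<beta>')"
    by (rule exI[of _ u], rule exI[of _ v], rule exI[of _ \<alpha>], rule exI[of _ \<beta>]) (simp add: u \<alpha> lift_def)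
next
  fix r
  assume "\<exists>u' v' \<alpha>' \<beta>'. u' \<in> tangent A (fst q) \<and> v' \<in> tangent A (fst q) \<and>
      \<alpha>' \<in> cotangent A (fst q) \<and> \<beta>' \<in> cotangent A (fst q) \<and>
      lift q u \<alpha> = (\<lambda>C. hlift A D q u' C + vlift A q \<alpha>' C) \<and>
      lift q v \<beta> = (\<lambda>C. hlift A D q v' C + vlift A q \<beta>' C) \<and>
      r = h (fst q) u' v' + h (fst q) (raise A h (fst q) \<alpha>') (raise A h (fst q) \<beta>')"
  then obtain u' v' \<alpha>' \<beta>' where *: "u' \<in> tangent A (fst q)" "v' \<in> tangent A (fst q)"
      "\<alpha>' \<in> cotangent A (fst q)" "\<beta>' \<in> cotangent A (fst q)"
      "lift q u \<alpha> = lift q u' \<alpha>'" "lift q v \<beta> = lift q v' \<beta>'"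
      "r = h (fst q) u' v' + h (fst q) (raise A h (fst q) \<alpha>') (raise A h (fst q) \<beta>')"
    unfolding lift_def[symmetric] by (elim exE conjE) (rule that)
  have "u = u' \<and> \<alpha> = \<alpha>'" by (rule lift_inject[OF q u(1) *(1) \<alpha>(1) *(3) *(5)])
  moreover have "v = v' \<and> \<beta> = \<beta>'" by (rule lift_inject[OF q u(2) *(2) \<alpha>(2) *(4) *(6)])
  ultimately show "r = h (fst q) u v + h (fst q) (raise A h (fst q) \<alpha>) (raise A h (fst q) \<beta>)"
    using *(7) by simp
qed

text \<open>Coordinates of the covector in the vertical part of the tangent vector w, as found in
  \<open>lift_coords\<close>.\<close>

definition vertical :: "('m, 'e) chart \<Rightarrow> 'm \<Rightarrow> 'e \<Rightarrow> 'e \<times> 'e \<Rightarrow> 'e" where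
  "vertical c p y w = snd w - hcomp c p y (fst w)"

lemma linear_vertical: "linear (vertical c p y)"
  by (rule linearI)
    (simp_all add: vertical_def linear_add[OF linear_hcomp] linear_cmul[OF linear_hcomp] algebra_simps)

text \<open>By \<open>h_raise\<close> the vertical summand is the first covector evaluated at the
  raised second one, so a single inverse matrix appears. Bilinearity and smoothness are read off
  this formula.\<close>

lemma sasaki_coords:
  assumes q: "q \<in> points cobundle" and t: "\<xi> \<in> tangent cobundle q" "\<eta> \<in> tangent cobundle q"
    and c: "c \<in> A" "fst q \<in> fst c"
  defines "C \<equiv> cotangent_chart A c" and "y \<equiv> covec_coords A c (fst q) (snd q)"
  shows "sasaki A h D q \<xi> \<eta> = tensor_coords A h c (fst q) (fst (\<xi> C)) (fst (\<eta> C)) +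
    vertical c (fst q) y (\<xi> C) \<bullet> raise_coords c (fst q) (vertical c (fst q) y (\<eta> C))"
proof -
  have p: "fst q \<in> points A" using q points_bundle by blast
  let ?\<alpha> = "covec A c (fst q) (vertical c (fst q) y (\<xi> C))" and ?\<beta> = "covec A c (fst q) (vertical c (fst q) y (\<eta> C))"
  have "\<xi> = lift q (coord_vec A c (fst q) (fst (\<xi> C))) ?\<alpha>" "\<eta> = lift q (coord_vec A c (fst q) (fst (\<eta> C))) ?\<beta>"
    using lift_coords[OF q t(1) c] lift_coords[OF q t(2) c] unfolding vertical_def C_def y_def .
  then have "sasaki A h D q \<xi> \<eta> = sasaki A h D q (lift q (coord_vec A c (fst q) (fst (\<xi> C))) ?\<alpha>)
      (lift q (coord_vec A c (fst q) (fst (\<eta> C))) ?\<beta>)" by simp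
  also have "\<dots> = h (fst q) (coord_vec A c (fst q) (fst (\<xi> C))) (coord_vec A c (fst q) (fst (\<eta> C))) +
      h (fst q) (raise A h (fst q) ?\<alpha>) (raise A h (fst q) ?\<beta>)"
    by (rule sasaki_lift[OF q coord_vec_tangent[OF c] coord_vec_tangent[OF c] covec_cotangent covec_cotangent])
  also have "h (fst q) (raise A h (fst q) ?\<alpha>) (raise A h (fst q) ?\<beta>) = ?\<alpha> (raise A h (fst q) ?\<beta>)"
    by (rule h_raise[OF covec_cotangent raise_tangent(1)[OF covec_cotangent p] p])
  also have "\<dots> = vertical c (fst q) y (\<xi> C) \<bullet> raise_coords c (fst q) (vertical c (fst q) y (\<eta> C))"
    using c by (simp add: raise_eq[OF covec_cotangent c] covec_apply covec_coords_covec)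
  finally show ?thesis by (simp add: tensor_coords_def)
qed

lemma tensor_field_sasaki: "tensor_field cobundle (sasaki A h D)"
  unfolding tensor_field_def
proof (intro conjI ballI allI)
  fix q u v w r assume q: "q \<in> points cobundle"
    and t: "u \<in> tangent cobundle q" "v \<in> tangent cobundle q" "w \<in> tangent cobundle q"
  obtain c where c: "c \<in> A" "fst q \<in> fst c" using q points_bundle points_iff by blast
  note S = sasaki_coords[OF q _ _ c] and T = tensor_coords_linear[OF h c] and R = linear_raise_coords[OF c]
  note lin = linear_add[OF T(1)] linear_add[OF T(2)] linear_cmul[OF T(1)] linear_cmul[OF T(2)]
    linear_add[OF R] linear_cmul[OF R] linear_add[OF linear_vertical] linear_cmul[OF linear_vertical]
    B.tangent_add B.tangent_scaleR inner_add_left inner_add_right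
  show "sasaki A h D q (\<lambda>c. u c + v c) w = sasaki A h D q u w + sasaki A h D q v w"
    "sasaki A h D q w (\<lambda>c. u c + v c) = sasaki A h D q w u + sasaki A h D q w v"
    "sasaki A h D q (\<lambda>c. r *\<^sub>R u c) w = r * sasaki A h D q u w"
    "sasaki A h D q w (\<lambda>c. r *\<^sub>R u c) = r * sasaki A h D q w u"
    using t by (simp_all add: S lin algebra_simps)
next
  fix C and a b :: "'e \<times> 'e" assume "C \<in> cobundle"
  then obtain c where c: "c \<in> A" "C = cotangent_chart A c" by (rule bundle_chartE)
  let ?S = "(snd c ` fst c) \<times> (UNIV :: 'e set)"
  note o = open_bundle_chart[OF c(1)]
  have con: "smooth_on (\<lambda>z. christoffel A D c (chart_inv c (fst z)) i l) ?S" for i l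
    by (rule smooth_on_chart_times[OF c(1) smooth_on_christoffel[OF c(1)]])
  have vert: "smooth_on (\<lambda>z. vertical c (chart_inv c (fst z)) (snd z) a) ?S" for a
    unfolding vertical_def hcomp_def connection_form_def
    by (intro smooth_intros con smooth_on_snd_times[OF c(1)] o)
  show "smooth_on (\<lambda>z. sasaki A h D (chart_inv C z) (coord_vec cobundle C (chart_inv C z) a)
      (coord_vec cobundle C (chart_inv C z) b)) (snd C ` fst C)"
    unfolding c(2) cotangent_chart_range[OF c(1)]
  proof (rule smooth_on_cong[OF o])
    have "smooth_on (\<lambda>z. tensor_coords A h c (chart_inv c (fst z)) (fst a) (fst b)) ?S"
      by (rule smooth_on_tensor_coords[OF h c(1) o])
        (auto intro: smooth_on_const[OF o] smooth_on_fst[OF o smooth_on_ident[OF o]])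
    moreover have "smooth_on (\<lambda>z. raise_coords c (chart_inv c (fst z)) (vertical c (chart_inv c (fst z)) (snd z) b)) ?S"
      by (rule smooth_on_linear_family[OF o _ smooth_on_chart_times[OF c(1) smooth_on_raise_coords[OF c(1)]] vert])
        (use c(1) in \<open>auto intro!: linear_raise_coords\<close>)
    ultimately show "smooth_on (\<lambda>z. tensor_coords A h c (chart_inv c (fst z)) (fst a) (fst b) +
        vertical c (chart_inv c (fst z)) (snd z) a \<bullet>
        raise_coords c (chart_inv c (fst z)) (vertical c (chart_inv c (fst z)) (snd z) b)) ?S"
      by (intro smooth_on_add smooth_on_inner vert o)
    fix z :: "'e \<times> 'e" assume "z \<in> ?S"
    then obtain p y where p: "p \<in> fst c" "z = (snd c p, y)" by auto
    let ?q = "(p, covec A c p y)" and ?C = "cotangent_chart A c"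
    have q: "?q \<in> points cobundle"
      using c p by (auto simp: points_bundle covec_cotangent points_iff)
    have qC: "?q \<in> fst ?C" using p by (simp add: fst_cotangent_chart covec_cotangent)
    have pc: "fst ?q \<in> fst c" using p by simp
    show "tensor_coords A h c (chart_inv c (fst z)) (fst a) (fst b) +
        vertical c (chart_inv c (fst z)) (snd z) a \<bullet>
        raise_coords c (chart_inv c (fst z)) (vertical c (chart_inv c (fst z)) (snd z) b) =
      sasaki A h D (chart_inv ?C z) (coord_vec cobundle ?C (chart_inv ?C z) a) (coord_vec cobundle ?C (chart_inv ?C z) b)"
      using sasaki_coords[OF q B.coord_vec_tangent[OF bundle_chart[OF c(1)] qC] B.coord_vec_tangent[OF bundle_chart[OF c(1)] qC] c(1) pc, of a b]
        c(1) p B.coord_vec_same[OF bundle_chart[OF c(1)] qC]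
      by (simp add: chart_inv_cotangent_chart covec_coords_covec)
  qed
qed

text \<open>Pairing with horizontal lifts detects u, pairing with vertical lifts of lowered vectors
  detects the raised covector. Each slot of the Sasaki tensor reduces to the same slot of h.\<close>

lemma nondegenerate_sasaki: "nondegenerate cobundle (sasaki A h D)"
  unfolding nondegenerate_def
proof (intro ballI conjI impI)
  fix q \<xi> assume q: "q \<in> points cobundle" and \<xi>: "\<xi> \<in> tangent cobundle q"
  obtain u \<alpha> where u: "u \<in> tangent A (fst q)" and \<alpha>: "\<alpha> \<in> cotangent A (fst q)" and \<xi>_eq: "\<xi> = lift q u \<alpha>"
    using lift_cases[OF q \<xi>] .
  have p: "fst q \<in> points A" using q points_bundle by blast
  have nd: "\<lbrakk>w \<in> tangent A (fst q); \<forall>v\<in>tangent A (fst q). h (fst q) w v = 0\<rbrakk> \<Longrightarrow> w = (\<lambda>_. 0)"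
    "\<lbrakk>w \<in> tangent A (fst q); \<forall>v\<in>tangent A (fst q). h (fst q) v w = 0\<rbrakk> \<Longrightarrow> w = (\<lambda>_. 0)" for w
    using nondegenerate p unfolding nondegenerate_def by blast+
  let ?z = "\<lambda>_ :: ('m, 'e) chart. 0 :: 'e"
  \<comment> \<open>The zero covector, written as the image of the zero vector so that raising it is
    immediate.\<close>
  let ?\<zeta> = "lower A h (fst q) ?z"
  have z: "?z \<in> tangent A (fst q)" by (rule tangent_0)
  have hz: "h (fst q) ?z v = 0" "h (fst q) v ?z = 0" if "v \<in> tangent A (fst q)" for v
    using tensor_scaleR_left[OF h p that that, of 0] tensor_scaleR_right[OF h p that that, of 0] by simp_all
  have r: "raise A h (fst q) \<alpha> \<in> tangent A (fst q)" by (rule raise_tangent(1)[OF \<alpha> p])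
  have zero: "\<xi> = (\<lambda>_. 0)" if "u = ?z" "raise A h (fst q) \<alpha> = ?z"
  proof -
    have "\<alpha> = ?\<zeta>" using raise_tangent(2)[OF \<alpha> p] that(2) by simp
    obtain c where c: "c \<in> A" "fst q \<in> fst c" using p points_iff by blast
    have "\<xi> (cotangent_chart A c) = 0"
      unfolding \<xi>_eq lift_in_chart[OF q u \<alpha> c]
      using that(1) \<open>\<alpha> = ?\<zeta>\<close> linear_0[OF linear_hcomp] linear_0[OF linear_lower_coords[OF c]]
      by (simp add: covec_coords_lower[OF z c] zero_prod_def)
    then show ?thesis
      by (intro B.tangent_eqI[OF \<xi> B.tangent_0 bundle_chart[OF c(1)] bundle_chart_at[OF q c(2)]])
  qed
  show "\<xi> = (\<lambda>_. 0)" if *: "\<forall>\<eta>\<in>tangent cobundle q. sasaki A h D q \<xi> \<eta> = 0"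
  proof (rule zero)
    show "u = ?z"
    proof (rule nd(1)[OF u], rule ballI)
      fix v assume v: "v \<in> tangent A (fst q)"
      show "h (fst q) u v = 0"
        using *[rule_format, OF lift_tangent[OF q v lower_cotangent[OF z]]]
        by (simp add: \<xi>_eq sasaki_lift[OF q u v \<alpha> lower_cotangent[OF z]] raise_lower[OF z] hz r)
    qed
    show "raise A h (fst q) \<alpha> = ?z"
    proof (rule nd(1)[OF r], rule ballI)
      fix v assume v: "v \<in> tangent A (fst q)"
      show "h (fst q) (raise A h (fst q) \<alpha>) v = 0"
        using *[rule_format, OF lift_tangent[OF q z lower_cotangent[OF v]]]
        by (simp add: \<xi>_eq sasaki_lift[OF q u z \<alpha> lower_cotangent[OF v]] raise_lower[OF v] hz u)
    qed
  qed
  show "\<xi> = (\<lambda>_. 0)" if *: "\<forall>\<eta>\<in>tangent cobundle q. sasaki A h D q \<eta> \<xi> = 0"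
  proof (rule zero)
    show "u = ?z"
    proof (rule nd(2)[OF u], rule ballI)
      fix v assume v: "v \<in> tangent A (fst q)"
      show "h (fst q) v u = 0"
        using *[rule_format, OF lift_tangent[OF q v lower_cotangent[OF z]]]
        by (simp add: \<xi>_eq sasaki_lift[OF q v u lower_cotangent[OF z] \<alpha>] raise_lower[OF z] hz r)
    qed
    show "raise A h (fst q) \<alpha> = ?z"
    proof (rule nd(2)[OF r], rule ballI)
      fix v assume v: "v \<in> tangent A (fst q)"
      show "h (fst q) v (raise A h (fst q) \<alpha>) = 0"
        using *[rule_format, OF lift_tangent[OF q z lower_cotangent[OF v]]]
        by (simp add: \<xi>_eq sasaki_lift[OF q z u lower_cotangent[OF v] \<alpha>] raise_lower[OF v] hz u)
    qed
  qed
qed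

end

section \<open>The pull-back connection\<close>

locale flat_pullback = nondegenerate_connection A D h
  for A :: "('m, 'e::euclidean_space) chart set" and D :: "('m, 'e) connection" and h :: "('m, 'e) tensor" +
  fixes D' :: "('m \<times> ('m, 'e) covec, 'e \<times> 'e) connection"
  assumes flat: "flat A D" and pullback: "pullback_connection A h D D'"
begin

lemma connection_bundle: "connection cobundle D'"
  using pullback by (intro connection.intro manifold_bundle connection_axioms.intro)
    (simp add: pullback_connection_def)

interpretation B: connection cobundle D' by (rule connection_bundle)

text \<open>The vertical part is a lowered vector field. Every covector arises by lowering, and the
  two halves of such a pair obey the same rules.\<close>

definition lift_field :: "('m, 'e) vfield \<Rightarrow> ('m, 'e) vfield \<Rightarrow> ('m \<times> ('m, 'e) covec, 'e \<times> 'e) vfield" where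
  "lift_field X Y = (\<lambda>q. lift q (X (fst q)) (lower A h (fst q) (Y (fst q))))"

lemma lift_field_eq:
  "lift_field X Y = (\<lambda>q C. hlift_field A D X q C + vlift_field A (\<lambda>p. lower A h p (Y p)) q C)"
  by (simp add: lift_field_def lift_def hlift_field_def vlift_field_def)

lemma vector_field_lift_field:
  "\<lbrakk>vector_field A X; vector_field A Y\<rbrakk> \<Longrightarrow> vector_field cobundle (lift_field X Y)"
  unfolding lift_field_eq by (intro B.vector_field_add vector_field_hlift vector_field_vlift one_form_lower)

lemma form_connection_lower:
  assumes "vector_field A X" "vector_field A Y"
  shows "form_connection A h D X (\<lambda>p. lower A h p (Y p)) = (\<lambda>p. lower A h p (D X Y p))"
  by (simp add: form_connection_def raise_lower[OF vector_field_tangent[OF assms(2)]])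

lemma pullback_lift_field:
  assumes "vector_field A X" "vector_field A Y" "vector_field A X'" "vector_field A Y'"
  shows "D' (lift_field X Y) (lift_field X' Y') = lift_field (D X X') (D X Y')"
proof -
  let ?H = "hlift_field A D X" and ?H' = "hlift_field A D X'"
  let ?V = "vlift_field A (\<lambda>p. lower A h p (Y p))" and ?V' = "vlift_field A (\<lambda>p. lower A h p (Y' p))"
  note vf = vector_field_hlift vector_field_vlift[OF one_form_lower] B.vector_field_add assms
  note of = one_form_lower[OF assms(2)] one_form_lower[OF assms(4)]
  have pb: "D' ?H ?H' = hlift_field A D (D X X')"
    "D' ?H ?V' = vlift_field A (form_connection A h D X (\<lambda>p. lower A h p (Y' p)))"
    "D' ?V ?H' = (\<lambda>_ _. 0)" "D' ?V ?V' = (\<lambda>_ _. 0)"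
    using pullback assms of unfolding pullback_connection_def by blast+
  have "D' (lift_field X Y) (lift_field X' Y') =
      (\<lambda>q C. D' ?H (lift_field X' Y') q C + D' ?V (lift_field X' Y') q C)"
    unfolding lift_field_eq[of X Y] by (intro B.D_add_left vf vector_field_lift_field)
  moreover have "D' ?H (lift_field X' Y') = (\<lambda>q C. D' ?H ?H' q C + D' ?H ?V' q C)"
    unfolding lift_field_eq[of X' Y'] by (intro B.D_add_right vf)
  moreover have "D' ?V (lift_field X' Y') = (\<lambda>q C. D' ?V ?H' q C + D' ?V ?V' q C)"
    unfolding lift_field_eq[of X' Y'] by (intro B.D_add_right vf)
  ultimately show ?thesis
    by (simp add: pb form_connection_lower[OF assms(1,4)] lift_field_eq[of "D X X'"])
qed

lemma sasaki_lift_field: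
  assumes "q \<in> points cobundle" "vector_field A X" "vector_field A Y" "vector_field A X'" "vector_field A Y'"
  shows "sasaki A h D q (lift_field X Y q) (lift_field X' Y' q) =
    h (fst q) (X (fst q)) (X' (fst q)) + h (fst q) (Y (fst q)) (Y' (fst q))"
  unfolding lift_field_def
  using assms by (simp add: sasaki_lift lower_cotangent raise_lower vector_field_tangent)

lemma derivation_lift_field:
  assumes q: "q \<in> points cobundle" and X: "vector_field A X" and Y: "vector_field A Y"
  shows "smooth_function A f \<Longrightarrow> derivation cobundle (lift_field X Y) (\<lambda>q. f (fst q)) q = derivation A X f (fst q)"
    and "vector_field A Z \<Longrightarrow> derivation cobundle (lift_field X Y) (\<lambda>q. snd q (Z (fst q))) q =
      snd q (D X Z (fst q)) + h (fst q) (Y (fst q)) (Z (fst q))"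
proof -
  have p: "fst q \<in> points A" using q points_bundle by blast
  note * = derivation_lift[OF q X lower_cotangent[OF vector_field_tangent[OF Y]], of "lift_field X Y"]
  have eq: "lift_field X Y q = lift q (X (fst q)) (lower A h (fst q) (Y (fst q)))"
    by (simp add: lift_field_def)
  show "derivation cobundle (lift_field X Y) (\<lambda>q. f (fst q)) q = derivation A X f (fst q)" if "smooth_function A f"
    by (rule *(1)[OF eq that])
  show "derivation cobundle (lift_field X Y) (\<lambda>q. snd q (Z (fst q))) q =
      snd q (D X Z (fst q)) + h (fst q) (Y (fst q)) (Z (fst q))" if Z: "vector_field A Z"
    using *(2)[OF eq Z] by (simp add: lower_apply[OF p vector_field_tangent[OF Z]])
qed

section \<open>Bracket, curvature and Codazzi expression of lifts\<close>

text \<open>The form in which flatness is used, both for brackets of lifts and for the curvature on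
  lifts.\<close>

lemma D_commutator:
  assumes "vector_field A X" "vector_field A X'" "vector_field A Z"
  shows "D X (D X' Z) p = (\<lambda>c. D X' (D X Z) p c + D (lie_bracket A X X') Z p c)"
proof
  fix c
  have "curvature A D X X' Z p c = 0" using flat assms by (simp add: flat_def)
  then show "D X (D X' Z) p c = D X' (D X Z) p c + D (lie_bracket A X X') Z p c"
    by (simp add: curvature_def algebra_simps)
qed

text \<open>The bracket is identified through its action on test functions. Functions of the base
  point give the horizontal part; for evaluations the iterated derivatives of Z combine by
  \<open>D_commutator\<close>, and what is left over is the pairing with W. The field W may depend
  on q.\<close>

lemma lie_bracket_lift_field:
  assumes q: "q \<in> points cobundle" and X: "vector_field A X" "vector_field A Y" and X': "vector_field A X'" "vector_field A Y'"
  obtains W where "vector_field A W"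
    "lie_bracket cobundle (lift_field X Y) (lift_field X' Y') q = lift_field (lie_bracket A X X') W q"
    "\<forall>Z. vector_field A Z \<longrightarrow> h (fst q) (W (fst q)) (Z (fst q)) =
      derivation A X (\<lambda>p. h p (Y' p) (Z p)) (fst q) - derivation A X' (\<lambda>p. h p (Y p) (Z p)) (fst q)
      - h (fst q) (Y' (fst q)) (D X Z (fst q)) + h (fst q) (Y (fst q)) (D X' Z (fst q))"
proof -
  let ?G = "lift_field X Y" and ?G' = "lift_field X' Y'" and ?p = "fst q"
  let ?L = "lie_bracket cobundle ?G ?G'" and ?U = "lie_bracket A X X'"
  have p: "?p \<in> points A" and \<alpha>: "snd q \<in> cotangent A ?p" using q points_bundle by blast+
  have G: "vector_field cobundle ?G" "vector_field cobundle ?G'"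
    by (intro vector_field_lift_field X X')+
  have L: "vector_field cobundle ?L" by (rule B.vector_field_lie_bracket[OF G])
  have U: "vector_field A ?U" by (rule vector_field_lie_bracket[OF X(1) X'(1)])
  obtain u \<gamma> where u: "u \<in> tangent A ?p" and \<gamma>: "\<gamma> \<in> cotangent A ?p" and Lq: "?L q = lift q u \<gamma>"
    using lift_cases[OF q B.vector_field_tangent[OF L]] .
  obtain U' where U': "vector_field A U'" "U' ?p = u" using vector_field_through[OF u] .
  have LU': "?L q = lift q (U' ?p) \<gamma>" using Lq U'(2) by simp
  \<comment> \<open>Stated for arbitrary pairs because both orders of the two lifts occur in the
    commutator.\<close>
  have base2: "derivation cobundle (lift_field X Y) (derivation cobundle (lift_field X' Y') (\<lambda>q. f (fst q))) q =
      derivation A X (derivation A X' f) ?p"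
    if f: "smooth_function A f" and "vector_field A X" "vector_field A Y" "vector_field A X'" "vector_field A Y'"
    for f X Y X' Y'
  proof -
    note vf = that(2-)
    have "derivation cobundle (lift_field X Y) (derivation cobundle (lift_field X' Y') (\<lambda>q. f (fst q))) q =
        derivation cobundle (lift_field X Y) (\<lambda>q. derivation A X' f (fst q)) q"
      by (rule B.derivation_cong[OF B.smooth_function_derivation[OF smooth_function_base[OF f] vector_field_lift_field[OF vf(3,4)]]
            derivation_lift_field(1)[OF _ vf(3,4) f] vector_field_lift_field[OF vf(1,2)] q])
    also have "\<dots> = derivation A X (derivation A X' f) ?p"
      by (rule derivation_lift_field(1)[OF q vf(1,2) smooth_function_derivation[OF f vf(3)]])
    finally show ?thesis .
  qed
  have eval2: "derivation cobundle (lift_field X Y) (derivation cobundle (lift_field X' Y') (\<lambda>q. snd q (Z (fst q)))) q =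
      snd q (D X (D X' Z) ?p) + h ?p (Y ?p) (D X' Z ?p) + derivation A X (\<lambda>p. h p (Y' p) (Z p)) ?p"
    if Z: "vector_field A Z" and "vector_field A X" "vector_field A Y" "vector_field A X'" "vector_field A Y'"
    for Z X Y X' Y'
  proof -
    note vf = that(2-)
    have DZ: "vector_field A (D X' Z)" by (rule D_vector_field[OF vf(3) Z])
    have hYZ: "smooth_function A (\<lambda>p. h p (Y' p) (Z p))" by (rule smooth_function_tensor[OF h vf(4) Z])
    have "derivation cobundle (lift_field X Y) (derivation cobundle (lift_field X' Y') (\<lambda>q. snd q (Z (fst q)))) q =
        derivation cobundle (lift_field X Y) (\<lambda>q. snd q (D X' Z (fst q)) + h (fst q) (Y' (fst q)) (Z (fst q))) q"
      by (rule B.derivation_cong[OF B.smooth_function_derivation[OF smooth_function_eval[OF Z] vector_field_lift_field[OF vf(3,4)]]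
            derivation_lift_field(2)[OF _ vf(3,4) Z] vector_field_lift_field[OF vf(1,2)] q])
    also have "\<dots> = derivation cobundle (lift_field X Y) (\<lambda>q. snd q (D X' Z (fst q))) q +
        derivation cobundle (lift_field X Y) (\<lambda>q. h (fst q) (Y' (fst q)) (Z (fst q))) q"
      by (rule B.derivation_add[OF smooth_function_eval[OF DZ] smooth_function_base[OF hYZ] vector_field_lift_field[OF vf(1,2)] q])
    also have "\<dots> = snd q (D X (D X' Z) ?p) + h ?p (Y ?p) (D X' Z ?p) + derivation A X (\<lambda>p. h p (Y' p) (Z p)) ?p"
      by (simp add: derivation_lift_field(1)[OF q vf(1,2) hYZ] derivation_lift_field(2)[OF q vf(1,2) DZ])
    finally show ?thesis .
  qed
  have "U' ?p = ?U ?p"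
  proof (rule tangent_eqI_derivation[of U' ?p ?U, OF vector_field_tangent[OF U'(1)] vector_field_tangent[OF U] p])
    fix f assume f: "smooth_function A f"
    show "derivation A U' f ?p = derivation A ?U f ?p"
      using derivation_lift(1)[where \<Xi> = ?L, OF q U'(1) \<gamma> LU' f]
      by (simp add: B.derivation_lie_bracket[OF smooth_function_base[OF f] G q] base2 f X X'
          derivation_lie_bracket[OF f X(1) X'(1) p])
  qed
  then have LU: "?L q = lift q (?U ?p) \<gamma>" using LU' by simp
  \<comment> \<open>Only the value at the base point of q is prescribed, and the pairing formula
    speaks of that value alone.\<close>
  obtain W where W: "vector_field A W" "W ?p = raise A h ?p \<gamma>"
    using vector_field_through[OF raise_tangent(1)[OF \<gamma> p]] .
  show thesis
  proof (rule that[OF W(1)])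
    show "?L q = lift_field ?U W q"
      by (simp add: lift_field_def[of ?U W] W(2) raise_tangent(2)[OF \<gamma> p] LU)
    show "\<forall>Z. vector_field A Z \<longrightarrow> h ?p (W ?p) (Z ?p) =
      derivation A X (\<lambda>p. h p (Y' p) (Z p)) ?p - derivation A X' (\<lambda>p. h p (Y p) (Z p)) ?p
      - h ?p (Y' ?p) (D X Z ?p) + h ?p (Y ?p) (D X' Z ?p)"
    proof (intro allI impI)
      fix Z assume Z: "vector_field A Z"
      have "snd q (D X (D X' Z) ?p) = snd q (D X' (D X Z) ?p) + snd q (D ?U Z ?p)"
        unfolding D_commutator[OF X(1) X'(1) Z, of ?p]
        by (rule cotangent_add[OF \<alpha> D_tangent[OF X'(1) D_vector_field[OF X(1) Z]] D_tangent[OF U Z]])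
      moreover have "h ?p (W ?p) (Z ?p) = \<gamma> (Z ?p)"
        unfolding W(2) by (rule h_raise[OF \<gamma> vector_field_tangent[OF Z] p])
      ultimately show "h ?p (W ?p) (Z ?p) =
        derivation A X (\<lambda>p. h p (Y' p) (Z p)) ?p - derivation A X' (\<lambda>p. h p (Y p) (Z p)) ?p
        - h ?p (Y' ?p) (D X Z ?p) + h ?p (Y ?p) (D X' Z ?p)"
        using derivation_lift(2)[where \<Xi> = ?L, OF q U \<gamma> LU Z]
        by (simp add: B.derivation_lie_bracket[OF smooth_function_eval[OF Z] G q] eval2 Z X X')
    qed
  qed
qed

lemma lift_add:
  assumes q: "q \<in> points cobundle" and t: "u \<in> tangent A (fst q)" "u' \<in> tangent A (fst q)"
    "v \<in> tangent A (fst q)" "v' \<in> tangent A (fst q)"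
  shows "lift q (\<lambda>c. u c + u' c) (lower A h (fst q) (\<lambda>c. v c + v' c)) =
    (\<lambda>C. lift q u (lower A h (fst q) v) C + lift q u' (lower A h (fst q) v') C)"
proof -
  obtain c where c: "c \<in> A" "fst q \<in> fst c" using q points_bundle points_iff by blast
  note ta = tangent_add[OF t(1,2)] tangent_add[OF t(3,4)]
  show ?thesis
  proof (rule B.tangent_eqI[OF _ _ bundle_chart[OF c(1)] bundle_chart_at[OF q c(2)]])
    show "lift q (\<lambda>c. u c + u' c) (lower A h (fst q) (\<lambda>c. v c + v' c)) (cotangent_chart A c) =
        lift q u (lower A h (fst q) v) (cotangent_chart A c) + lift q u' (lower A h (fst q) v') (cotangent_chart A c)"
      by (simp add: lift_in_chart[OF q _ lower_cotangent c] t ta covec_coords_lower[OF _ c]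
          linear_add[OF linear_hcomp] linear_add[OF linear_lower_coords[OF c]])
  qed (intro lift_tangent B.tangent_add q t ta lower_cotangent)+
qed

text \<open>On lifts the connection differentiates both halves of a pair along the base field alone.
  So the vertical part W of the bracket leaves no trace, and each half satisfies
  \<open>D_commutator\<close>.\<close>

lemma curvature_lift_field:
  assumes q: "q \<in> points cobundle"
    and 1: "vector_field A X1" "vector_field A Y1" and 2: "vector_field A X2" "vector_field A Y2"
    and 3: "vector_field A X3" "vector_field A Y3"
  shows "curvature cobundle D' (lift_field X1 Y1) (lift_field X2 Y2) (lift_field X3 Y3) q = (\<lambda>_. 0)"
proof -
  let ?U = "lie_bracket A X1 X2"
  have U: "vector_field A ?U" by (rule vector_field_lie_bracket[OF 1(1) 2(1)])
  note G = vector_field_lift_field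
  obtain W where W: "vector_field A W"
    "lie_bracket cobundle (lift_field X1 Y1) (lift_field X2 Y2) q = lift_field ?U W q"
    using lie_bracket_lift_field[OF q 1 2] by metis
  \<comment> \<open>The bracket is known to be a lift at q only, which suffices because D' is
    tensorial in its first argument.\<close>
  have "D' (lie_bracket cobundle (lift_field X1 Y1) (lift_field X2 Y2)) (lift_field X3 Y3) q =
      D' (lift_field ?U W) (lift_field X3 Y3) q"
    by (rule B.D_pointwise[OF B.vector_field_lie_bracket[OF G[OF 1] G[OF 2]] G[OF U W(1)] G[OF 3] W(2) q])
  also have "\<dots> = lift_field (D ?U X3) (D ?U Y3) q"
    by (simp add: pullback_lift_field U W 3)
  finally have b: "D' (lie_bracket cobundle (lift_field X1 Y1) (lift_field X2 Y2)) (lift_field X3 Y3) q =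
      lift_field (D ?U X3) (D ?U Y3) q" .
  have "lift_field (D X1 (D X2 X3)) (D X1 (D X2 Y3)) q =
      (\<lambda>C. lift_field (D X2 (D X1 X3)) (D X2 (D X1 Y3)) q C + lift_field (D ?U X3) (D ?U Y3) q C)"
    unfolding lift_field_def D_commutator[OF 1(1) 2(1) 3(1)] D_commutator[OF 1(1) 2(1) 3(2)]
    by (intro lift_add q D_tangent D_vector_field 1 2 3 U)
  then show ?thesis
    unfolding curvature_def b
    by (simp add: pullback_lift_field D_vector_field 1 2 3)
qed

text \<open>The expression splits into a part in the base fields X1, X2, X3, which is 0 by
  hypothesis, and a part in Y1, Y2, Y3. The bracket contributes h (W, Y3) to the latter, and the
  pairing formula with Z = Y3 cancels everything there.\<close>

lemma codazzi_lift_field: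
  assumes q: "q \<in> points cobundle" and codazzi: "codazzi h X1 X2 X3 (fst q) = 0"
    and 1: "vector_field A X1" "vector_field A Y1" and 2: "vector_field A X2" "vector_field A Y2"
    and 3: "vector_field A X3" "vector_field A Y3"
  shows "B.codazzi (sasaki A h D) (lift_field X1 Y1) (lift_field X2 Y2) (lift_field X3 Y3) q = 0"
proof -
  let ?U = "lie_bracket A X1 X2" and ?p = "fst q"
  have p: "?p \<in> points A" using q points_bundle by blast
  have U: "vector_field A ?U" by (rule vector_field_lie_bracket[OF 1(1) 2(1)])
  note G = vector_field_lift_field
  obtain W where W: "vector_field A W"
    "lie_bracket cobundle (lift_field X1 Y1) (lift_field X2 Y2) q = lift_field ?U W q"
    and hW: "\<forall>Z. vector_field A Z \<longrightarrow> h ?p (W ?p) (Z ?p) =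
      derivation A X1 (\<lambda>p. h p (Y2 p) (Z p)) ?p - derivation A X2 (\<lambda>p. h p (Y1 p) (Z p)) ?p
      - h ?p (Y2 ?p) (D X1 Z ?p) + h ?p (Y1 ?p) (D X2 Z ?p)"
    using lie_bracket_lift_field[OF q 1 2] .
  have d: "derivation cobundle (lift_field X Y) (\<lambda>q. sasaki A h D q (lift_field X' Y' q) (lift_field X3 Y3 q)) q =
      derivation A X (\<lambda>p. h p (X' p) (X3 p)) ?p + derivation A X (\<lambda>p. h p (Y' p) (Y3 p)) ?p"
    if "vector_field A X" "vector_field A Y" "vector_field A X'" "vector_field A Y'" for X Y X' Y'
  proof -
    note s = smooth_function_tensor[OF h that(3) 3(1)] smooth_function_tensor[OF h that(4) 3(2)]
    have "derivation cobundle (lift_field X Y) (\<lambda>q. sasaki A h D q (lift_field X' Y' q) (lift_field X3 Y3 q)) q =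
        derivation cobundle (lift_field X Y) (\<lambda>q. h (fst q) (X' (fst q)) (X3 (fst q)) + h (fst q) (Y' (fst q)) (Y3 (fst q))) q"
      by (rule B.derivation_cong[OF B.smooth_function_tensor[OF tensor_field_sasaki G[OF that(3,4)] G[OF 3]]
            sasaki_lift_field[OF _ that(3,4) 3] G[OF that(1,2)] q])
    also have "\<dots> = derivation A X (\<lambda>p. h p (X' p) (X3 p) + h p (Y' p) (Y3 p)) ?p"
      by (rule derivation_lift_field(1)[OF q that(1,2) smooth_function_add[OF s]])
    also have "\<dots> = derivation A X (\<lambda>p. h p (X' p) (X3 p)) ?p + derivation A X (\<lambda>p. h p (Y' p) (Y3 p)) ?p"
      by (rule derivation_add[OF s that(1) p])
    finally show ?thesis .
  qed
  show ?thesis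
    using codazzi hW[rule_format, OF 3(2)]
    unfolding B.codazzi_def codazzi_def
    by (simp add: d[OF 1 2] d[OF 2 1] W(2) pullback_lift_field 1 2 3 sasaki_lift_field[OF q] D_vector_field U W(1))
qed

section \<open>From lifts to arbitrary vector fields\<close>

text \<open>A tangent vector of the bundle splits into a base vector and a covector; global fields
  pass through the former and through the raised latter. Agreement at q is what the tensorial
  expressions ask for.\<close>

lemma lift_field_through:
  assumes q: "q \<in> points cobundle" and \<Xi>: "vector_field cobundle \<Xi>"
  obtains X Y where "vector_field A X" "vector_field A Y" "\<Xi> q = lift_field X Y q"
proof -
  have p: "fst q \<in> points A" using q points_bundle by blast
  obtain u \<beta> where u: "u \<in> tangent A (fst q)" and \<beta>: "\<beta> \<in> cotangent A (fst q)" and eq: "\<Xi> q = lift q u \<beta>"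
    using lift_cases[OF q B.vector_field_tangent[OF \<Xi>]] .
  obtain X where X: "vector_field A X" "X (fst q) = u" using vector_field_through[OF u] .
  obtain Y where Y: "vector_field A Y" "Y (fst q) = raise A h (fst q) \<beta>"
    using vector_field_through[OF raise_tangent(1)[OF \<beta> p]] .
  show thesis
    by (rule that[OF X(1) Y(1)]) (simp add: lift_field_def X(2) Y(2) raise_tangent(2)[OF \<beta> p] eq)
qed

lemma flat_bundle: "flat cobundle D'"
  unfolding flat_def
proof (intro allI impI, elim conjE, rule ext)
  fix \<Xi> \<Theta> \<Psi> q assume vf: "vector_field cobundle \<Xi>" "vector_field cobundle \<Theta>" "vector_field cobundle \<Psi>"
  show "curvature cobundle D' \<Xi> \<Theta> \<Psi> q = (\<lambda>_. 0)"
  proof (cases "q \<in> points cobundle")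
    case q: True
    obtain X1 Y1 where 1: "vector_field A X1" "vector_field A Y1" "\<Xi> q = lift_field X1 Y1 q"
      using lift_field_through[OF q vf(1)] .
    obtain X2 Y2 where 2: "vector_field A X2" "vector_field A Y2" "\<Theta> q = lift_field X2 Y2 q"
      using lift_field_through[OF q vf(2)] .
    obtain X3 Y3 where 3: "vector_field A X3" "vector_field A Y3" "\<Psi> q = lift_field X3 Y3 q"
      using lift_field_through[OF q vf(3)] .
    have "curvature cobundle D' \<Xi> \<Theta> \<Psi> q =
        curvature cobundle D' (lift_field X1 Y1) (lift_field X2 Y2) (lift_field X3 Y3) q"
      by (intro B.curvature_pointwise vf vector_field_lift_field 1 2 3 q)
    then show ?thesis using curvature_lift_field[OF q 1(1,2) 2(1,2) 3(1,2)] by simp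
  next
    \<comment> \<open>Flatness is an equality of functions on all pairs, so points off the bundle
      are included; every vector field is 0 there.\<close>
    case False
    then have "\<And>\<Xi>. vector_field cobundle \<Xi> \<Longrightarrow> \<Xi> q = (\<lambda>_. 0)" by (rule B.vector_field_outside[rotated])
    then show ?thesis
      by (simp add: curvature_def vf B.D_vector_field B.vector_field_lie_bracket)
  qed
qed

lemma quasi_statistical_bundle:
  assumes "quasi_statistical A h D"
  shows "quasi_statistical cobundle (sasaki A h D) D'"
  unfolding quasi_statistical_def
proof (intro conjI allI impI ballI)
  show "smooth_manifold cobundle"
    using assms smooth_manifold_cotangent_bundle by (auto simp: quasi_statistical_def)
  show "tensor_field cobundle (sasaki A h D)" by (rule tensor_field_sasaki)
  show "nondegenerate cobundle (sasaki A h D)" by (rule nondegenerate_sasaki)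
  show "affine_connection cobundle D'" by (rule B.affine)
  fix \<Xi> \<Theta> \<Psi> q
  assume "vector_field cobundle \<Xi> \<and> vector_field cobundle \<Theta> \<and> vector_field cobundle \<Psi>"
  then have vf: "vector_field cobundle \<Xi>" "vector_field cobundle \<Theta>" "vector_field cobundle \<Psi>" by blast+
  assume q: "q \<in> points cobundle"
  then have p: "fst q \<in> points A" using points_bundle by blast
  obtain X1 Y1 where 1: "vector_field A X1" "vector_field A Y1" "\<Xi> q = lift_field X1 Y1 q"
    using lift_field_through[OF q vf(1)] .
  obtain X2 Y2 where 2: "vector_field A X2" "vector_field A Y2" "\<Theta> q = lift_field X2 Y2 q"
    using lift_field_through[OF q vf(2)] .
  obtain X3 Y3 where 3: "vector_field A X3" "vector_field A Y3" "\<Psi> q = lift_field X3 Y3 q"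
    using lift_field_through[OF q vf(3)] .
  \<comment> \<open>The quasi-statistical condition of the base enters here, rewritten without the
    torsion.\<close>
  have "codazzi h X1 X2 X3 (fst q) = 0"
    using assms 1 2 3 p codazzi_eq_cov_deriv[OF h 1(1) 2(1) 3(1) p] by (simp add: quasi_statistical_def)
  then have "B.codazzi (sasaki A h D) (lift_field X1 Y1) (lift_field X2 Y2) (lift_field X3 Y3) q = 0"
    by (intro codazzi_lift_field q 1 2 3)
  moreover have "B.codazzi (sasaki A h D) \<Xi> \<Theta> \<Psi> q =
      B.codazzi (sasaki A h D) (lift_field X1 Y1) (lift_field X2 Y2) (lift_field X3 Y3) q"
    by (intro B.codazzi_pointwise tensor_field_sasaki vf vector_field_lift_field 1 2 3 q)
  ultimately show "cov_deriv cobundle D' (sasaki A h D) \<Xi> \<Theta> \<Psi> q - cov_deriv cobundle D' (sasaki A h D) \<Theta> \<Xi> \<Psi> q +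
      sasaki A h D q (torsion cobundle D' \<Xi> \<Theta> q) (\<Psi> q) = 0"
    by (simp add: B.codazzi_eq_cov_deriv[OF tensor_field_sasaki vf q])
qed

end

theorem theorem4p7:
  fixes A :: "('m, 'e::euclidean_space) chart set"
    and h :: "('m, 'e) tensor"
    and D :: "('m, 'e) connection"
    and D' :: "('m \<times> ('m, 'e) covec, 'e \<times> 'e) connection"
  assumes "quasi_statistical A h D"
    and "flat A D"
    and "pullback_connection A h D D'"
  shows "quasi_statistical (cotangent_bundle A) (sasaki A h D) D' \<and>
         flat (cotangent_bundle A) D'"
proof -
  interpret flat_pullback A D h D'
    using assms
    by unfold_locales (auto simp: quasi_statistical_def smooth_manifold_def)
  show ?thesis
    using flat_bundle quasi_statistical_bundle[OF assms(1)] by blast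
qed

end
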